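(* Let $\Gamma$ be a $\mathcal{C}^1$-smooth closed curve in $\mathbb{C}^2$ and let $f:\mathbb{C}^2\setminus\Gamma\to\mathbb{P}(l^2)$ be a holomorphic map. Then $f$ extends meromorphically to the whole of $\mathbb{C}^2$.
   Context: $l^2$ is the Hilbert space of square-summable complex sequences; $\mathbb{P}(l^2)=(l^2\setminus\{0\})/(w\sim\lambda w,\ \lambda\neq0)$ with canonical projection $\pi:l^2\setminus\{0\}\to\mathbb{P}(l^2)$, a complex Hilbert manifold with affine charts $\{w_k\ne0\}\to l^2$, $[w]\mapsto(w_j/w_k)_{j\neq k}$. A meromorphic map from a complex manifold $\mathcal{X}$ to $\mathbb{P}(l^2)$ is given by a holomorphic map $f:\mathcal{X}\setminus I\to\mathbb{P}(l^2)$, where $I\subset\mathcal{X}$ is an analytic subset of codimension $\ge2$, such that every $a\in I$ has a neighbourhood $\mathcal{V}$ and a holomorphic map $\phi=(\phi_0,\phi_1,\dots):\mathcal{V}\to l^2$ with $f(z)=\pi(\phi(z))=[\phi_0(z):\phi_1(z):\dots]$ for $z\in\mathcal{V}\setminus I$. (For $\mathcal{X}=\mathbb{C}^2$ the set $I$ is discrete.) *)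

theory Defs
  imports "HOL-Analysis.Analysis"
begin

section \<open>Complex normed spaces and holomorphic maps between them\<close>

class complex_normed_vector = real_normed_vector +
  fixes scaleC :: "complex \<Rightarrow> 'a \<Rightarrow> 'a"  (infixr \<open>*\<^sub>C\<close> 75)
  assumes scaleC_add_right: "c *\<^sub>C (x + y) = c *\<^sub>C x + c *\<^sub>C y"
    and scaleC_add_left: "(c + d) *\<^sub>C x = c *\<^sub>C x + d *\<^sub>C x"
    and scaleC_scaleC: "c *\<^sub>C d *\<^sub>C x = (c * d) *\<^sub>C x"
    and scaleR_scaleC: "r *\<^sub>R x = complex_of_real r *\<^sub>C x"
    and norm_scaleC: "norm (c *\<^sub>C x) = cmod c * norm x"

lemma scaleC_one [simp]: "1 *\<^sub>C (x :: 'a :: complex_normed_vector) = x"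
  using scaleR_scaleC[of 1 x] by simp

lemma scaleC_zero_left [simp]: "0 *\<^sub>C (x :: 'a :: complex_normed_vector) = 0"
  using scaleR_scaleC[of 0 x] by simp

lemma scaleC_eq_0_iff [simp]:
  "c *\<^sub>C (x :: 'a :: complex_normed_vector) = 0 \<longleftrightarrow> c = 0 \<or> x = 0"
  by (metis mult_eq_0_iff norm_eq_zero norm_scaleC)

instantiation complex :: complex_normed_vector
begin
definition scaleC_complex :: "complex \<Rightarrow> complex \<Rightarrow> complex"
  where "scaleC_complex c x = c * x"
instance
  by standard (simp_all add: scaleC_complex_def algebra_simps norm_mult scaleR_conv_of_real)
end

instantiation vec :: (complex_normed_vector, finite) complex_normed_vector
begin
definition scaleC_vec :: "complex \<Rightarrow> 'a ^ 'b \<Rightarrow> 'a ^ 'b"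
  where "scaleC_vec c x = (\<chi> i. c *\<^sub>C (x $ i))"
instance
proof
  fix c d :: complex and r :: real and x y :: "'a ^ 'b"
  show "c *\<^sub>C (x + y) = c *\<^sub>C x + c *\<^sub>C y"
    by (simp add: scaleC_vec_def vec_eq_iff scaleC_add_right)
  show "(c + d) *\<^sub>C x = c *\<^sub>C x + d *\<^sub>C x"
    by (simp add: scaleC_vec_def vec_eq_iff scaleC_add_left)
  show "c *\<^sub>C d *\<^sub>C x = (c * d) *\<^sub>C x"
    by (simp add: scaleC_vec_def vec_eq_iff scaleC_scaleC)
  show "r *\<^sub>R x = complex_of_real r *\<^sub>C x"
    by (simp add: scaleC_vec_def vec_eq_iff scaleR_scaleC)
  show "norm (c *\<^sub>C x) = cmod c * norm x"
    by (simp add: scaleC_vec_def norm_vec_def norm_scaleC L2_set_right_distrib)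
qed
end

definition cx_holomorphic_on ::
    "('a::complex_normed_vector \<Rightarrow> 'b::complex_normed_vector) \<Rightarrow> 'a set \<Rightarrow> bool"
  where "cx_holomorphic_on f S \<longleftrightarrow>
    (\<forall>z\<in>S. \<exists>D. (f has_derivative D) (at z) \<and> (\<forall>c v. D (c *\<^sub>C v) = c *\<^sub>C D v))"


section \<open>The Hilbert space of square-summable sequences\<close>

typedef l2 = "{x :: nat \<Rightarrow> complex. summable (\<lambda>n. (cmod (x n))\<^sup>2)}"
  morphisms l2_nth Abs_l2
  by (rule exI[of _ "\<lambda>_. 0"]) simp

setup_lifting type_definition_l2

lemma summable_l2_nth: "summable (\<lambda>n. (cmod (l2_nth x n))\<^sup>2)"
  using l2_nth[of x] by simp

lemma l2_eqI: "(\<And>n. l2_nth x n = l2_nth y n) \<Longrightarrow> x = y"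
  by (simp add: l2_nth_inject[symmetric] fun_eq_iff)

lemma square_summable_add:
  fixes x y :: "nat \<Rightarrow> complex"
  assumes "summable (\<lambda>n. (cmod (x n))\<^sup>2)" "summable (\<lambda>n. (cmod (y n))\<^sup>2)"
  shows "summable (\<lambda>n. (cmod (x n + y n))\<^sup>2)"
proof (rule summable_comparison_test')
  show "summable (\<lambda>n. 2 * (cmod (x n))\<^sup>2 + 2 * (cmod (y n))\<^sup>2)"
    using assms by (intro summable_add summable_mult)
  fix n
  have "(cmod (x n + y n))\<^sup>2 \<le> (cmod (x n) + cmod (y n))\<^sup>2"
    by (simp add: norm_triangle_ineq power_mono)
  also have "\<dots> \<le> 2 * (cmod (x n))\<^sup>2 + 2 * (cmod (y n))\<^sup>2"
    using sum_squares_bound[of "cmod (x n)" "cmod (y n)"]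
    by (simp add: power2_sum)
  finally show "norm ((cmod (x n + y n))\<^sup>2) \<le> 2 * (cmod (x n))\<^sup>2 + 2 * (cmod (y n))\<^sup>2"
    by simp
qed

lemma square_summable_mult:
  fixes x :: "nat \<Rightarrow> complex"
  assumes "summable (\<lambda>n. (cmod (x n))\<^sup>2)"
  shows "summable (\<lambda>n. (cmod (c * x n))\<^sup>2)"
  using summable_mult[OF assms, of "(cmod c)\<^sup>2"] by (simp add: norm_mult power_mult_distrib)

lemma square_summable_inner:
  fixes x y :: "nat \<Rightarrow> complex"
  assumes "summable (\<lambda>n. (cmod (x n))\<^sup>2)" "summable (\<lambda>n. (cmod (y n))\<^sup>2)"
  shows "summable (\<lambda>n. x n \<bullet> y n)"
proof (rule summable_comparison_test')
  show "summable (\<lambda>n. (cmod (x n))\<^sup>2 + (cmod (y n))\<^sup>2)"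
    using assms by (intro summable_add)
  fix n
  have "\<bar>x n \<bullet> y n\<bar> \<le> cmod (x n) * cmod (y n)"
    by (rule Cauchy_Schwarz_ineq2)
  also have "\<dots> \<le> (cmod (x n))\<^sup>2 + (cmod (y n))\<^sup>2"
  proof -
    have "0 \<le> cmod (x n) * cmod (y n)" by simp
    with sum_squares_bound[of "cmod (x n)" "cmod (y n)"] show ?thesis by linarith
  qed
  finally show "norm (x n \<bullet> y n) \<le> (cmod (x n))\<^sup>2 + (cmod (y n))\<^sup>2" by simp
qed

instantiation l2 :: real_vector
begin
lift_definition zero_l2 :: l2 is "\<lambda>_. 0" by simp
lift_definition plus_l2 :: "l2 \<Rightarrow> l2 \<Rightarrow> l2" is "\<lambda>x y n. x n + y n"
  by (rule square_summable_add)
lift_definition uminus_l2 :: "l2 \<Rightarrow> l2" is "\<lambda>x n. - x n" by simp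
lift_definition minus_l2 :: "l2 \<Rightarrow> l2 \<Rightarrow> l2" is "\<lambda>x y n. x n - y n"
proof -
  fix x y :: "nat \<Rightarrow> complex"
  assume "summable (\<lambda>n. (cmod (x n))\<^sup>2)" "summable (\<lambda>n. (cmod (y n))\<^sup>2)"
  then show "summable (\<lambda>n. (cmod (x n - y n))\<^sup>2)"
    using square_summable_add[of x "\<lambda>n. - y n"] by simp
qed
lift_definition scaleR_l2 :: "real \<Rightarrow> l2 \<Rightarrow> l2" is "\<lambda>r x n. complex_of_real r * x n"
  by (rule square_summable_mult)
instance
  by standard (transfer, simp add: algebra_simps fun_eq_iff)+
end

instantiation l2 :: real_inner
begin
definition inner_l2 :: "l2 \<Rightarrow> l2 \<Rightarrow> real"
  where "inner_l2 x y = (\<Sum>n. l2_nth x n \<bullet> l2_nth y n)"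
definition norm_l2 :: "l2 \<Rightarrow> real"
  where "norm_l2 x = sqrt (\<Sum>n. (cmod (l2_nth x n))\<^sup>2)"
definition sgn_l2 :: "l2 \<Rightarrow> l2"
  where "sgn_l2 x = x /\<^sub>R norm x"
definition dist_l2 :: "l2 \<Rightarrow> l2 \<Rightarrow> real"
  where "dist_l2 x y = norm (x - y)"
definition uniformity_l2 :: "(l2 \<times> l2) filter"
  where "uniformity_l2 = (INF e\<in>{0<..}. principal {(x, y). dist x y < e})"
definition open_l2 :: "l2 set \<Rightarrow> bool"
  where "open_l2 U \<longleftrightarrow> (\<forall>x\<in>U. eventually (\<lambda>(x', y). x' = x \<longrightarrow> y \<in> U) uniformity)"
instance
proof
  fix x y z :: l2 and r :: real and U :: "l2 set"
  have S: "summable (\<lambda>n. l2_nth x n \<bullet> l2_nth y n)" for x y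
    by (intro square_summable_inner summable_l2_nth)
  show "dist x y = norm (x - y)" by (rule dist_l2_def)
  show "sgn x = x /\<^sub>R norm x" by (rule sgn_l2_def)
  show "uniformity = (INF e\<in>{0<..}. principal {(x::l2, y). dist x y < e})"
    by (rule uniformity_l2_def)
  show "open U \<longleftrightarrow> (\<forall>x\<in>U. eventually (\<lambda>(x', y). x' = x \<longrightarrow> y \<in> U) uniformity)"
    by (rule open_l2_def)
  show "x \<bullet> y = y \<bullet> x"
    by (simp add: inner_l2_def inner_commute)
  show "(x + y) \<bullet> z = x \<bullet> z + y \<bullet> z"
    by (simp add: inner_l2_def plus_l2.rep_eq inner_add_left suminf_add[OF S S])
  have "l2_nth (r *\<^sub>R x) n \<bullet> l2_nth y n = r * (l2_nth x n \<bullet> l2_nth y n)" for n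
    by (simp add: scaleR_l2.rep_eq flip: scaleR_conv_of_real)
  then show "(r *\<^sub>R x) \<bullet> y = r * (x \<bullet> y)"
    by (simp add: inner_l2_def suminf_mult[OF S])
  show "0 \<le> x \<bullet> x"
    unfolding inner_l2_def by (intro suminf_nonneg S) simp
  show "x \<bullet> x = 0 \<longleftrightarrow> x = 0"
  proof -
    have "x \<bullet> x = 0 \<longleftrightarrow> (\<forall>n. l2_nth x n \<bullet> l2_nth x n = 0)"
      unfolding inner_l2_def by (rule suminf_eq_zero_iff[OF S]) simp
    also have "\<dots> \<longleftrightarrow> x = 0"
      by (auto simp: zero_l2.rep_eq intro!: l2_eqI)
    finally show ?thesis .
  qed
  show "norm x = sqrt (x \<bullet> x)"
    by (simp add: norm_l2_def inner_l2_def power2_norm_eq_inner)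
qed
end

instantiation l2 :: complex_normed_vector
begin
lift_definition scaleC_l2 :: "complex \<Rightarrow> l2 \<Rightarrow> l2" is "\<lambda>c x n. c * x n"
  by (rule square_summable_mult)
instance
proof
  fix c d :: complex and r :: real and x y :: l2
  show "c *\<^sub>C (x + y) = c *\<^sub>C x + c *\<^sub>C y" by transfer (simp add: algebra_simps)
  show "(c + d) *\<^sub>C x = c *\<^sub>C x + d *\<^sub>C x" by transfer (simp add: algebra_simps)
  show "c *\<^sub>C d *\<^sub>C x = (c * d) *\<^sub>C x" by transfer (simp add: algebra_simps)
  show "r *\<^sub>R x = complex_of_real r *\<^sub>C x" by transfer simp
  show "norm (c *\<^sub>C x) = cmod c * norm x"
    by (simp add: norm_l2_def scaleC_l2.rep_eq norm_mult power_mult_distrib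
        suminf_mult[OF summable_l2_nth] real_sqrt_mult)
qed
end

lemma norm_l2_nth_le: "cmod (l2_nth x n) \<le> norm x"
proof -
  have "(\<Sum>k\<in>{n}. (cmod (l2_nth x k))\<^sup>2) \<le> (\<Sum>k. (cmod (l2_nth x k))\<^sup>2)"
    by (rule sum_le_suminf[OF summable_l2_nth]) auto
  then show ?thesis by (simp add: norm_l2_def real_le_rsqrt)
qed

instance l2 :: complete_space
proof
  fix X :: "nat \<Rightarrow> l2"
  assume X: "Cauchy X"
  have nth_diff: "l2_nth (x - y) k = l2_nth x k - l2_nth y k" for x y k
    by (simp add: minus_l2.rep_eq)
  have "Cauchy (\<lambda>m. l2_nth (X m) k)" for k
  proof (rule CauchyI)
    fix e :: real assume "0 < e"
    then obtain M where M: "\<And>m n. m \<ge> M \<Longrightarrow> n \<ge> M \<Longrightarrow> norm (X m - X n) < e"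
      using CauchyD[OF X] by blast
    show "\<exists>M. \<forall>m\<ge>M. \<forall>n\<ge>M. norm (l2_nth (X m) k - l2_nth (X n) k) < e"
      by (intro exI[of _ M] allI impI)
        (metis M nth_diff norm_l2_nth_le order.strict_trans1)
  qed
  then have "\<forall>k. \<exists>l. (\<lambda>m. l2_nth (X m) k) \<longlonglongrightarrow> l"
    by (simp add: Cauchy_convergent_iff convergent_def)
  then obtain L where L: "\<And>k. (\<lambda>m. l2_nth (X m) k) \<longlonglongrightarrow> L k"
    by metis
  have bound: "\<exists>M. \<forall>m\<ge>M. \<forall>N. (\<Sum>k<N. (cmod (l2_nth (X m) k - L k))\<^sup>2) \<le> e\<^sup>2"
    if "0 < e" for e :: real
  proof -
    obtain M where M: "\<And>m n. m \<ge> M \<Longrightarrow> n \<ge> M \<Longrightarrow> norm (X m - X n) < e"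
      using CauchyD[OF X \<open>0 < e\<close>] by blast
    have "(\<Sum>k<N. (cmod (l2_nth (X m) k - L k))\<^sup>2) \<le> e\<^sup>2" if "m \<ge> M" for m N
    proof (rule LIMSEQ_le_const2)
      show "(\<lambda>n. \<Sum>k<N. (cmod (l2_nth (X m) k - l2_nth (X n) k))\<^sup>2)
              \<longlonglongrightarrow> (\<Sum>k<N. (cmod (l2_nth (X m) k - L k))\<^sup>2)"
        by (intro tendsto_intros L)
      have "(\<Sum>k<N. (cmod (l2_nth (X m) k - l2_nth (X n) k))\<^sup>2) \<le> e\<^sup>2" if "n \<ge> M" for n
      proof -
        have "(\<Sum>k<N. (cmod (l2_nth (X m - X n) k))\<^sup>2) \<le> (norm (X m - X n))\<^sup>2"
          using sum_le_suminf[OF summable_l2_nth[of "X m - X n"], of "{..<N}"]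
          by (simp add: norm_l2_def suminf_nonneg[OF summable_l2_nth])
        also have "\<dots> \<le> e\<^sup>2"
          using M[OF \<open>m \<ge> M\<close> \<open>n \<ge> M\<close>] by (intro power_mono) auto
        finally show ?thesis by (simp add: nth_diff)
      qed
      then show "\<exists>M. \<forall>n\<ge>M. (\<Sum>k<N. (cmod (l2_nth (X m) k - l2_nth (X n) k))\<^sup>2) \<le> e\<^sup>2"
        by blast
    qed
    then show ?thesis by blast
  qed
  have summ: "summable (\<lambda>k. (cmod (y k))\<^sup>2)" if "\<And>N. (\<Sum>k<N. (cmod (y k))\<^sup>2) \<le> B"
    for y :: "nat \<Rightarrow> complex" and B
  proof (rule bounded_imp_summable)
    show "0 \<le> (cmod (y n))\<^sup>2" for n by simp
    show "(\<Sum>k\<le>n. (cmod (y k))\<^sup>2) \<le> B" for n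
      using that[of "Suc n"] by (simp add: lessThan_Suc_atMost)
  qed
  obtain M where M: "\<And>N. (\<Sum>k<N. (cmod (l2_nth (X M) k - L k))\<^sup>2) \<le> 1\<^sup>2"
    using bound[of 1] by auto
  have "summable (\<lambda>k. (cmod (L k - l2_nth (X M) k))\<^sup>2)"
    by (rule summ[of _ "1\<^sup>2"]) (use M in \<open>simp add: norm_minus_commute\<close>)
  from square_summable_add[OF this summable_l2_nth[of "X M"]]
  have Lsum: "summable (\<lambda>k. (cmod (L k))\<^sup>2)" by simp
  define l where "l = Abs_l2 L"
  have l: "l2_nth l k = L k" for k
    using Lsum by (simp add: l_def Abs_l2_inverse)
  have "X \<longlonglongrightarrow> l"
  proof (rule LIMSEQ_I)
    fix e :: real assume "0 < e"
    then obtain M where M: "\<And>m N. m \<ge> M \<Longrightarrow> (\<Sum>k<N. (cmod (l2_nth (X m) k - L k))\<^sup>2) \<le> (e/2)\<^sup>2"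
      using bound[of "e/2"] by auto
    have "norm (X m - l) < e" if "m \<ge> M" for m
    proof -
      have "(\<Sum>k. (cmod (l2_nth (X m - l) k))\<^sup>2) \<le> (e/2)\<^sup>2"
        by (rule suminf_le_const[OF summable_l2_nth]) (use M[OF that] in \<open>simp add: nth_diff l\<close>)
      then have "norm (X m - l) \<le> e/2"
        unfolding norm_l2_def using \<open>0 < e\<close> by (intro real_le_lsqrt) auto
      with \<open>0 < e\<close> show ?thesis by simp
    qed
    then show "\<exists>M. \<forall>m\<ge>M. norm (X m - l) < e" by blast
  qed
  then show "convergent X" by (rule convergentI)
qed


section \<open>The projective Hilbert space\<close>

definition proj_rel :: "l2 \<Rightarrow> l2 \<Rightarrow> bool"
  where "proj_rel v w \<longleftrightarrow> v \<noteq> 0 \<and> w \<noteq> 0 \<and> (\<exists>c. c \<noteq> 0 \<and> v = c *\<^sub>C w)"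

lemma unit_square_summable: "summable (\<lambda>n. (cmod (if n = 0 then 1 else 0))\<^sup>2)"
  by (rule summable_finite[of "{0}"]) auto

lemma part_equivp_proj_rel: "part_equivp proj_rel"
proof (rule part_equivpI)
  define e where "e = Abs_l2 (\<lambda>n. if n = 0 then 1 else 0)"
  have "l2_nth e 0 = 1"
    using unit_square_summable by (simp add: e_def Abs_l2_inverse)
  then have "e \<noteq> 0" by (auto simp: zero_l2.rep_eq)
  then have "proj_rel e e" unfolding proj_rel_def by (metis scaleC_one zero_neq_one)
  then show "\<exists>x. proj_rel x x" ..
  show "symp proj_rel"
  proof (rule sympI)
    fix v w assume "proj_rel v w"
    then obtain c where c: "v \<noteq> 0" "w \<noteq> 0" "c \<noteq> 0" "v = c *\<^sub>C w"
      by (auto simp: proj_rel_def)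
    then have "w = inverse c *\<^sub>C v" by (simp add: scaleC_scaleC)
    with c show "proj_rel w v"
      unfolding proj_rel_def by (metis inverse_nonzero_iff_nonzero)
  qed
  show "transp proj_rel"
    unfolding proj_rel_def by (rule transpI) (metis mult_eq_0_iff scaleC_scaleC)
qed

quotient_type proj_l2 = l2 / partial: proj_rel
  by (rule part_equivp_proj_rel)

text \<open>The canonical projection; only its values on nonzero vectors are meaningful.\<close>

definition proj :: "l2 \<Rightarrow> proj_l2"
  where "proj = abs_proj_l2"

lemma proj_eq_iff:
  assumes "v \<noteq> 0" "w \<noteq> 0"
  shows "proj v = proj w \<longleftrightarrow> (\<exists>c. c \<noteq> 0 \<and> v = c *\<^sub>C w)"
proof -
  have "proj_rel u u" if "u \<noteq> 0" for u
    unfolding proj_rel_def using that by (metis scaleC_one zero_neq_one)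
  with assms show ?thesis
    using Quotient3_rel[OF Quotient3_proj_l2, of v w]
    by (auto simp: proj_def proj_rel_def)
qed

lemma proj_surj: obtains w where "w \<noteq> 0" "p = proj w"
  using Quotient3_abs_rep[OF Quotient3_proj_l2, of p] Quotient3_rep_reflp[OF Quotient3_proj_l2, of p]
  by (metis proj_def proj_rel_def)

text \<open>The quotient topology of the set of nonzero vectors.\<close>

instantiation proj_l2 :: topological_space
begin
definition open_proj_l2 :: "proj_l2 set \<Rightarrow> bool"
  where "open_proj_l2 U \<longleftrightarrow> open {w. w \<noteq> 0 \<and> proj w \<in> U}"
instance
proof
  show "open (UNIV :: proj_l2 set)"
    by (simp add: open_proj_l2_def open_Collect_neq)
  fix S T :: "proj_l2 set"
  assume "open S" "open T"
  then have "open ({w. w \<noteq> 0 \<and> proj w \<in> S} \<inter> {w. w \<noteq> 0 \<and> proj w \<in> T})"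
    by (simp add: open_proj_l2_def open_Int)
  also have "\<dots> = {w. w \<noteq> 0 \<and> proj w \<in> S \<inter> T}" by auto
  finally show "open (S \<inter> T)" by (simp add: open_proj_l2_def)
next
  fix K :: "proj_l2 set set"
  assume "\<forall>S\<in>K. open S"
  then have "open (\<Union>S\<in>K. {w. w \<noteq> 0 \<and> proj w \<in> S})"
    by (intro open_UN) (auto simp: open_proj_l2_def)
  also have "\<dots> = {w. w \<noteq> 0 \<and> proj w \<in> \<Union>K}" by auto
  finally show "open (\<Union>K)" by (simp add: open_proj_l2_def)
qed
end

definition chart_domain :: "nat \<Rightarrow> proj_l2 set"
  where "chart_domain k = {proj w | w. l2_nth w k \<noteq> 0}"

text \<open>
  The sequence of all quotients of the coordinates other than the one with index \<open>k\<close> by that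
  coordinate; the remaining indices are renumbered by the natural numbers in increasing order.
\<close>

lift_definition affine_quotient :: "nat \<Rightarrow> l2 \<Rightarrow> l2"
  is "\<lambda>k w j. w (if j < k then j else Suc j) / w k"
proof -
  fix k and w :: "nat \<Rightarrow> complex"
  assume "summable (\<lambda>n. (cmod (w n))\<^sup>2)"
  then have "summable (\<lambda>n. (cmod (w (Suc n)))\<^sup>2)"
    by (subst summable_Suc_iff)
  moreover have "\<forall>\<^sub>F n in sequentially.
      (cmod (w (Suc n)))\<^sup>2 = (cmod (w (if n < k then n else Suc n)))\<^sup>2"
    using eventually_ge_at_top[of k] by eventually_elim simp
  ultimately have "summable (\<lambda>n. (cmod (w (if n < k then n else Suc n)))\<^sup>2)"
    by (simp only: summable_cong[of "\<lambda>n. (cmod (w (Suc n)))\<^sup>2"])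
  then show "summable (\<lambda>j. (cmod (w (if j < k then j else Suc j) / w k))\<^sup>2)"
    using square_summable_mult[of "\<lambda>j. w (if j < k then j else Suc j)" "1 / w k"] by simp
qed

lift_definition chart :: "nat \<Rightarrow> proj_l2 \<Rightarrow> l2" is affine_quotient
  unfolding proj_rel_def
  by (auto intro!: l2_eqI simp: affine_quotient.rep_eq scaleC_l2.rep_eq)

lemma chart_proj:
  assumes "w \<noteq> 0"
  shows "chart k (proj w) = affine_quotient k w"
proof -
  have "proj_rel w w"
    unfolding proj_rel_def using assms by (metis scaleC_one zero_neq_one)
  then show ?thesis unfolding proj_def by (rule chart.abs_eq)
qed

definition proj_holomorphic_on :: "('a::complex_normed_vector \<Rightarrow> proj_l2) \<Rightarrow> 'a set \<Rightarrow> bool"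
  where "proj_holomorphic_on f S \<longleftrightarrow>
    open S \<and> continuous_on S f \<and>
    (\<forall>k. cx_holomorphic_on (\<lambda>z. chart k (f z)) {z \<in> S. f z \<in> chart_domain k})"


section \<open>Analytic subsets and meromorphic maps\<close>

definition analytic_subset :: "'a::complex_normed_vector set \<Rightarrow> 'a set \<Rightarrow> bool"
  where "analytic_subset X A \<longleftrightarrow>
    A \<subseteq> X \<and>
    (\<forall>a\<in>X. \<exists>V G. open V \<and> a \<in> V \<and> V \<subseteq> X \<and> finite G \<and>
      (\<forall>g\<in>G. cx_holomorphic_on (g :: 'a \<Rightarrow> complex) V) \<and>
      A \<inter> V = {z \<in> V. \<forall>g\<in>G. g z = 0})"

text \<open>
  Near \<open>a\<close> the set \<open>A\<close> is a \<open>d\<close>-dimensional complex submanifold: some biholomorphic coordinate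
  system \<open>\<Phi>\<close> at \<open>a\<close>, with inverse \<open>\<Psi>\<close>, maps it to a coordinate subspace of dimension \<open>d\<close>.
\<close>

definition regular_point_of_dim :: "(complex ^ 'n) set \<Rightarrow> nat \<Rightarrow> complex ^ 'n \<Rightarrow> bool"
  where "regular_point_of_dim A d a \<longleftrightarrow>
    a \<in> A \<and>
    (\<exists>V (\<Phi> :: complex ^ 'n \<Rightarrow> complex ^ 'n) \<Psi> (J :: 'n set).
      open V \<and> a \<in> V \<and> open (\<Phi> ` V) \<and>
      cx_holomorphic_on \<Phi> V \<and> cx_holomorphic_on \<Psi> (\<Phi> ` V) \<and> (\<forall>z\<in>V. \<Psi> (\<Phi> z) = z) \<and>
      card J = d \<and> (\<forall>z\<in>V. z \<in> A \<longleftrightarrow> (\<forall>i. i \<notin> J \<longrightarrow> \<Phi> z $ i = 0)))"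

text \<open>
  The dimension of an analytic set is the maximum of the dimensions at its regular points.
  In particular the empty set has codimension at least \<open>c\<close> for every \<open>c\<close>.
\<close>

definition codim_at_least :: "nat \<Rightarrow> (complex ^ 'n) set \<Rightarrow> bool"
  where "codim_at_least c A \<longleftrightarrow> (\<forall>d a. regular_point_of_dim A d a \<longrightarrow> d + c \<le> CARD('n))"

text \<open>
  The map \<open>F\<close>, holomorphic outside the set \<open>I\<close>, is a meromorphic map from the open set \<open>X\<close> to the
  projective space; its values on \<open>I\<close> are irrelevant.
\<close>

definition meromorphic_map ::
    "(complex ^ 'n) set \<Rightarrow> (complex ^ 'n) set \<Rightarrow> (complex ^ 'n \<Rightarrow> proj_l2) \<Rightarrow> bool"
  where "meromorphic_map X I F \<longleftrightarrow>
    open X \<and> analytic_subset X I \<and> codim_at_least 2 I \<and> proj_holomorphic_on F (X - I) \<and>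
    (\<forall>a\<in>I. \<exists>V \<phi>. open V \<and> a \<in> V \<and> V \<subseteq> X \<and> cx_holomorphic_on \<phi> V \<and>
      (\<forall>z\<in>V - I. \<phi> z \<noteq> 0 \<and> F z = proj (\<phi> z)))"

definition extends_meromorphically_to ::
    "(complex ^ 'n) set \<Rightarrow> (complex ^ 'n \<Rightarrow> proj_l2) \<Rightarrow> (complex ^ 'n) set \<Rightarrow> bool"
  where "extends_meromorphically_to U f X \<longleftrightarrow>
    (\<exists>I F. meromorphic_map X I F \<and> U \<subseteq> X - I \<and> (\<forall>z\<in>U. F z = f z))"


section \<open>Smooth closed curves\<close>

text \<open>Images of the circle, as the reals modulo \<open>1\<close>, under regular \<open>C\<^sup>1\<close> parametrizations.\<close>

definition C1_closed_curve :: "'a::real_normed_vector set \<Rightarrow> bool"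
  where "C1_closed_curve \<Gamma> \<longleftrightarrow>
    (\<exists>\<gamma> \<gamma>'. (\<forall>t::real. (\<gamma> has_vector_derivative \<gamma>' t) (at t)) \<and> continuous_on UNIV \<gamma>' \<and>
      (\<forall>t. \<gamma>' t \<noteq> 0) \<and> (\<forall>t. \<gamma> (t + 1) = \<gamma> t) \<and> \<Gamma> = range \<gamma>)"

end

(*
  Near a point p of the curve choose coordinates (s, t) such that the line s = 0 meets the curve
  only at p. The projection E of the curve to the s-axis is a null set, and for s outside E the map
  f is holomorphic on the whole line {s} x C. Let w be homogeneous coordinates of f, and choose k
  and a circle |t| = r on which w_k has no zeros for small s. For s outside E the quotients
  w_j / w_k are meromorphic in the disc |t| < r with a common polynomial denominator. That a
  polynomial P(s, .) of bounded degree clears all denominators is expressed by linear equations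
  whose coefficients, the moments of w_j / w_k on the circle, are holomorphic in s. Only countably
  many degrees being possible, Gaussian elimination and a null set argument yield one P with
  coefficients holomorphic in s, and the Cauchy integrals of P w_j / w_k over the circle lift f
  across the curve near p. For P of minimal degree these lifts have no common zero near p other
  than p itself, so that the points without a nonvanishing local lift are isolated.
*)

theory Submission
  imports Defs "HOL-Complex_Analysis.Complex_Analysis"
begin

section \<open>Holomorphic families of linear equations and Cauchy integrals\<close>

text \<open>Over the null set E the curve may interrupt the lines, and neither degrees nor roots of
  denominators are controlled as s varies. So everything is read off from the circle, where the
  quotients are holomorphic in s for s in E as well. The unknowns are the finitely many coefficients
  of P(s, .), but the equations, one for each power of t and each coordinate, are infinite in
  number; elimination uses finitely many pivots only, so one P serves all coordinates. It ends with
  a holomorphic solution or with a nonzero holomorphic function vanishing at every s that has a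
  solution; the countable zero sets of such functions, together with E, cannot cover a disc. The
  line s = 0 is exceptional: a solution may vanish there identically, so a common power of s is
  divided out. If all integrals vanish at (s, t), the factor u - t can be removed from P(s, .)
  without losing the vanishing moments, which minimality excludes except at isolated s. Holomorphy
  into the Hilbert space follows from the coordinates by bounds for finite sums that are uniform in
  their length.\<close>

lemma holomorphic_nonzero_product:
  fixes f g :: "complex \<Rightarrow> complex"
  assumes "f holomorphic_on S" "g holomorphic_on S" "open S" "connected S"
    and "a \<in> S" "f a \<noteq> 0" "b \<in> S" "g b \<noteq> 0"
  shows "\<exists>s\<in>S. f s * g s \<noteq> 0"
proof (rule ccontr)
  assume *: "\<not> (\<exists>s\<in>S. f s * g s \<noteq> 0)"
  have "isCont f a"
    using assms holomorphic_on_imp_continuous_on continuous_on_eq_continuous_at by blast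
  then have "\<exists>e>0. \<forall>y. dist a y < e \<longrightarrow> f y \<noteq> 0"
    by (rule continuous_at_avoid) (fact assms)
  then obtain e where e: "e > 0" "\<And>y. dist a y < e \<Longrightarrow> f y \<noteq> 0" by blast
  have "g b = 0"
  proof (rule analytic_continuation_open[of "ball a e \<inter> S" S g "\<lambda>_. 0"])
    have "a \<in> ball a e \<inter> S" using e \<open>a \<in> S\<close> by simp
    then show "ball a e \<inter> S \<noteq> {}" by blast
    show "g z = 0" if "z \<in> ball a e \<inter> S" for z using * e that by auto
  qed (use assms in auto)
  with assms show False by simp
qed

text \<open>Gaussian elimination over the field of meromorphic functions.\<close>

lemma holomorphic_kernel_dichotomy:
  fixes v :: "'i \<Rightarrow> nat \<Rightarrow> complex \<Rightarrow> complex"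
  assumes S: "open S" "connected S" "S \<noteq> {}"
    and "\<And>\<alpha> i. i < n \<Longrightarrow> v \<alpha> i holomorphic_on S"
  shows "(\<exists>c. (\<forall>i<n. c i holomorphic_on S) \<and> (\<exists>i<n. \<exists>s\<in>S. c i s \<noteq> 0) \<and>
            (\<forall>\<alpha>. \<forall>s\<in>S. (\<Sum>i<n. c i s * v \<alpha> i s) = 0)) \<or>
         (\<exists>\<delta>. \<delta> holomorphic_on S \<and> (\<exists>s\<in>S. \<delta> s \<noteq> 0) \<and>
            (\<forall>s\<in>S. (\<exists>c. (\<exists>i<n. c i \<noteq> 0) \<and> (\<forall>\<alpha>. (\<Sum>i<n. c i * v \<alpha> i s) = 0)) \<longrightarrow> \<delta> s = 0))"
  using assms(4)
proof (induction n arbitrary: v)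
  case 0
  show ?case
    by (rule disjI2, rule exI[of _ "\<lambda>_. 1"]) (use S in auto)
next
  case (Suc n)
  show ?case
  proof (cases "\<forall>\<alpha>. \<forall>s\<in>S. v \<alpha> n s = 0")
    case True
    \<comment> \<open>The last unknown occurs in no equation, so the corresponding unit vector is a
      solution.\<close>
    have "(\<forall>i<Suc n. (\<lambda>s. if i = n then 1 else 0) holomorphic_on S) \<and>
          (\<exists>i<Suc n. \<exists>s\<in>S. (if i = n then 1 else 0) \<noteq> (0::complex)) \<and>
          (\<forall>\<alpha>. \<forall>s\<in>S. (\<Sum>i<Suc n. (if i = n then 1 else 0) * v \<alpha> i s) = 0)"
      using True S by auto
    then show ?thesis
      by (intro disjI1 exI[of _ "\<lambda>i s. if i = n then 1 else 0"])
  next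
    case False
    then obtain \<beta> a where a: "a \<in> S" "v \<beta> n a \<noteq> 0" by blast
    define p where "p = v \<beta> n"
    \<comment> \<open>Row operation without division: \<open>p\<close> times equation
      \<open>\<alpha>\<close> minus a multiple of the pivot equation \<open>\<beta>\<close>. It
      removes the unknown \<open>n\<close> and keeps the coefficients holomorphic.\<close>
    define w where "w = (\<lambda>\<alpha> i s. p s * v \<alpha> i s - v \<alpha> n s * v \<beta> i s)"
    have p: "p holomorphic_on S" using Suc.prems p_def by simp
    have w: "w \<alpha> i holomorphic_on S" if "i < n" for \<alpha> i
      unfolding w_def using p Suc.prems that by (intro holomorphic_intros) auto
    show ?thesis
    proof (rule disjE[OF Suc.IH[of w]])
      fix \<alpha> i assume "i < n"
      then show "w \<alpha> i holomorphic_on S" by (rule w)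
    next
      assume "\<exists>c. (\<forall>i<n. c i holomorphic_on S) \<and> (\<exists>i<n. \<exists>s\<in>S. c i s \<noteq> 0) \<and>
        (\<forall>\<alpha>. \<forall>s\<in>S. (\<Sum>i<n. c i s * w \<alpha> i s) = 0)"
      then obtain c where 0: "(\<forall>i<n. c i holomorphic_on S) \<and> (\<exists>i<n. \<exists>s\<in>S. c i s \<noteq> 0) \<and>
        (\<forall>\<alpha>. \<forall>s\<in>S. (\<Sum>i<n. c i s * w \<alpha> i s) = 0)" ..
      note 1 = 0[THEN conjunct1] 0[THEN conjunct2, THEN conjunct1] 0[THEN conjunct2, THEN conjunct2]
      \<comment> \<open>Back substitution: the pivot equation determines the unknown
        \<open>n\<close>, and the whole vector is scaled by \<open>p\<close> to avoid dividing by
        the pivot.\<close>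
      define d where "d = (\<lambda>i s. if i = n then - (\<Sum>i<n. c i s * v \<beta> i s) else p s * c i s)"
      have d1: "d i holomorphic_on S" if "i < Suc n" for i
        using 1(1) Suc.prems p that unfolding d_def
        by (cases "i = n") (auto intro!: holomorphic_intros)
      have d2: "\<exists>i<Suc n. \<exists>s\<in>S. d i s \<noteq> 0"
      proof -
        obtain i b where ib: "i < n" "b \<in> S" "c i b \<noteq> 0" using 1(2) by blast
        \<comment> \<open>Holomorphic functions on a connected open set have no zero divisors, so
          scaling by the pivot does not annihilate the solution.\<close>
        then have "\<exists>s\<in>S. p s * c i s \<noteq> 0"
          using holomorphic_nonzero_product[OF p 1(1)[rule_format, OF ib(1)] S(1,2) a(1)] a(2)
          unfolding p_def by blast
        then show ?thesis using ib(1) by (intro exI[of _ i]) (auto simp: d_def)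
      qed
      have d3: "(\<Sum>i<Suc n. d i s * v \<alpha> i s) = 0" if "s \<in> S" for \<alpha> s
      proof -
        have "(\<Sum>i<Suc n. d i s * v \<alpha> i s)
            = (\<Sum>i<n. p s * c i s * v \<alpha> i s) - (\<Sum>i<n. c i s * v \<beta> i s) * v \<alpha> n s"
          by (simp add: d_def)
        also have "\<dots> = (\<Sum>i<n. c i s * w \<alpha> i s)"
          by (simp add: w_def sum_distrib_left sum_distrib_right algebra_simps sum_subtractf)
        finally show ?thesis using 1(3) that by simp
      qed
      show ?thesis
        by (rule disjI1, rule exI[of _ d], intro conjI allI impI ballI d2) (use d1 d3 in blast)+
    next
      assume "\<exists>\<delta>. \<delta> holomorphic_on S \<and> (\<exists>s\<in>S. \<delta> s \<noteq> 0) \<and>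
        (\<forall>s\<in>S. (\<exists>c. (\<exists>i<n. c i \<noteq> 0) \<and> (\<forall>\<alpha>. (\<Sum>i<n. c i * w \<alpha> i s) = 0)) \<longrightarrow> \<delta> s = 0)"
      then obtain \<delta> where 0: "\<delta> holomorphic_on S \<and> (\<exists>s\<in>S. \<delta> s \<noteq> 0) \<and>
        (\<forall>s\<in>S. (\<exists>c. (\<exists>i<n. c i \<noteq> 0) \<and> (\<forall>\<alpha>. (\<Sum>i<n. c i * w \<alpha> i s) = 0)) \<longrightarrow> \<delta> s = 0)" ..
      note 2 = 0[THEN conjunct1] 0[THEN conjunct2, THEN conjunct1] 0[THEN conjunct2, THEN conjunct2]
      \<comment> \<open>Where the pivot vanishes the reduced system gives no information on the
        original one; the factor \<open>p\<close> puts these points into the exceptional zero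
        set.\<close>
      have "\<exists>s\<in>S. p s * \<delta> s \<noteq> 0"
        using holomorphic_nonzero_product[OF p 2(1) S(1,2) a(1)] a(2) 2(2) unfolding p_def by blast
      moreover have "p s * \<delta> s = 0"
        if s: "s \<in> S" and c: "\<exists>i<Suc n. c i \<noteq> 0" "\<And>\<alpha>. (\<Sum>i<Suc n. c i * v \<alpha> i s) = 0" for s c
      proof (cases "p s = 0")
        case False
        have cn: "(\<Sum>i<n. c i * v \<alpha> i s) = - c n * v \<alpha> n s" for \<alpha>
          using c(2)[of \<alpha>] by (simp add: add_eq_0_iff)
        \<comment> \<open>A solution supported on the unknown \<open>n\<close> alone contradicts the
          pivot equation, because \<open>p s\<close> is nonzero here.\<close>
        have "\<exists>i<n. c i \<noteq> 0"
        proof (rule ccontr)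
          assume "\<not> ?thesis"
          with c(1) have "c n \<noteq> 0" "\<And>i. i < n \<Longrightarrow> c i = 0" by (auto simp: less_Suc_eq)
          with cn[of \<beta>] False show False by (simp add: p_def)
        qed
        moreover have "(\<Sum>i<n. c i * w \<alpha> i s) = 0" for \<alpha>
        proof -
          have "(\<Sum>i<n. c i * w \<alpha> i s)
              = p s * (\<Sum>i<n. c i * v \<alpha> i s) - v \<alpha> n s * (\<Sum>i<n. c i * v \<beta> i s)"
            by (simp add: w_def sum_distrib_left algebra_simps sum_subtractf)
          also have "\<dots> = 0" unfolding cn by (simp add: p_def)
          finally show ?thesis .
        qed
        ultimately have "\<delta> s = 0" using 2(3) s by blast
        then show ?thesis by simp
      qed simp
      ultimately show ?thesis
        using p 2(1) by (intro disjI2 exI[of _ "\<lambda>s. p s * \<delta> s"]) (auto intro!: holomorphic_intros)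
    qed
  qed
qed

section \<open>Cauchy integrals depending on parameters\<close>

lemma continuous_on_contour_integral_circlepath:
  fixes f :: "'a::topological_space \<Rightarrow> complex \<Rightarrow> complex"
  assumes "continuous_on (U \<times> sphere z r) (\<lambda>(x, u). f x u)" "0 \<le> r"
  shows "continuous_on U (\<lambda>x. contour_integral (circlepath z r) (f x))"
proof -
  have "continuous_on (U \<times> cbox 0 (1::real))
      (\<lambda>(x, t). f x (circlepath z r t) * vector_derivative (circlepath z r) (at t))"
    unfolding vector_derivative_circlepath case_prod_beta
  proof (intro continuous_intros)
    have *: "continuous_on (U \<times> cbox 0 (1::real)) (\<lambda>p. (fst p, circlepath z r (snd p)))"
      unfolding circlepath by (intro continuous_intros)
    have "(\<lambda>p. (fst p, circlepath z r (snd p))) ` (U \<times> cbox 0 (1::real)) \<subseteq> U \<times> sphere z r"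
      using assms(2) path_image_circlepath_nonneg[of r z] unfolding path_image_def by fastforce
    from continuous_on_compose2[OF assms(1) * this]
    show "continuous_on (U \<times> cbox 0 (1::real)) (\<lambda>p. f (fst p) (circlepath z r (snd p)))"
      by (simp add: case_prod_beta)
  qed
  from integral_continuous_on_param[OF this] show ?thesis
    unfolding contour_integral_integral by (simp add: cbox_interval)
qed

text \<open>Cauchy's formula turns the derivative in \<open>s\<close> into an integral over the
  boundary circle of the disc, and such integrals inherit continuity in all parameters. Hence the
  continuity up to the closed disc in the hypothesis.\<close>

lemma continuous_on_deriv_param:
  fixes G :: "complex \<Rightarrow> 'b::topological_space \<Rightarrow> complex"
  assumes G: "continuous_on (cball a e \<times> K) (\<lambda>(s, t). G s t)"
    and hol: "\<And>t. t \<in> K \<Longrightarrow> (\<lambda>s. G s t) holomorphic_on ball a e" and "0 < e"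
  shows "continuous_on (ball a e \<times> K) (\<lambda>(s, t). deriv (\<lambda>s. G s t) s)"
proof -
  have *: "continuous_on ((ball a e \<times> K) \<times> sphere a e)
      (\<lambda>(x, u). G u (snd x) / (u - fst x)^2)"
    unfolding case_prod_beta
  proof (intro continuous_intros)
    have 1: "continuous_on ((ball a e \<times> K) \<times> sphere a e) (\<lambda>x. (snd x, snd (fst x)))"
      by (intro continuous_intros)
    have 2: "(\<lambda>x. (snd x, snd (fst x))) ` ((ball a e \<times> K) \<times> sphere a e) \<subseteq> cball a e \<times> K"
      by auto
    from continuous_on_compose2[OF G 1 2]
    show "continuous_on ((ball a e \<times> K) \<times> sphere a e) (\<lambda>x. G (snd x) (snd (fst x)))"
      by simp
  qed auto
  have "continuous_on (ball a e \<times> K)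
      (\<lambda>x. contour_integral (circlepath a e) (\<lambda>u. G u (snd x) / (u - fst x)^2) / (2 * pi * \<i>))"
    using \<open>0 < e\<close> continuous_on_contour_integral_circlepath[OF *]
    by (intro continuous_intros) auto
  then show ?thesis
  proof (rule continuous_on_eq)
    fix x assume x: "x \<in> ball a e \<times> K"
    have "continuous_on (cball a e) (\<lambda>s. G s (snd x))"
    proof -
      have 1: "continuous_on (cball a e) (\<lambda>s. (s, snd x))" by (intro continuous_intros)
      have 2: "(\<lambda>s. (s, snd x)) ` cball a e \<subseteq> cball a e \<times> K" using x by auto
      from continuous_on_compose2[OF G 1 2] show ?thesis by simp
    qed
    with Cauchy_contour_integral_circlepath_2[of a e "\<lambda>s. G s (snd x)" "fst x"] hol x
    show "contour_integral (circlepath a e) (\<lambda>u. G u (snd x) / (u - fst x)^2) / (2 * pi * \<i>) =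
        (case x of (s, t) \<Rightarrow> deriv (\<lambda>s. G s t) s)"
      by (auto simp: case_prod_beta)
  qed
qed

text \<open>Differentiation under the integral sign, justified by the joint continuity of the
  derivative in \<open>s\<close>. This makes the moments on the circle holomorphic functions of
  \<open>s\<close>.\<close>

lemma holomorphic_on_contour_integral_circlepath:
  fixes G :: "complex \<Rightarrow> complex \<Rightarrow> complex"
  assumes G: "continuous_on (cball a e \<times> sphere z r) (\<lambda>(s, t). G s t)"
    and hol: "\<And>t. t \<in> sphere z r \<Longrightarrow> (\<lambda>s. G s t) holomorphic_on ball a e" and "0 < e" "0 < r"
  shows "(\<lambda>s. contour_integral (circlepath z r) (G s)) holomorphic_on ball a e"
proof -
  let ?v = "\<lambda>t. vector_derivative (circlepath z r) (at t)"
  have sph: "circlepath z r t \<in> sphere z r" if "t \<in> {0..1}" for t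
    using that \<open>0 < r\<close> path_image_circlepath[of z r] unfolding path_image_def by auto
  have cv: "continuous_on T ?v" for T
    unfolding vector_derivative_circlepath by (intro continuous_intros)
  have cc: "continuous_on T (circlepath z r)" for T
    unfolding circlepath by (intro continuous_intros)
  have "(\<lambda>s. integral (cbox 0 1) (\<lambda>t. G s (circlepath z r t) * ?v t)) holomorphic_on ball a e"
  proof (rule leibniz_rule_holomorphic)
    show "((\<lambda>s. G s (circlepath z r t) * ?v t) has_field_derivative
        deriv (\<lambda>s. G s (circlepath z r t)) s * ?v t) (at s within ball a e)"
      if "s \<in> ball a e" "t \<in> cbox 0 1" for s t
    proof -
      have "((\<lambda>s. G s (circlepath z r t)) has_field_derivative
          deriv (\<lambda>s. G s (circlepath z r t)) s) (at s)"
        using holomorphic_derivI[OF hol[OF sph[of t]] open_ball] that by simp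
      from DERIV_cmult_right[OF has_field_derivative_at_within[OF this]] show ?thesis .
    qed
    show "(\<lambda>t. G s (circlepath z r t) * ?v t) integrable_on cbox 0 1" if "s \<in> ball a e" for s
    proof (intro integrable_continuous continuous_intros cv)
      have 1: "continuous_on (cbox 0 1) (\<lambda>t. (s, circlepath z r t))"
        by (intro continuous_intros cc)
      have 2: "(\<lambda>t. (s, circlepath z r t)) ` cbox 0 1 \<subseteq> cball a e \<times> sphere z r"
        using that sph by (auto simp del: mem_sphere)
      from continuous_on_compose2[OF G 1 2]
      show "continuous_on (cbox 0 1) (\<lambda>t. G s (circlepath z r t))" by simp
    qed
    have 1: "continuous_on (ball a e \<times> cbox 0 1) (\<lambda>x. (fst x, circlepath z r (snd x)))"
      unfolding circlepath by (intro continuous_intros)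
    have 2: "(\<lambda>x. (fst x, circlepath z r (snd x))) ` (ball a e \<times> cbox 0 1) \<subseteq> ball a e \<times> sphere z r"
      using sph by (auto simp del: mem_sphere)
    from continuous_on_compose2[OF continuous_on_deriv_param[OF G hol \<open>0 < e\<close>] 1 2]
    have 3: "continuous_on (ball a e \<times> cbox 0 1)
        (\<lambda>x. deriv (\<lambda>s. G s (circlepath z r (snd x))) (fst x))"
      by simp
    have 4: "continuous_on (ball a e \<times> cbox 0 1) (\<lambda>x. ?v (snd x))"
      unfolding vector_derivative_circlepath by (intro continuous_intros)
    show "continuous_on (ball a e \<times> cbox 0 1)
        (\<lambda>(s, t). deriv (\<lambda>s. G s (circlepath z r t)) s * ?v t)"
      unfolding case_prod_beta by (intro continuous_on_mult 3 4)
  qed auto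
  then show ?thesis
    unfolding contour_integral_integral by (simp add: cbox_interval)
qed

text \<open>\<open>A\<close> and \<open>B\<close> are the two partial derivatives, and complex
  linearity is built into the shape of the derivative. Pairs are the setting of the criterion by
  partial derivatives; linear coordinates later carry the result over to
  \<open>complex ^ 2\<close>.\<close>

definition cdifferentiable_at :: "(complex \<times> complex \<Rightarrow> complex) \<Rightarrow> complex \<times> complex \<Rightarrow> bool"
  where "cdifferentiable_at g x \<longleftrightarrow> (\<exists>A B. (g has_derivative (\<lambda>(u, v). A * u + B * v)) (at x))"

text \<open>One partial derivative at the point and a second one that is continuous nearby give the
  total derivative. In \<open>s\<close> the integral is holomorphic by differentiation under the
  integral sign; in \<open>t\<close> only the Cauchy kernel is differentiated, and the integral with
  the squared kernel is continuous in both variables.\<close>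

lemma cdifferentiable_at_Cauchy_integral:
  fixes G :: "complex \<Rightarrow> complex \<Rightarrow> complex"
  assumes G: "continuous_on (cball a e \<times> sphere z r) (\<lambda>(s, t). G s t)"
    and hol: "\<And>t. t \<in> sphere z r \<Longrightarrow> (\<lambda>s. G s t) holomorphic_on ball a e" and "0 < e" "0 < r"
    and st: "s0 \<in> ball a e" "t0 \<in> ball z r"
  shows "cdifferentiable_at (\<lambda>(s, t). contour_integral (circlepath z r) (\<lambda>u. G s u / (u - t))) (s0, t0)"
proof -
  let ?F = "\<lambda>s t. contour_integral (circlepath z r) (\<lambda>u. G s u / (u - t))"
  let ?D = "\<lambda>s t. contour_integral (circlepath z r) (\<lambda>u. G s u / (u - t)^2)"
  have "(\<lambda>s. ?F s t0) holomorphic_on ball a e"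
  proof (rule holomorphic_on_contour_integral_circlepath)
    show "continuous_on (cball a e \<times> sphere z r) (\<lambda>(s, t). G s t / (t - t0))"
      using G st unfolding case_prod_beta by (intro continuous_intros) auto
    show "(\<lambda>s. G s t / (t - t0)) holomorphic_on ball a e" if "t \<in> sphere z r" for t
      using hol[OF that] that st by (intro holomorphic_intros) auto
  qed fact+
  then have A: "((\<lambda>s. ?F s t0) has_field_derivative deriv (\<lambda>s. ?F s t0) s0) (at s0)"
    using st by (intro holomorphic_derivI) auto
  have B: "(?F s has_field_derivative ?D s t) (at t)" if "s \<in> ball a e" "t \<in> ball z r" for s t
  proof -
    have 1: "continuous_on (sphere z r) (\<lambda>t. (s, t))" by (intro continuous_intros)
    have 2: "(\<lambda>t. (s, t)) ` sphere z r \<subseteq> cball a e \<times> sphere z r" using that by auto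
    have "continuous_on (path_image (circlepath z r)) (G s)"
      using continuous_on_compose2[OF G 1 2] \<open>0 < r\<close> by simp
    moreover have "((\<lambda>u. G s u / (u - w) ^ 1) has_contour_integral ?F s w) (circlepath z r)"
      if "w \<in> ball z r" for w
      unfolding power_one_right
      using calculation that \<open>0 < r\<close>
      by (intro has_contour_integral_integral contour_integrable_continuous_circlepath
          continuous_intros) auto
    ultimately show ?thesis
      using Cauchy_next_derivative_circlepath(2)[of z r "G s" 1 "?F s", OF _ _ _ that(2)]
      by (simp add: power2_eq_square)
  qed
  have *: "continuous_on ((ball a e \<times> ball z r) \<times> sphere z r)
      (\<lambda>(x, u). G (fst x) u / (u - snd x)^2)"
    unfolding case_prod_beta
  proof (intro continuous_intros)
    have 1: "continuous_on ((ball a e \<times> ball z r) \<times> sphere z r) (\<lambda>x. (fst (fst x), snd x))"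
      by (intro continuous_intros)
    have 2: "(\<lambda>x. (fst (fst x), snd x)) ` ((ball a e \<times> ball z r) \<times> sphere z r)
        \<subseteq> cball a e \<times> sphere z r"
      by auto
    from continuous_on_compose2[OF G 1 2]
    show "continuous_on ((ball a e \<times> ball z r) \<times> sphere z r) (\<lambda>x. G (fst (fst x)) (snd x))"
      by simp
  qed auto
  have C: "continuous_on (ball a e \<times> ball z r) (\<lambda>x. ?D (fst x) (snd x))"
    using \<open>0 < r\<close> continuous_on_contour_integral_circlepath[OF *] by simp
  have "((\<lambda>(s, t). ?F s t) has_derivative
      (\<lambda>(u, v). deriv (\<lambda>s. ?F s t0) s0 * u + blinfun_mult_right (?D s0 t0) v))
      (at (s0, t0) within ball a e \<times> ball z r)"
  proof (rule has_derivative_partialsI)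
    show "((\<lambda>s. ?F s t0) has_derivative (*) (deriv (\<lambda>s. ?F s t0) s0)) (at s0 within ball a e)"
      using A by (simp add: has_field_derivative_def has_derivative_at_withinI)
    show "(?F s has_derivative blinfun_apply (blinfun_mult_right (?D s t))) (at t within ball z r)"
      if "s \<in> ball a e" "t \<in> ball z r" for s t
      using B[OF that] by (simp add: has_field_derivative_def has_derivative_at_withinI)
    have "continuous_on (ball a e \<times> ball z r) (\<lambda>x. blinfun_mult_right (?D (fst x) (snd x)))"
      by (intro continuous_intros C)
    then show "continuous (at (s0, t0) within ball a e \<times> ball z r)
        (\<lambda>(s, t). blinfun_mult_right (?D s t))"
      using st unfolding case_prod_beta by (auto simp: continuous_on_eq_continuous_within)
  qed (use st in auto)
  moreover have "at (s0, t0) within ball a e \<times> ball z r = at (s0, t0)"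
    using st by (intro at_within_open open_Times) auto
  ultimately have "((\<lambda>(s, t). ?F s t) has_derivative
      (\<lambda>(u, v). deriv (\<lambda>s. ?F s t0) s0 * u + ?D s0 t0 * v)) (at (s0, t0))"
    by (simp only: blinfun_mult_right.rep_eq)
  then show ?thesis unfolding cdifferentiable_at_def by (intro exI)
qed

lemma continuous_on_slice:
  assumes "continuous_on (A \<times> B) (\<lambda>(s, t). G s t)" "s \<in> A"
  shows "continuous_on B (G s)"
proof -
  have 1: "continuous_on B (\<lambda>t. (s, t))" by (intro continuous_intros)
  have 2: "(\<lambda>t. (s, t)) ` B \<subseteq> A \<times> B" using assms by auto
  from continuous_on_compose2[OF assms(1) 1 2] show ?thesis by simp
qed

section \<open>Moments on a circle and common denominators\<close>

lemma circle_integrable: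
  "0 \<le> r \<Longrightarrow> continuous_on (sphere z r) f \<Longrightarrow> f contour_integrable_on circlepath z r"
  by (intro contour_integrable_continuous_circlepath) (simp add: path_image_circlepath_nonneg)

lemma circle_integral_cong:
  assumes "0 \<le> r" "\<And>u. u \<in> sphere z r \<Longrightarrow> f u = g u"
  shows "contour_integral (circlepath z r) f = contour_integral (circlepath z r) g"
  by (rule contour_integral_cong) (use assms path_image_circlepath_nonneg in auto)

text \<open>Cauchy's formula for \<open>f u * u\<close> at the centre returns the value
  \<open>f 0 * 0\<close>. This form of Cauchy's theorem admits functions that are merely continuous
  on the boundary circle.\<close>

lemma circle_integral_holomorphic:
  assumes "0 < r" "continuous_on (cball 0 r) f" "f holomorphic_on ball 0 r"
  shows "contour_integral (circlepath 0 r) f = 0"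
proof -
  have "((\<lambda>u. (f u * u) / (u - 0)) has_contour_integral 2 * of_real pi * \<i> * (f 0 * 0)) (circlepath 0 r)"
    by (rule Cauchy_integral_circlepath)
      (use assms in \<open>auto intro!: continuous_intros holomorphic_intros\<close>)
  then have "contour_integral (circlepath 0 r) (\<lambda>u. (f u * u) / (u - 0)) = 0"
    by (simp add: contour_integral_unique)
  moreover have "contour_integral (circlepath 0 r) (\<lambda>u. (f u * u) / (u - 0)) =
      contour_integral (circlepath 0 r) f"
    by (rule circle_integral_cong) (use assms(1) in auto)
  ultimately show ?thesis by simp
qed

lemma poly_eq_sum_coeff:
  fixes p :: "'a::comm_semiring_1 poly"
  assumes "degree p < n"
  shows "poly p u = (\<Sum>i<n. coeff p i * u ^ i)"
proof -
  have "poly p u = (\<Sum>i\<le>degree p. coeff p i * u ^ i)" by (rule poly_altdef)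
  also have "\<dots> = (\<Sum>i<n. coeff p i * u ^ i)"
    by (rule sum.mono_neutral_left) (use assms in \<open>auto intro: le_degree\<close>)
  finally show ?thesis .
qed

text \<open>The left side is row \<open>m\<close> of a Hankel matrix applied to the coefficients of
  \<open>p\<close>. The vanishing of the moments of \<open>p w\<close> is thus a linear condition on
  \<open>p\<close>.\<close>

lemma circle_integral_poly_moments:
  assumes "0 \<le> r" "continuous_on (sphere 0 r) w" "degree p < n"
  shows "(\<Sum>i<n. coeff p i * contour_integral (circlepath 0 r) (\<lambda>u. u ^ (m + i) * w u)) =
    contour_integral (circlepath 0 r) (\<lambda>u. u ^ m * (poly p u * w u))"
proof -
  have "(\<Sum>i<n. coeff p i * contour_integral (circlepath 0 r) (\<lambda>u. u ^ (m + i) * w u)) =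
      (\<Sum>i<n. contour_integral (circlepath 0 r) (\<lambda>u. coeff p i * (u ^ (m + i) * w u)))"
    by (intro sum.cong refl contour_integral_lmul[symmetric] circle_integrable assms
        continuous_intros)
  also have "\<dots> = contour_integral (circlepath 0 r) (\<lambda>u. \<Sum>i<n. coeff p i * (u ^ (m + i) * w u))"
    by (intro contour_integral_sum[symmetric] circle_integrable assms continuous_intros) auto
  also have "\<dots> = contour_integral (circlepath 0 r) (\<lambda>u. u ^ m * (poly p u * w u))"
    unfolding poly_eq_sum_coeff[OF assms(3)]
    by (intro arg_cong2[where f = contour_integral] refl)
      (simp add: fun_eq_iff sum_distrib_left sum_distrib_right power_add algebra_simps)
  finally show ?thesis .
qed

lemma circle_integral_poly_eq_0:
  assumes "0 \<le> r" "continuous_on (sphere 0 r) w"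
    and "\<And>m. contour_integral (circlepath 0 r) (\<lambda>u. u ^ m * w u) = 0"
  shows "contour_integral (circlepath 0 r) (\<lambda>u. poly p u * w u) = 0"
  using circle_integral_poly_moments[OF assms(1,2), of p "Suc (degree p)" 0] assms(3) by simp

text \<open>
  The difference quotient of \<open>q\<close> is a polynomial in \<open>u\<close>, hence integrates to zero against \<open>w\<close>.
\<close>

lemma circle_integral_poly_kernel:
  assumes r: "0 < r" and w: "continuous_on (sphere 0 r) w"
    and mom: "\<And>m. contour_integral (circlepath 0 r) (\<lambda>u. u ^ m * w u) = 0"
    and t: "t \<in> ball 0 r"
  shows "contour_integral (circlepath 0 r) (\<lambda>u. poly q u * w u / (u - t)) =
    poly q t * contour_integral (circlepath 0 r) (\<lambda>u. w u / (u - t))"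
proof -
  have "[:- t, 1:] dvd q - [:poly q t:]" by (simp flip: poly_eq_0_iff_dvd)
  then obtain R where R: "q - [:poly q t:] = [:- t, 1:] * R" by (elim dvdE)
  have q: "poly q u = poly q t + (u - t) * poly R u" for u
    using arg_cong[OF R, of "\<lambda>p. poly p u"] by (simp add: algebra_simps)
  have nz: "u - t \<noteq> 0" if "u \<in> sphere 0 r" for u using that t by auto
  have "contour_integral (circlepath 0 r) (\<lambda>u. poly q u * w u / (u - t)) =
      contour_integral (circlepath 0 r) (\<lambda>u. poly q t * (w u / (u - t)) + poly R u * w u)"
  proof (rule circle_integral_cong)
    fix u :: complex assume "u \<in> sphere 0 r"
    then show "poly q u * w u / (u - t) = poly q t * (w u / (u - t)) + poly R u * w u"
      using nz[of u] by (simp add: q[of u] field_simps)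
  qed (use r in simp)
  also have "\<dots> = poly q t * contour_integral (circlepath 0 r) (\<lambda>u. w u / (u - t)) +
      contour_integral (circlepath 0 r) (\<lambda>u. poly R u * w u)"
  proof -
    have 1: "(\<lambda>u. w u / (u - t)) contour_integrable_on circlepath 0 r"
      and 2: "(\<lambda>u. poly R u * w u) contour_integrable_on circlepath 0 r"
      using r w nz by (auto intro!: circle_integrable continuous_intros)
    show ?thesis
      by (simp only: contour_integral_add[OF contour_integrable_lmul[OF 1] 2] contour_integral_lmul[OF 1])
  qed
  also have "contour_integral (circlepath 0 r) (\<lambda>u. poly R u * w u) = 0"
    using r by (intro circle_integral_poly_eq_0 w mom) auto
  finally show ?thesis by simp
qed

text \<open>As the moments of \<open>P w\<close> vanish, \<open>q\<close> can be moved under the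
  integral; there \<open>q w\<close> is holomorphic in the disc and Cauchy's formula applies. Away
  from the zeros of \<open>q\<close> the integral is \<open>2 * pi * \<i> * P t * w t\<close>, so
  that all coordinates \<open>w\<close> get multiplied by one and the same factor.\<close>

lemma Cauchy_integral_clear_denominator:
  assumes r: "0 < r" and w: "continuous_on (sphere 0 r) w"
    and P: "continuous_on (cball 0 r) P" "P holomorphic_on ball 0 r"
    and mom: "\<And>m. contour_integral (circlepath 0 r) (\<lambda>u. u ^ m * (P u * w u)) = 0"
    and q: "continuous_on (cball 0 r) (\<lambda>u. poly q u * w u)" "(\<lambda>u. poly q u * w u) holomorphic_on ball 0 r"
    and t: "t \<in> ball 0 r"
  shows "poly q t * contour_integral (circlepath 0 r) (\<lambda>u. P u * w u / (u - t)) =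
    2 * pi * \<i> * P t * (poly q t * w t)"
proof -
  have "continuous_on (sphere 0 r) (\<lambda>u. P u * w u)"
    using w continuous_on_subset[OF P(1)] by (intro continuous_intros) auto
  from circle_integral_poly_kernel[OF r this mom t, of q]
  have "poly q t * contour_integral (circlepath 0 r) (\<lambda>u. P u * w u / (u - t)) =
      contour_integral (circlepath 0 r) (\<lambda>u. P u * (poly q u * w u) / (u - t))"
    by (simp add: mult_ac)
  also have "\<dots> = 2 * pi * \<i> * (P t * (poly q t * w t))"
    using Cauchy_integral_circlepath[OF continuous_on_mult[OF P(1) q(1)] holomorphic_on_mult[OF P(2) q(2)]] t
    by (intro contour_integral_unique) simp
  finally show ?thesis by simp
qed

section \<open>Zeros of holomorphic functions of one variable\<close>

lemma holomorphic_nonzero_punctured_ball: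
  assumes "f holomorphic_on ball a e" "b \<in> ball a e" "f b \<noteq> 0"
  obtains d where "0 < d" "d \<le> e" "\<And>s. s \<in> ball a d \<Longrightarrow> s \<noteq> a \<Longrightarrow> f s \<noteq> 0"
proof (cases "f a = 0")
  case True
  have a: "a \<in> ball a e" using assms(2) by (simp add: le_less_trans[OF zero_le_dist])
  obtain d where d: "0 < d" "ball a d \<subseteq> ball a e" "\<And>s. s \<in> ball a d - {a} \<Longrightarrow> f s \<noteq> 0"
    by (rule isolated_zeros[OF assms(1) open_ball connected_ball a True assms(2,3)], rule that)
  then show ?thesis by (intro that[of d]) (auto simp: ball_subset_ball_iff)
next
  case False
  have e: "0 < e" using assms(2) by (simp add: le_less_trans[OF zero_le_dist])
  have "isCont f a"
    using assms(1) e holomorphic_on_imp_continuous_on continuous_on_eq_continuous_at open_ball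
      centre_in_ball by blast
  from continuous_at_avoid[OF this False]
  obtain d where d: "0 < d" "\<And>y. dist a y < d \<Longrightarrow> f y \<noteq> 0" by blast
  then show ?thesis using e by (intro that[of "min d e"]) auto
qed

text \<open>Divide by the largest power of \<open>s\<close> common to all components. It exists
  because a component that is not identically zero vanishes at 0 to finite order.\<close>

lemma holomorphic_divide_out_zero:
  fixes c :: "nat \<Rightarrow> complex \<Rightarrow> complex"
  assumes "0 < e" and hol: "\<And>i. i < n \<Longrightarrow> c i holomorphic_on ball 0 e"
    and nz: "\<exists>i<n. \<exists>s\<in>ball 0 e. c i s \<noteq> 0"
  obtains m d where "\<And>i. i < n \<Longrightarrow> d i holomorphic_on ball 0 e"
    "\<And>i s. i < n \<Longrightarrow> s \<in> ball 0 e \<Longrightarrow> c i s = s ^ m * d i s" "\<exists>i<n. d i 0 \<noteq> 0"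
proof -
  define K where "K m d \<longleftrightarrow> (\<forall>i<n. d i holomorphic_on ball 0 e \<and>
      (\<forall>s\<in>ball 0 e. c i s = s ^ m * d i s))" for m and d :: "nat \<Rightarrow> complex \<Rightarrow> complex"
  obtain j b where j: "j < n" "b \<in> ball 0 e" "c j b \<noteq> 0" using nz by blast
  have K0: "K 0 c" using hol by (simp add: K_def)
  have "\<exists>M. \<forall>m. (\<exists>d. K m d) \<longrightarrow> m \<le> M"
  proof (cases "c j 0 = 0")
    case False
    have "m \<le> 0" if "K m d" for m d
    proof (rule ccontr)
      assume "\<not> m \<le> 0"
      with that j(1) \<open>0 < e\<close> have "c j 0 = 0" by (simp add: K_def power_0_left)
      with False show False by simp
    qed
    then show ?thesis by blast
  next
    case True
    have nc: "\<not> c j constant_on ball 0 e"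
      using True j(2,3) \<open>0 < e\<close> unfolding constant_on_def by (metis centre_in_ball)
    have 0: "0 \<in> ball (0::complex) e" using \<open>0 < e\<close> by simp
    obtain g r N where g: "0 < N" "0 < r" "ball (0::complex) r \<subseteq> ball 0 e" "g holomorphic_on ball 0 r"
      "\<And>w. w \<in> ball 0 r \<Longrightarrow> c j w = (w - 0) ^ N * g w" "\<And>w. w \<in> ball 0 r \<Longrightarrow> g w \<noteq> 0"
      by (rule holomorphic_factor_zero_nonconstant[OF hol[OF j(1)] open_ball connected_ball 0 True nc],
          rule that)
    have "m \<le> N" if K: "K m d" for m d
    proof (rule ccontr)
      assume "\<not> m \<le> N"
      then obtain l where l: "m = Suc (N + l)" using less_imp_Suc_add by (metis not_le)
      \<comment> \<open>Off 0 the factor \<open>s ^ N\<close> cancels and leaves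
        \<open>g s = s * s ^ l * d j s\<close>. The identity theorem carries this equation to 0,
        where it contradicts \<open>g 0 \<noteq> 0\<close>.\<close>
      have "g 0 - 0 * 0 ^ l * d j 0 = 0"
      proof (rule analytic_continuation_open[where s = "ball 0 r - {0}" and s' = "ball 0 r"
            and f = "\<lambda>s. g s - s * s ^ l * d j s" and g = "\<lambda>_. 0" and z = 0])
        have "d j holomorphic_on ball 0 r"
          using K j(1) g(3) holomorphic_on_subset unfolding K_def by blast
        then show "(\<lambda>s. g s - s * s ^ l * d j s) holomorphic_on ball 0 r"
          using g(4) by (intro holomorphic_intros)
        have "complex_of_real (r/2) \<in> ball 0 r - {0}" using g(2) by simp
        then show "ball (0::complex) r - {0} \<noteq> {}" by blast
        show "g s - s * s ^ l * d j s = 0" if s: "s \<in> ball 0 r - {0}" for s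
        proof -
          have "s \<in> ball 0 r" "s \<in> ball 0 e" using s g(3) by auto
          then have "s ^ N * g s = s ^ m * d j s" using g(5)[of s] K j(1) by (simp add: K_def)
          then show ?thesis using s by (simp add: l power_add)
        qed
      qed (use g(2) in \<open>simp_all add: open_Diff\<close>)
      with g(2,6) show False by simp
    qed
    then show ?thesis by blast
  qed
  then obtain M where M: "\<And>m. \<exists>d. K m d \<Longrightarrow> m \<le> M" by blast
  define m where "m = (GREATEST m. \<exists>d. K m d)"
  have "\<exists>d. K m d" unfolding m_def by (rule GreatestI_nat[where k = 0 and b = M]) (use K0 M in blast)+
  then obtain d where d: "K m d" ..
  have max: "\<not> K (Suc m) d'" for d'
  proof
    assume "K (Suc m) d'"
    then have "Suc m \<le> m" unfolding m_def by (intro Greatest_le_nat[where b = M]) (use M in blast)+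
    then show False by simp
  qed
  have "\<exists>i<n. d i 0 \<noteq> 0"
  proof (rule ccontr)
    assume *: "\<not> ?thesis"
    \<comment> \<open>If all \<open>d i\<close> vanish at 0, their difference quotients, completed
      at 0 by the derivative, split off one more factor \<open>s\<close>.\<close>
    have "K (Suc m) (\<lambda>i s. if s = 0 then deriv (d i) 0 else (d i s - d i 0) / (s - 0))"
      unfolding K_def
    proof (intro allI impI conjI ballI)
      fix i assume i: "i < n"
      show "(\<lambda>s. if s = 0 then deriv (d i) 0 else (d i s - d i 0) / (s - 0)) holomorphic_on ball 0 e"
        using d i \<open>0 < e\<close> by (intro pole_lemma) (simp_all add: K_def interior_open)
      show "c i s = s ^ Suc m * (if s = 0 then deriv (d i) 0 else (d i s - d i 0) / (s - 0))"
        if "s \<in> ball 0 e" for s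
      proof -
        have "c i s = s ^ m * d i s" "d i 0 = 0" using d i * that by (simp_all add: K_def)
        then show ?thesis by simp
      qed
    qed
    with max show False by blast
  qed
  moreover have "d i holomorphic_on ball 0 e" if "i < n" for i
    using d that unfolding K_def by blast
  moreover have "c i s = s ^ m * d i s" if "i < n" "s \<in> ball 0 e" for i s
    using d that unfolding K_def by blast
  ultimately show ?thesis by (intro that)
qed

section \<open>Null sets and duality bounds for square sums\<close>

lemma open_imp_fsigma:
  fixes S :: "'a::euclidean_space set"
  assumes "open S"
  shows "fsigma S"
proof -
  obtain C :: "nat \<Rightarrow> 'a set" where "\<And>n. compact (C n)" "\<Union>(range C) = S"
    by (rule open_Union_compact_subsets[OF assms], rule that)
  then show ?thesis using compact_imp_closed fsigma.intros[of C] by auto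
qed

lemma countable_imp_negligible:
  fixes S :: "'a::euclidean_space set"
  assumes "countable S"
  shows "negligible S"
  unfolding negligible_iff_null_sets
  using countable_imp_null_set_lborel[OF assms] by (rule null_sets_completionI)

text \<open>The converse of the Cauchy-Schwarz inequality, by testing with
  \<open>a j = cnj (x j)\<close>. It reduces estimates in the Hilbert space norm to estimates of
  single complex-valued functions, which integral formulas provide with a constant independent of
  \<open>N\<close>.\<close>

lemma sum_square_le_of_bilinear_bound:
  fixes x :: "nat \<Rightarrow> complex"
  assumes "0 \<le> C" "\<And>a. cmod (\<Sum>j<N. a j * x j) \<le> C * L2_set (\<lambda>j. cmod (a j)) {..<N}"
  shows "(\<Sum>j<N. (cmod (x j))\<^sup>2) \<le> C\<^sup>2"
proof -
  let ?L = "L2_set (\<lambda>j. cmod (x j)) {..<N}"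
  have "(\<Sum>j<N. cnj (x j) * x j) = of_real (\<Sum>j<N. (cmod (x j))\<^sup>2)"
    by (simp add: complex_norm_square mult.commute del: of_real_power)
  then have "\<bar>\<Sum>j<N. (cmod (x j))\<^sup>2\<bar> \<le> C * ?L"
    using assms(2)[of "\<lambda>j. cnj (x j)"] by (simp flip: of_real_power of_real_sum)
  moreover have L: "(\<Sum>j<N. (cmod (x j))\<^sup>2) = ?L\<^sup>2"
    by (simp add: L2_set_def sum_nonneg)
  ultimately have "?L * ?L \<le> C * ?L" by (simp add: power2_eq_square)
  then have "?L \<le> C"
    using assms(1) L2_set_nonneg[of "\<lambda>j. cmod (x j)" "{..<N}"]
    by (cases "?L = 0") (auto simp: mult_le_cancel_right)
  then show ?thesis unfolding L by (intro power_mono) auto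
qed

lemma cmod_sum_mult_le_L2:
  fixes a x :: "nat \<Rightarrow> complex"
  assumes "(\<Sum>j<N. (cmod (x j))\<^sup>2) \<le> M"
  shows "cmod (\<Sum>j<N. a j * x j) \<le> sqrt M * L2_set (\<lambda>j. cmod (a j)) {..<N}"
proof -
  have "cmod (\<Sum>j<N. a j * x j) \<le> (\<Sum>j<N. \<bar>cmod (a j)\<bar> * \<bar>cmod (x j)\<bar>)"
    by (rule order.trans[OF norm_sum]) (simp add: norm_mult)
  also have "\<dots> \<le> L2_set (\<lambda>j. cmod (a j)) {..<N} * L2_set (\<lambda>j. cmod (x j)) {..<N}"
    by (rule L2_set_mult_ineq)
  also have "\<dots> \<le> L2_set (\<lambda>j. cmod (a j)) {..<N} * sqrt M"
    by (intro mult_left_mono L2_set_nonneg) (use assms in \<open>simp add: L2_set_def\<close>)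
  finally show ?thesis by (simp add: mult.commute)
qed

text \<open>
  The family \<open>\<omega>\<close> is rational in \<open>t\<close>, with a common denominator, for every parameter \<open>s\<close> outside
  the null set \<open>E\<close>. The possible denominators of bounded degree are cut out by the vanishing of
  holomorphic moments, so some \<open>P\<close>, polynomial in \<open>t\<close> with holomorphic coefficients, works for all
  \<open>s\<close>. Minimality of its degree prevents the extension of \<open>P \<omega>\<close> to the disc from having a
  divisor of common zeros.
\<close>

lemma common_denominator_extension:
  fixes \<omega> :: "nat \<Rightarrow> complex \<Rightarrow> complex \<Rightarrow> complex"
  assumes e: "0 < e" and r: "0 < r"
    and cont: "\<And>j. continuous_on (cball 0 e \<times> sphere 0 r) (\<lambda>(s, t). \<omega> j s t)"
    and hol: "\<And>j t. t \<in> sphere 0 r \<Longrightarrow> (\<lambda>s. \<omega> j s t) holomorphic_on ball 0 e"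
    and E: "negligible E"
    and rat: "\<And>s. s \<in> ball 0 e - E \<Longrightarrow> \<exists>Q::complex poly. Q \<noteq> 0 \<and>
      (\<forall>j. continuous_on (cball 0 r) (\<lambda>t. poly Q t * \<omega> j s t) \<and>
        (\<lambda>t. poly Q t * \<omega> j s t) holomorphic_on ball 0 r)"
    and one: "\<And>s t. s \<in> cball 0 e \<Longrightarrow> t \<in> sphere 0 r \<Longrightarrow> \<omega> k s t = 1"
    and bnd: "\<And>s t N. s \<in> cball 0 e \<Longrightarrow> t \<in> sphere 0 r \<Longrightarrow> (\<Sum>j<N. (cmod (\<omega> j s t))\<^sup>2) \<le> M"
  obtains h e' r' M' where "0 < e'" "e' \<le> e" "0 < r'" "r' \<le> r"
    "\<And>j s t. s \<in> ball 0 e' \<Longrightarrow> t \<in> ball 0 r' \<Longrightarrow> cdifferentiable_at (\<lambda>(s, t). h j s t) (s, t)"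
    "\<And>s t N. s \<in> ball 0 e' \<Longrightarrow> t \<in> ball 0 r' \<Longrightarrow> (\<Sum>j<N. (cmod (h j s t))\<^sup>2) \<le> M'"
    "\<And>s t. s \<in> ball 0 e' \<Longrightarrow> t \<in> ball 0 r' \<Longrightarrow> (s, t) \<noteq> (0, 0) \<Longrightarrow> \<exists>j. h j s t \<noteq> 0"
    "\<And>s. s \<in> ball 0 e' - E \<Longrightarrow> \<exists>Z. finite Z \<and> (\<forall>t\<in>ball 0 r' - Z. \<exists>p. \<forall>j. h j s t = p * \<omega> j s t)"
proof -
  let ?I = "contour_integral (circlepath 0 r)"
  let ?S = "ball (0::complex) e"
  \<comment> \<open>The equations are indexed by pairs \<open>\<alpha> = (m, j)\<close> of an
    exponent and a coordinate, the unknowns by the power \<open>i\<close> of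
    \<open>t\<close>.\<close>
  define \<mu> where "\<mu> = (\<lambda>\<alpha> i s. ?I (\<lambda>u. u ^ (fst \<alpha> + i) * \<omega> (snd \<alpha>) s u))"
  have r0: "0 \<le> r" using r by simp
  have c\<omega>: "continuous_on (sphere 0 r) (\<omega> j s)" if "s \<in> cball 0 e" for j s
    using cont that by (rule continuous_on_slice)
  have \<mu>: "\<mu> \<alpha> i holomorphic_on ?S" for \<alpha> i
    unfolding \<mu>_def
  proof (rule holomorphic_on_contour_integral_circlepath)
    show "continuous_on (cball 0 e \<times> sphere 0 r) (\<lambda>(s, u). u ^ (fst \<alpha> + i) * \<omega> (snd \<alpha>) s u)"
      using cont[of "snd \<alpha>"] unfolding case_prod_beta by (intro continuous_intros)
    show "(\<lambda>s. u ^ (fst \<alpha> + i) * \<omega> (snd \<alpha>) s u) holomorphic_on ?S" if "u \<in> sphere 0 r" for u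
      using hol[OF that] by (intro holomorphic_intros)
  qed fact+
  have poly_kills: "(\<Sum>i<n. coeff p i * \<mu> (m, j) i s) = ?I (\<lambda>u. u ^ m * (poly p u * \<omega> j s u))"
    if "s \<in> cball 0 e" "degree p < n" for p n m j s
    unfolding \<mu>_def fst_conv snd_conv
    by (rule circle_integral_poly_moments[OF r0 c\<omega>]) (use that in auto)
  \<comment> \<open>The two alternatives of the elimination: \<open>K\<close> says that
    \<open>n\<close> coefficients admit a holomorphic solution that is not identically zero,
    \<open>D\<close> that nontrivial solutions exist at most over the zeros of
    \<open>\<delta>\<close>.\<close>
  define K where "K n c \<longleftrightarrow> (\<forall>i<n. c i holomorphic_on ?S) \<and> (\<exists>i<n. \<exists>s\<in>?S. c i s \<noteq> 0) \<and>
      (\<forall>\<alpha>. \<forall>s\<in>?S. (\<Sum>i<n. c i s * \<mu> \<alpha> i s) = 0)" for n c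
  define D where "D n \<delta> \<longleftrightarrow> \<delta> holomorphic_on ?S \<and> (\<exists>s\<in>?S. \<delta> s \<noteq> 0) \<and>
      (\<forall>s\<in>?S. (\<exists>c. (\<exists>i<n. c i \<noteq> 0) \<and> (\<forall>\<alpha>. (\<Sum>i<n. c i * \<mu> \<alpha> i s) = 0)) \<longrightarrow> \<delta> s = 0)" for n \<delta>
  have KD: "(\<exists>c. K n c) \<or> (\<exists>\<delta>. D n \<delta>)" for n
    unfolding K_def D_def
    by (rule holomorphic_kernel_dichotomy) (use e \<mu> in auto)
  have D_dest: "\<delta> s = 0"
    if "D n \<delta>" "s \<in> ?S" "p \<noteq> 0" "degree p < n"
      "\<And>m j. ?I (\<lambda>u. u ^ m * (poly p u * \<omega> j s u)) = 0" for n \<delta> s p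
  proof -
    have "coeff p (degree p) \<noteq> 0" using that(3) by simp
    then have "\<exists>i<n. coeff p i \<noteq> 0" using that(4) by blast
    moreover have "(\<Sum>i<n. coeff p i * \<mu> \<alpha> i s) = 0" for \<alpha>
      using poly_kills[of s p n "fst \<alpha>" "snd \<alpha>"] that(2,4,5) by simp
    ultimately show ?thesis using that(1,2) unfolding D_def by blast
  qed
  \<comment> \<open>Otherwise each \<open>n\<close> has its function \<open>\<delta> n\<close>, with
    countably many zeros. Every \<open>s\<close> outside \<open>E\<close> has a denominator of some
    degree and is therefore a zero of one of these functions, so the disc would be a null
    set.\<close>
  have "\<exists>n c. K n c"
  proof (rule ccontr)
    assume "\<not> ?thesis"
    then have "\<forall>n. \<exists>\<delta>. D n \<delta>" using KD by blast
    then obtain \<delta> where \<delta>: "\<And>n. D n (\<delta> n)" by metis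
    have "?S \<subseteq> E \<union> (\<Union>n. {s \<in> ?S. \<delta> n s = 0})"
    proof
      fix s assume s: "s \<in> ?S"
      show "s \<in> E \<union> (\<Union>n. {s \<in> ?S. \<delta> n s = 0})"
      proof (cases "s \<in> E")
        case False
        then obtain Q where Q: "Q \<noteq> 0" "\<And>j. continuous_on (cball 0 r) (\<lambda>t. poly Q t * \<omega> j s t)"
          "\<And>j. (\<lambda>t. poly Q t * \<omega> j s t) holomorphic_on ball 0 r"
          using rat[of s] s by blast
        \<comment> \<open>\<open>Q\<close> has \<open>Suc (degree Q)\<close> coefficients, and all
          moments of \<open>Q \<omega>\<close> vanish because these products are holomorphic in the
          disc.\<close>
        have "\<delta> (Suc (degree Q)) s = 0"
          by (rule D_dest[OF \<delta> s Q(1)])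
            (auto intro!: circle_integral_holomorphic r Q continuous_intros holomorphic_intros)
        then show ?thesis using s by blast
      qed simp
    qed
    moreover have "countable {s \<in> ?S. \<delta> n s = 0}" for n
    proof (cases "\<delta> n constant_on ?S")
      case True
      with \<delta>[of n] have "{s \<in> ?S. \<delta> n s = 0} = {}" unfolding D_def constant_on_def by auto
      then show ?thesis by (simp only: countable_empty)
    next
      case False
      with \<delta>[of n] show ?thesis
        by (intro holomorphic_countable_zeros) (auto simp: D_def open_imp_fsigma)
    qed
    then have "negligible (\<Union>n. {s \<in> ?S. \<delta> n s = 0})"
      by (intro countable_imp_negligible countable_UN) auto
    ultimately have "negligible ?S" using E negligible_Un negligible_subset by blast
    with open_not_negligible[of ?S] e show False by simp
  qed
  \<comment> \<open>The minimal number of coefficients. With one fewer only the second alternative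
    is left, and its \<open>\<delta>\<close> excludes denominators of smaller degree outside its
    zeros.\<close>
  define n where "n = (LEAST n. \<exists>c. K n c)"
  have "\<exists>c. K n c" unfolding n_def using \<open>\<exists>n c. K n c\<close> by (rule LeastI_ex)
  then obtain c where c: "K n c" ..
  have "n \<noteq> 0" using c by (auto simp: K_def)
  then obtain n' where n': "n = Suc n'" by (cases n) auto
  have "\<not> (\<exists>c. K n' c)" using not_less_Least[of n' "\<lambda>n. \<exists>c. K n c"] n' n_def by simp
  with KD obtain \<delta> where \<delta>: "D n' \<delta>" by blast
  \<comment> \<open>Without this division \<open>P 0\<close> might be the zero polynomial, and then
    all \<open>h j\<close> would vanish along the line \<open>s = 0\<close>.\<close>
  obtain m d where d: "\<And>i. i < n \<Longrightarrow> d i holomorphic_on ?S"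
    "\<And>i s. i < n \<Longrightarrow> s \<in> ?S \<Longrightarrow> c i s = s ^ m * d i s" and d0: "\<exists>i<n. d i 0 \<noteq> 0"
    by (rule holomorphic_divide_out_zero[OF e, of n c]) (use c in \<open>unfold K_def, blast+\<close>)
  have dkills: "(\<Sum>i<n. d i s * \<mu> \<alpha> i s) = 0" if s: "s \<in> ?S" for \<alpha> s
  proof (rule analytic_continuation_open[where s = "?S - {0}" and s' = ?S
        and f = "\<lambda>s. \<Sum>i<n. d i s * \<mu> \<alpha> i s" and g = "\<lambda>_. 0" and z = s])
    show "(\<lambda>s. \<Sum>i<n. d i s * \<mu> \<alpha> i s) holomorphic_on ?S"
      using d(1) \<mu> by (intro holomorphic_intros) auto
    have "complex_of_real (e/2) \<in> ?S - {0}" using e by simp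
    then show "?S - {0} \<noteq> {}" by blast
    show "(\<Sum>i<n. d i s * \<mu> \<alpha> i s) = 0" if s: "s \<in> ?S - {0}" for s
    proof -
      have "s ^ m * (\<Sum>i<n. d i s * \<mu> \<alpha> i s) = (\<Sum>i<n. c i s * \<mu> \<alpha> i s)"
        using s by (auto simp: sum_distrib_left d(2) mult.assoc intro!: sum.cong)
      also have "\<dots> = 0" using c s unfolding K_def by blast
      finally show ?thesis using s by simp
    qed
  qed (use s in \<open>simp_all add: open_Diff\<close>)
  define P where "P s = (\<Sum>i<n. monom (d i s) i)" for s
  have polyP: "poly (P s) u = (\<Sum>i<n. d i s * u ^ i)" for s u
    by (simp add: P_def poly_sum poly_monom)
  have coeffP: "coeff (P s) i = (if i < n then d i s else 0)" for s i
    by (simp add: P_def coeff_sum coeff_monom)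
  have degP: "degree (P s) < n" for s
    using degree_le[of n' "P s"] n' by (simp add: coeffP)
  have momP: "?I (\<lambda>u. u ^ m * (poly (P s) u * \<omega> j s u)) = 0" if "s \<in> ?S" for s m j
    using poly_kills[of s "P s" n m j] degP[of s] dkills[OF that, of "(m, j)"] that
    by (simp add: coeffP)
  define h where "h j s t = ?I (\<lambda>u. poly (P s) u * \<omega> j s u / (u - t))" for j s t
  obtain i0 where i0: "i0 < n" "d i0 0 \<noteq> 0" using d0 by blast
  obtain e1 where e1: "0 < e1" "e1 \<le> e" "\<And>s. s \<in> ball 0 e1 \<Longrightarrow> s \<noteq> 0 \<Longrightarrow> d i0 s \<noteq> 0"
    by (rule holomorphic_nonzero_punctured_ball[OF d(1)[OF i0(1)] _ i0(2)]) (use e in auto)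
  obtain b where b: "b \<in> ?S" "\<delta> b \<noteq> 0" using \<delta> by (auto simp: D_def)
  have \<delta>hol: "\<delta> holomorphic_on ?S" using \<delta> by (simp add: D_def)
  obtain e2 where e2: "0 < e2" "e2 \<le> e" "\<And>s. s \<in> ball 0 e2 \<Longrightarrow> s \<noteq> 0 \<Longrightarrow> \<delta> s \<noteq> 0"
    by (rule holomorphic_nonzero_punctured_ball[OF \<delta>hol b], rule that)
  \<comment> \<open>\<open>e / 2\<close> keeps the closed disc needed for Cauchy integrals inside
    the open disc where the coefficients are holomorphic. Within \<open>e1\<close> the polynomial
    \<open>P s\<close> is nonzero, and within \<open>e2\<close> the only possible zero of
    \<open>\<delta>\<close> is 0.\<close>
  define e' where "e' = min (e / 2) (min e1 e2)"
  have e': "0 < e'" "e' \<le> e / 2" "e' \<le> e1" "e' \<le> e2" using e e1 e2 by (auto simp: e'_def)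
  have Pnz: "P s \<noteq> 0" if "s \<in> ball 0 e'" for s
  proof -
    have "coeff (P s) i0 \<noteq> 0"
      using that e'(3) e1(3)[of s] i0 by (cases "s = 0") (auto simp: coeffP)
    then show ?thesis by auto
  qed
  have "finite {t. poly (P 0) t = 0}" using Pnz[of 0] e' by (intro poly_roots_finite) auto
  moreover have "infinite (ball (0::complex) (r / 2))"
    using r by (simp add: uncountable_infinite uncountable_ball)
  ultimately have "\<not> ball 0 (r / 2) \<subseteq> {t. poly (P 0) t = 0}" using finite_subset by blast
  then obtain t0 where t0: "t0 \<in> ball 0 (r / 2)" "poly (P 0) t0 \<noteq> 0" by blast
  have hP: "(\<lambda>t. poly (P 0) t) holomorphic_on ball 0 (r / 2)" by (intro holomorphic_intros)
  \<comment> \<open>The bound \<open>r / 2\<close> keeps \<open>t\<close> at distance at least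
    \<open>r / 2\<close> from the circle, for the estimate of the Cauchy kernel. The centre may
    remain a zero of \<open>P 0\<close>; this is the one common zero that is allowed.\<close>
  obtain r' where r': "0 < r'" "r' \<le> r / 2" "\<And>t. t \<in> ball 0 r' \<Longrightarrow> t \<noteq> 0 \<Longrightarrow> poly (P 0) t \<noteq> 0"
    by (rule holomorphic_nonzero_punctured_ball[OF hP t0], rule that)
  have cP: "continuous_on (cball 0 (e / 2) \<times> sphere 0 r) (\<lambda>x. poly (P (fst x)) (snd x))"
    unfolding polyP
  proof (intro continuous_intros)
    fix i assume "i \<in> {..<n}"
    then have "continuous_on (cball 0 (e / 2)) (d i)"
      using d(1)[of i] e
      by (intro holomorphic_on_imp_continuous_on[OF holomorphic_on_subset]) auto
    then show "continuous_on (cball 0 (e / 2) \<times> sphere 0 r) (\<lambda>x. d i (fst x))"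
      by (rule continuous_on_compose2) (auto intro!: continuous_intros)
  qed
  have cP\<omega>: "continuous_on (cball 0 (e / 2) \<times> sphere 0 r) (\<lambda>(s, u). poly (P s) u * \<omega> j s u)" for j
  proof -
    have "cball (0::complex) (e / 2) \<times> sphere (0::complex) r \<subseteq> cball 0 e \<times> sphere 0 r"
      using e by auto
    from continuous_on_mult[OF cP continuous_on_subset[OF cont[of j] this, unfolded case_prod_beta]]
    show ?thesis unfolding case_prod_beta .
  qed
  \<comment> \<open>On the circle \<open>\<omega> k\<close> is 1, so the integral with index
    \<open>k\<close> returns \<open>P\<close> itself. Common zeros of all \<open>h j\<close> are
    therefore zeros of \<open>P\<close>.\<close>
  have hk: "h k s t = 2 * pi * \<i> * poly (P s) t" if "s \<in> ?S" "t \<in> ball 0 r" for s t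
  proof -
    have "h k s t = ?I (\<lambda>u. poly (P s) u / (u - t))"
      unfolding h_def by (rule circle_integral_cong) (use r that in \<open>auto simp: one\<close>)
    also have "\<dots> = 2 * pi * \<i> * poly (P s) t"
    proof (rule contour_integral_unique)
      have "(\<lambda>u. poly (P s) u) holomorphic_on cball 0 r" by (intro holomorphic_intros)
      from Cauchy_integral_circlepath_simple[OF this, of t] that(2)
      show "((\<lambda>u. poly (P s) u / (u - t)) has_contour_integral 2 * pi * \<i> * poly (P s) t)
          (circlepath 0 r)"
        by (simp add: dist_norm)
    qed
    finally show ?thesis .
  qed
  have "compact ((\<lambda>x. poly (P (fst x)) (snd x)) ` (cball 0 (e / 2) \<times> sphere 0 r))"
    by (intro compact_continuous_image cP compact_Times) auto
  then obtain B where B: "\<And>s u. s \<in> cball 0 (e / 2) \<Longrightarrow> u \<in> sphere 0 r \<Longrightarrow> cmod (poly (P s) u) \<le> B"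
    "0 < B"
    unfolding bounded_pos by (force dest!: compact_imp_bounded simp: bounded_pos)
  have M0: "0 \<le> M" using bnd[of 0 "of_real r" 0] e r by simp
  \<comment> \<open>The constant is the product of the bound \<open>B\<close> for \<open>P\<close>
    on the circle, the bound \<open>sqrt M\<close> for the square-sum norm of
    \<open>\<omega>\<close>, the bound \<open>1 / (r / 2)\<close> for the kernel and the length of
    the circle, squared.\<close>
  show ?thesis
  proof (rule that[of e' r' h "(B * sqrt M / (r / 2) * (2 * pi * r))\<^sup>2"])
    show "0 < e'" "e' \<le> e" "0 < r'" "r' \<le> r" using e' r' e r by auto
    fix s t :: complex assume s: "s \<in> ball 0 e'" and t: "t \<in> ball 0 r'"
    have s2: "s \<in> ball 0 (e / 2)" "s \<in> ?S" and t2: "t \<in> ball 0 r" "cmod t < r / 2"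
      using s t e' r' e r by auto
    show "cdifferentiable_at (\<lambda>(s, t). h j s t) (s, t)" for j
      unfolding h_def
    proof (rule cdifferentiable_at_Cauchy_integral[OF cP\<omega>])
      show "(\<lambda>s. poly (P s) u * \<omega> j s u) holomorphic_on ball 0 (e / 2)" if "u \<in> sphere 0 r" for u
        unfolding polyP
        using e by (intro holomorphic_intros holomorphic_on_subset[OF hol[OF that]] holomorphic_on_subset[OF d(1)]) auto
    qed (use e r s2 t2 in auto)
    show "(\<Sum>j<N. (cmod (h j s t))\<^sup>2) \<le> (B * sqrt M / (r / 2) * (2 * pi * r))\<^sup>2" for N
    proof (rule sum_square_le_of_bilinear_bound)
      show "0 \<le> B * sqrt M / (r / 2) * (2 * pi * r)" using B M0 r by simp
      fix a :: "nat \<Rightarrow> complex"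
      let ?A = "L2_set (\<lambda>j. cmod (a j)) {..<N}"
      have nz: "u - t \<noteq> 0" if "u \<in> sphere 0 r" for u using that t2 by auto
      have int: "(\<lambda>u. poly (P s) u * \<omega> j s u / (u - t)) contour_integrable_on circlepath 0 r" for j
        using c\<omega>[of s j] s2 nz r by (intro circle_integrable continuous_intros) auto
      have "((\<lambda>u. \<Sum>j<N. a j * (poly (P s) u * \<omega> j s u / (u - t))) has_contour_integral
          (\<Sum>j<N. a j * h j s t)) (circlepath 0 r)"
        unfolding h_def
        by (intro has_contour_integral_sum has_contour_integral_lmul has_contour_integral_integral int) auto
      then have "cmod (\<Sum>j<N. a j * h j s t) \<le> (B * sqrt M / (r / 2) * ?A) * (2 * pi * r)"
      proof (rule has_contour_integral_bound_circlepath)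
        show "0 \<le> B * sqrt M / (r / 2) * ?A" using B M0 r by (simp add: L2_set_nonneg)
        fix u :: complex assume "cmod (u - 0) = r"
        then have u: "u \<in> sphere 0 r" by simp
        have ut: "r / 2 \<le> cmod (u - t)" using u t2 norm_triangle_ineq2[of u t] by simp
        have "(\<Sum>j<N. a j * (poly (P s) u * \<omega> j s u / (u - t))) =
            poly (P s) u * (\<Sum>j<N. a j * \<omega> j s u) / (u - t)"
          by (simp add: sum_distrib_left sum_divide_distrib mult_ac)
        also have "cmod \<dots> \<le> B * (sqrt M * ?A) / (r / 2)"
          unfolding norm_divide norm_mult
          using B(1)[of s u] B(2) M0 r u ut s2 cmod_sum_mult_le_L2[OF bnd[of s u N], of a]
          by (intro frac_le mult_mono mult_nonneg_nonneg) (auto simp: L2_set_nonneg)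
        finally show "cmod (\<Sum>j<N. a j * (poly (P s) u * \<omega> j s u / (u - t))) \<le> B * sqrt M / (r / 2) * ?A"
          by (simp add: mult_ac)
      qed (fact r)
      then show "cmod (\<Sum>j<N. a j * h j s t) \<le> B * sqrt M / (r / 2) * (2 * pi * r) * ?A"
        using r by (simp add: mult_ac)
    qed
    show "\<exists>j. h j s t \<noteq> 0" if "(s, t) \<noteq> (0, 0)"
    proof (cases "s = 0")
      case True
      then show ?thesis using hk[OF s2(2) t2(1)] r'(3)[OF t] that by (intro exI[of _ k]) auto
    next
      case False
      show ?thesis
      proof (rule ccontr)
        assume "\<not> ?thesis"
        then have h0: "h j s t = 0" for j by blast
        then have "[:- t, 1:] dvd P s"
          using hk[OF s2(2) t2(1)] by (simp flip: poly_eq_0_iff_dvd)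
        then obtain R where R: "P s = [:- t, 1:] * R" by (elim dvdE)
        have R0: "R \<noteq> 0" using R Pnz[OF s] by auto
        have "degree (P s) = Suc (degree R)" using R0 unfolding R by (subst degree_mult_eq) auto
        then have degR: "degree R < n'" using degP[of s] n' by simp
        have cPs: "continuous_on (sphere 0 r) (\<lambda>u. poly (P s) u * \<omega> j s u)" for j
          using c\<omega>[of s j] s2 by (intro continuous_intros) auto
        \<comment> \<open>Each moment of \<open>R \<omega>\<close> is a Cauchy integral of
          \<open>u ^ l\<close> times \<open>P \<omega>\<close>, and this equals
          \<open>t ^ l * h j s t = 0\<close>. So \<open>R\<close>, of smaller degree than
          \<open>P s\<close>, solves the equations at \<open>s\<close>, which forces
          \<open>\<delta> s = 0\<close>.\<close>
        have "?I (\<lambda>u. u ^ l * (poly R u * \<omega> j s u)) = 0" for l j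
        proof -
          have "?I (\<lambda>u. u ^ l * (poly R u * \<omega> j s u)) =
              ?I (\<lambda>u. poly (monom 1 l) u * (poly (P s) u * \<omega> j s u) / (u - t))"
          proof (rule circle_integral_cong)
            fix u :: complex assume "u \<in> sphere 0 r"
            then have "u \<noteq> t" using t2 by auto
            then show "u ^ l * (poly R u * \<omega> j s u) =
                poly (monom 1 l) u * (poly (P s) u * \<omega> j s u) / (u - t)"
              by (simp add: R poly_monom field_simps)
          qed (use r in simp)
          also have "\<dots> = poly (monom 1 l) t * h j s t"
            unfolding h_def by (rule circle_integral_poly_kernel[OF r cPs momP[OF s2(2)] t2(1)])
          finally show ?thesis using h0 by simp
        qed
        from D_dest[OF \<delta> s2(2) R0 degR this] e2(3)[of s] False s e' show False by auto
      qed
    qed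
  next
    fix s assume s: "s \<in> ball 0 e' - E"
    then have s2: "s \<in> ?S" using e' e by auto
    obtain Q where Q: "Q \<noteq> 0" "\<And>j. continuous_on (cball 0 r) (\<lambda>t. poly Q t * \<omega> j s t)"
      "\<And>j. (\<lambda>t. poly Q t * \<omega> j s t) holomorphic_on ball 0 r"
      using rat[of s] s2 s by blast
    show "\<exists>Z. finite Z \<and> (\<forall>t\<in>ball 0 r' - Z. \<exists>p. \<forall>j. h j s t = p * \<omega> j s t)"
    proof (intro exI[of _ "{t. poly Q t = 0}"] conjI ballI)
      show "finite {t. poly Q t = 0}" using Q(1) by (rule poly_roots_finite)
      fix t assume t: "t \<in> ball 0 r' - {t. poly Q t = 0}"
      then have t2: "t \<in> ball 0 r" using r' r by auto
      have "poly Q t * h j s t = 2 * pi * \<i> * poly (P s) t * (poly Q t * \<omega> j s t)" for j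
        unfolding h_def
        by (rule Cauchy_integral_clear_denominator[OF r _ _ _ momP[OF s2] Q(2,3) t2])
          (use s2 in \<open>auto intro!: c\<omega> continuous_intros holomorphic_intros\<close>)
      then have "h j s t = (2 * pi * \<i> * poly (P s) t) * \<omega> j s t" for j
        using t by (simp add: mult.left_commute)
      then show "\<exists>p. \<forall>j. h j s t = p * \<omega> j s t" by blast
    qed
  qed
qed

section \<open>Holomorphic maps into the Hilbert space\<close>

lemma summable_square_of_bounded_sums:
  fixes x :: "nat \<Rightarrow> complex"
  assumes "\<And>N. (\<Sum>j<N. (cmod (x j))\<^sup>2) \<le> B"
  shows "summable (\<lambda>j. (cmod (x j))\<^sup>2)"
proof (rule bounded_imp_summable)
  show "(\<Sum>j\<le>N. (cmod (x j))\<^sup>2) \<le> B" for N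
    using assms[of "Suc N"] by (simp add: lessThan_Suc_atMost)
qed simp

lemma norm_l2_le:
  assumes "0 \<le> C" "\<And>N. (\<Sum>j<N. (cmod (l2_nth x j))\<^sup>2) \<le> C\<^sup>2"
  shows "norm x \<le> C"
  unfolding norm_l2_def
  using suminf_le_const[OF summable_l2_nth assms(2)] assms(1) by (simp add: real_le_lsqrt)

lemma bounded_linear_scaleC_left: "bounded_linear (\<lambda>c. c *\<^sub>C (v :: 'a::complex_normed_vector))"
proof (rule bounded_linear_intro[where K = "norm v"])
  show "(r *\<^sub>R c) *\<^sub>C v = r *\<^sub>R c *\<^sub>C v" for r c
    by (simp add: scaleR_scaleC scaleC_scaleC scaleC_complex_def)
qed (simp_all add: scaleC_add_left norm_scaleC)

lemma has_field_derivative_along_line: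
  fixes G :: "'a::complex_normed_vector \<Rightarrow> complex"
  assumes "(G has_derivative D) (at (z + c *\<^sub>C v))" "\<And>c v. D (c *\<^sub>C v) = c *\<^sub>C D v"
  shows "((\<lambda>c. G (z + c *\<^sub>C v)) has_field_derivative D v) (at c)"
proof -
  have "((\<lambda>c. z + c *\<^sub>C v) has_derivative (\<lambda>c. c *\<^sub>C v)) (at c)"
    by (auto intro!: derivative_eq_intros bounded_linear.has_derivative[OF bounded_linear_scaleC_left])
  from has_derivative_compose[OF this, of G D] assms
  have "((\<lambda>c. G (z + c *\<^sub>C v)) has_derivative (\<lambda>c. c * D v)) (at c)"
    by (simp add: scaleC_complex_def)
  then show ?thesis
    by (simp add: has_field_derivative_def mult.commute[of _ "D v"])
qed

text \<open>The identity \<open>1 / (u - 1) - 1 / u - 1 / u\<^sup>2 = 1 / (u\<^sup>2 * (u -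
  1))\<close> writes the remainder as one integral over the circle of radius
  \<open>\<sigma>\<close>, and there \<open>cmod (u - 1)\<close> is at least
  \<open>\<sigma> / 2\<close>. The decay in \<open>\<sigma>\<close> later becomes a quadratic
  remainder term.\<close>

lemma Cauchy_first_order_remainder:
  assumes "continuous_on (cball 0 \<sigma>) \<phi>" "\<phi> holomorphic_on ball 0 \<sigma>" "2 \<le> \<sigma>"
    and "\<And>u. cmod u = \<sigma> \<Longrightarrow> cmod (\<phi> u) \<le> K"
  shows "cmod (\<phi> 1 - \<phi> 0 - deriv \<phi> 0) \<le> 2 * K / \<sigma>\<^sup>2"
proof -
  let ?c = "2 * of_real pi * \<i> :: complex"
  have K0: "0 \<le> K" using assms(4)[of "of_real \<sigma>"] assms(3) order.trans[OF norm_ge_zero] by auto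
  have 1: "((\<lambda>u. \<phi> u / (u - 1)) has_contour_integral ?c * \<phi> 1) (circlepath 0 \<sigma>)"
    and 2: "((\<lambda>u. \<phi> u / (u - 0)) has_contour_integral ?c * \<phi> 0) (circlepath 0 \<sigma>)"
    using assms(3) by (intro Cauchy_integral_circlepath[OF assms(1,2)]; simp)+
  have int: "(\<lambda>u. \<phi> u / (u - 0)\<^sup>2) contour_integrable_on circlepath 0 \<sigma>"
    using assms(1-3) by (intro Cauchy_derivative_integral_circlepath) auto
  have 3: "((\<lambda>u. \<phi> u / (u - 0)\<^sup>2) has_contour_integral ?c * deriv \<phi> 0) (circlepath 0 \<sigma>)"
    using has_contour_integral_integral[OF int]
      Cauchy_contour_integral_circlepath_2[OF assms(1,2), of 0] assms(3) by simp
  have "((\<lambda>u. \<phi> u / (u - 1) - \<phi> u / (u - 0) - \<phi> u / (u - 0)\<^sup>2) has_contour_integral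
      ?c * \<phi> 1 - ?c * \<phi> 0 - ?c * deriv \<phi> 0) (circlepath 0 \<sigma>)"
    by (intro has_contour_integral_diff 1 2 3)
  then have "cmod (?c * \<phi> 1 - ?c * \<phi> 0 - ?c * deriv \<phi> 0) \<le> (K / (\<sigma>\<^sup>2 * (\<sigma> / 2))) * (2 * pi * \<sigma>)"
  proof (rule has_contour_integral_bound_circlepath)
    show "0 \<le> K / (\<sigma>\<^sup>2 * (\<sigma> / 2))" using K0 assms(3) by simp
    fix u :: complex assume "cmod (u - 0) = \<sigma>"
    then have u: "cmod u = \<sigma>" by simp
    then have nz: "u \<noteq> 0" "u - 1 \<noteq> 0" using assms(3) by auto
    have "\<phi> u / (u - 1) - \<phi> u / (u - 0) - \<phi> u / (u - 0)\<^sup>2 = \<phi> u / (u\<^sup>2 * (u - 1))"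
      using nz by (simp add: field_simps power2_eq_square)
    also have "cmod \<dots> = cmod (\<phi> u) / (\<sigma>\<^sup>2 * cmod (u - 1))"
      by (simp add: norm_divide norm_mult norm_power u)
    also have "\<dots> \<le> K / (\<sigma>\<^sup>2 * (\<sigma> / 2))"
    proof (intro frac_le mult_left_mono)
      show "\<sigma> / 2 \<le> cmod (u - 1)" using norm_triangle_ineq2[of u 1] u assms(3) by simp
    qed (use assms(3,4) u K0 in auto)
    finally show "cmod (\<phi> u / (u - 1) - \<phi> u / (u - 0) - \<phi> u / (u - 0)\<^sup>2) \<le> K / (\<sigma>\<^sup>2 * (\<sigma> / 2))" .
  qed (use assms(3) in simp)
  moreover have "?c * \<phi> 1 - ?c * \<phi> 0 - ?c * deriv \<phi> 0 = ?c * (\<phi> 1 - \<phi> 0 - deriv \<phi> 0)"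
    by (simp add: algebra_simps)
  ultimately have "cmod (?c * (\<phi> 1 - \<phi> 0 - deriv \<phi> 0)) \<le> 2 * pi * (2 * K / \<sigma>\<^sup>2)"
    using assms(3) by (simp add: field_simps)
  then have "2 * pi * cmod (\<phi> 1 - \<phi> 0 - deriv \<phi> 0) \<le> 2 * pi * (2 * K / \<sigma>\<^sup>2)"
    unfolding norm_mult by simp
  then show ?thesis by (rule mult_left_le_imp_le) simp
qed

text \<open>
  Weak holomorphy: by duality, Cauchy's estimates for finite linear combinations of the coordinates
  bound the first order remainder in the norm of the Hilbert space.
\<close>

lemma cx_holomorphic_on_l2I:
  fixes g :: "'a::complex_normed_vector \<Rightarrow> nat \<Rightarrow> complex"
  assumes coord: "\<And>j. cx_holomorphic_on (\<lambda>z. g z j) U"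
    and bnd: "\<And>z. z \<in> U \<Longrightarrow> \<exists>R M. 0 < R \<and> ball z R \<subseteq> U \<and>
      (\<forall>y\<in>ball z R. \<forall>N. (\<Sum>j<N. (cmod (g y j))\<^sup>2) \<le> M)"
  shows "cx_holomorphic_on (\<lambda>z. Abs_l2 (g z)) U" "\<And>z. z \<in> U \<Longrightarrow> l2_nth (Abs_l2 (g z)) = g z"
proof -
  show nth: "l2_nth (Abs_l2 (g z)) = g z" if zU: "z \<in> U" for z
  proof -
    obtain R M where "0 < R" "\<forall>y\<in>ball z R. \<forall>N. (\<Sum>j<N. (cmod (g y j))\<^sup>2) \<le> M"
      using bnd[OF zU] by blast
    then have "summable (\<lambda>j. (cmod (g z j))\<^sup>2)"
      by (intro summable_square_of_bounded_sums[of _ M]) auto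
    then show ?thesis by (simp add: Abs_l2_inverse)
  qed
  show "cx_holomorphic_on (\<lambda>z. Abs_l2 (g z)) U"
    unfolding cx_holomorphic_on_def
  proof
    fix z assume z: "z \<in> U"
    obtain R M where R: "0 < R" "ball z R \<subseteq> U"
      and M: "\<And>y N. y \<in> ball z R \<Longrightarrow> (\<Sum>j<N. (cmod (g y j))\<^sup>2) \<le> M"
      using bnd[OF z] by blast
    have M0: "0 \<le> M" using M[of z 0] R by simp
    have "\<forall>j. \<forall>y\<in>U. \<exists>D. ((\<lambda>z. g z j) has_derivative D) (at y) \<and> (\<forall>c v. D (c *\<^sub>C v) = c *\<^sub>C D v)"
      using coord unfolding cx_holomorphic_on_def by blast
    then obtain D where D: "\<And>j y. y \<in> U \<Longrightarrow> ((\<lambda>z. g z j) has_derivative D j y) (at y)"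
      "\<And>j y c v. y \<in> U \<Longrightarrow> D j y (c *\<^sub>C v) = c *\<^sub>C D j y v"
      by metis
    have dual: "cmod (\<Sum>j<N. a j * D j z v) \<le> 2 * sqrt M * norm v / R * L2_set (\<lambda>j. cmod (a j)) {..<N}"
      "norm v \<le> R / 4 \<Longrightarrow> cmod (\<Sum>j<N. a j * (g (z + v) j - g z j - D j z v)) \<le>
        8 * sqrt M * (norm v)\<^sup>2 / R\<^sup>2 * L2_set (\<lambda>j. cmod (a j)) {..<N}"
      if v: "v \<noteq> 0" for v N and a :: "nat \<Rightarrow> complex"
    proof -
      \<comment> \<open>A scalar function of one variable: a finite combination of the coordinates
        on the complex line through \<open>z\<close> in direction \<open>v\<close>, scaled so that
        \<open>c = 1\<close> is the point \<open>z + v\<close>.\<close>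
      define \<phi> where "\<phi> c = (\<Sum>j<N. a j * g (z + c *\<^sub>C v) j)" for c
      define K where "K = sqrt M * L2_set (\<lambda>j. cmod (a j)) {..<N}"
      \<comment> \<open>The closed disc of this radius is mapped into points at distance at most
        \<open>R / 2\<close> from \<open>z\<close>. As \<open>\<sigma>\<close> is proportional to
        \<open>1 / norm v\<close>, the bound \<open>2 * K / \<sigma>\<^sup>2\<close> is quadratic in
        \<open>norm v\<close>, and \<open>norm v \<le> R / 4\<close> amounts to
        \<open>2 \<le> \<sigma>\<close>.\<close>
      define \<sigma> where "\<sigma> = R / (2 * norm v)"
      have \<sigma>: "0 < \<sigma>" using R v by (simp add: \<sigma>_def)
      have inb: "z + c *\<^sub>C v \<in> ball z R" if "c \<in> cball 0 \<sigma>" for c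
      proof -
        have "cmod c * norm v \<le> \<sigma> * norm v" using that by (intro mult_right_mono) auto
        also have "\<dots> < R" using R v by (simp add: \<sigma>_def)
        finally show ?thesis by (simp add: dist_norm norm_scaleC)
      qed
      have der: "(\<phi> has_field_derivative (\<Sum>j<N. a j * D j (z + c *\<^sub>C v) v)) (at c)"
        if "c \<in> cball 0 \<sigma>" for c
        unfolding \<phi>_def
        using inb[OF that] R(2)
        by (intro DERIV_sum DERIV_cmult has_field_derivative_along_line D) auto
      have cont: "continuous_on (cball 0 \<sigma>) \<phi>"
        using der DERIV_isCont by (blast intro: continuous_at_imp_continuous_on)
      have hol: "\<phi> holomorphic_on ball 0 \<sigma>"
        unfolding holomorphic_on_open[OF open_ball] using der ball_subset_cball by blast
      have bd: "cmod (\<phi> u) \<le> K" if "u \<in> cball 0 \<sigma>" for u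
        unfolding \<phi>_def K_def by (intro cmod_sum_mult_le_L2 M inb that)
      have d0: "deriv \<phi> 0 = (\<Sum>j<N. a j * D j z v)"
        using der[of 0] \<sigma> by (intro DERIV_imp_deriv) simp
      have "cmod ((deriv ^^ 1) \<phi> 0) \<le> fact 1 * K / \<sigma> ^ 1"
        by (rule Cauchy_inequality[OF hol cont \<sigma>]) (use bd in auto)
      then show "cmod (\<Sum>j<N. a j * D j z v) \<le> 2 * sqrt M * norm v / R * L2_set (\<lambda>j. cmod (a j)) {..<N}"
        using R v by (simp add: d0 K_def \<sigma>_def field_simps)
      assume "norm v \<le> R / 4"
      then have "2 \<le> \<sigma>" using R v by (simp add: \<sigma>_def field_simps)
      then have "cmod (\<phi> 1 - \<phi> 0 - deriv \<phi> 0) \<le> 2 * K / \<sigma>\<^sup>2"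
        using bd by (intro Cauchy_first_order_remainder cont hol) auto
      also have "2 * K / \<sigma>\<^sup>2 = 8 * sqrt M * (norm v)\<^sup>2 / R\<^sup>2 * L2_set (\<lambda>j. cmod (a j)) {..<N}"
        using R v by (simp add: K_def \<sigma>_def power_divide power_mult_distrib field_simps)
      also have "\<phi> 1 - \<phi> 0 - deriv \<phi> 0 = (\<Sum>j<N. a j * (g (z + v) j - g z j - D j z v))"
        by (simp add: \<phi>_def d0 algebra_simps sum_subtractf sum.distrib)
      finally show "cmod (\<Sum>j<N. a j * (g (z + v) j - g z j - D j z v)) \<le>
        8 * sqrt M * (norm v)\<^sup>2 / R\<^sup>2 * L2_set (\<lambda>j. cmod (a j)) {..<N}" .
    qed
    have lin: "linear (D j z)" for j
      using D(1)[OF z] has_derivative_linear by blast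
    have Dsum: "(\<Sum>j<N. (cmod (D j z v))\<^sup>2) \<le> (2 * sqrt M * norm v / R)\<^sup>2" for v N
    proof (cases "v = 0")
      case True
      then show ?thesis by (simp add: linear_0[OF lin])
    next
      case False
      show ?thesis
        by (rule sum_square_le_of_bilinear_bound[OF _ dual(1)[OF False]]) (use M0 R in auto)
    qed
    \<comment> \<open>The derivative is assembled from those of the coordinates; the first duality
      bound puts its values into the Hilbert space and makes it bounded.\<close>
    define L where "L v = Abs_l2 (\<lambda>j. D j z v)" for v
    have L: "l2_nth (L v) j = D j z v" for v j
      using summable_square_of_bounded_sums[OF Dsum] by (simp add: L_def Abs_l2_inverse)
    have Lnorm: "norm (L v) \<le> norm v * (2 * sqrt M / R)" for v
      by (rule norm_l2_le) (use M0 R Dsum in \<open>auto simp: L mult_ac\<close>)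
    have bl: "bounded_linear L"
    proof (rule bounded_linear_intro[OF _ _ Lnorm])
      show "L (v + w) = L v + L w" for v w
        by (rule l2_eqI) (simp add: L plus_l2.rep_eq linear_add[OF lin])
      show "L (c *\<^sub>R v) = c *\<^sub>R L v" for c v
        by (rule l2_eqI) (simp add: L scaleR_l2.rep_eq linear_scale[OF lin] scaleR_conv_of_real)
    qed
    let ?F = "\<lambda>z. Abs_l2 (g z)"
    have rem: "norm (?F y - ?F z - L (y - z)) \<le> 8 * sqrt M / R\<^sup>2 * (norm (y - z))\<^sup>2"
      if y: "y \<noteq> z" "norm (y - z) \<le> R / 4" for y
    proof (rule norm_l2_le)
      show "0 \<le> 8 * sqrt M / R\<^sup>2 * (norm (y - z))\<^sup>2" using M0 by simp
      have yU: "y \<in> U" using y R by (auto simp: dist_norm norm_minus_commute)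
      have nthF: "l2_nth (?F y - ?F z - L (y - z)) j = g (z + (y - z)) j - g z j - D j z (y - z)" for j
        by (simp add: minus_l2.rep_eq L nth[OF yU] nth[OF z])
      have "(\<Sum>j<N. (cmod (g (z + (y - z)) j - g z j - D j z (y - z)))\<^sup>2)
          \<le> (8 * sqrt M * (norm (y - z))\<^sup>2 / R\<^sup>2)\<^sup>2" for N
        by (rule sum_square_le_of_bilinear_bound[OF _ dual(2)]) (use M0 y in auto)
      then show "(\<Sum>j<N. (cmod (l2_nth (?F y - ?F z - L (y - z)) j))\<^sup>2)
          \<le> (8 * sqrt M / R\<^sup>2 * (norm (y - z))\<^sup>2)\<^sup>2" for N
        unfolding nthF by simp
    qed
    have "((\<lambda>y. norm (?F y - ?F z - L (y - z)) / norm (y - z)) \<longlongrightarrow> 0) (at z)"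
    proof (rule Lim_null_comparison)
      have "((\<lambda>y. 8 * sqrt M / R\<^sup>2 * norm (y - z)) \<longlongrightarrow> 8 * sqrt M / R\<^sup>2 * norm (z - z)) (at z)"
        by (intro tendsto_intros)
      then show "((\<lambda>y. 8 * sqrt M / R\<^sup>2 * norm (y - z)) \<longlongrightarrow> 0) (at z)" by simp
      have "\<forall>\<^sub>F y in at z. y \<noteq> z \<and> dist y z < R / 4"
        unfolding eventually_at using R by (intro exI[of _ "R / 4"]) auto
      then show "\<forall>\<^sub>F y in at z. norm (norm (?F y - ?F z - L (y - z)) / norm (y - z)) \<le>
          8 * sqrt M / R\<^sup>2 * norm (y - z)"
      proof eventually_elim
        case (elim y)
        then have "norm (?F y - ?F z - L (y - z)) \<le> 8 * sqrt M / R\<^sup>2 * norm (y - z) * norm (y - z)"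
          using rem[of y] by (simp add: dist_norm power2_eq_square)
        then show ?case using elim by (simp add: divide_le_eq)
      qed
    qed
    then have "(?F has_derivative L) (at z)"
      using bl by (simp add: has_derivative_iff_norm)
    moreover have "L (c *\<^sub>C v) = c *\<^sub>C L v" for c v
      by (rule l2_eqI) (simp add: L scaleC_l2.rep_eq D(2)[OF z] scaleC_complex_def)
    ultimately show "\<exists>D. (?F has_derivative D) (at z) \<and> (\<forall>c v. D (c *\<^sub>C v) = c *\<^sub>C D v)"
      by blast
  qed
qed

section \<open>Homogeneous coordinates\<close>

lemma l2_nth_scaleC: "l2_nth (c *\<^sub>C w) j = c * l2_nth w j"
  by (simp add: scaleC_l2.rep_eq)

lemma bounded_linear_l2_nth: "bounded_linear (\<lambda>x. l2_nth x j)"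
  by (rule bounded_linear_intro[where K = 1])
    (simp_all add: plus_l2.rep_eq scaleR_l2.rep_eq norm_l2_nth_le scaleR_conv_of_real)

lemma continuous_on_l2_nth [continuous_intros]:
  "continuous_on S f \<Longrightarrow> continuous_on S (\<lambda>x. l2_nth (f x) j)"
  by (rule bounded_linear.continuous_on[OF bounded_linear_l2_nth])

lemma l2_nonzero_coord:
  assumes "w \<noteq> 0"
  obtains k where "l2_nth w k \<noteq> 0"
  using assms l2_eqI[of w 0] by (metis zero_l2.rep_eq)

lemma l2_nth_nonzero: "l2_nth w k \<noteq> 0 \<Longrightarrow> w \<noteq> 0"
  by (auto simp: zero_l2.rep_eq)

text \<open>
  As division by zero yields zero, all quotients by the
  \<open>k\<close>-th coordinate vanish outside the \<open>k\<close>-th chart.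
\<close>

definition hcoord :: "nat \<Rightarrow> nat \<Rightarrow> proj_l2 \<Rightarrow> complex"
  where "hcoord k j p = (let w = SOME w. w \<noteq> 0 \<and> p = proj w in l2_nth w j / l2_nth w k)"

lemma hcoord_proj:
  assumes "w \<noteq> 0"
  shows "hcoord k j (proj w) = l2_nth w j / l2_nth w k"
proof -
  define w' where "w' = (SOME w'. w' \<noteq> 0 \<and> proj w = proj w')"
  have "w' \<noteq> 0 \<and> proj w = proj w'" unfolding w'_def by (rule someI[of _ w]) (simp add: assms)
  then obtain c where "c \<noteq> 0" "w = c *\<^sub>C w'" using proj_eq_iff[of w w'] assms by auto
  moreover have "hcoord k j (proj w) = l2_nth w' j / l2_nth w' k"
    by (simp add: hcoord_def w'_def Let_def)
  ultimately show ?thesis by (simp add: l2_nth_scaleC)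
qed

lemma proj_in_chart_domain_iff:
  assumes "w \<noteq> 0"
  shows "proj w \<in> chart_domain k \<longleftrightarrow> l2_nth w k \<noteq> 0"
proof
  assume "proj w \<in> chart_domain k"
  then obtain v where v: "proj w = proj v" "l2_nth v k \<noteq> 0" by (auto simp: chart_domain_def)
  then obtain c where "c \<noteq> 0" "w = c *\<^sub>C v"
    using proj_eq_iff[of w v] assms l2_nth_nonzero by auto
  with v show "l2_nth w k \<noteq> 0" by (simp add: l2_nth_scaleC)
qed (auto simp: chart_domain_def)

lemma exists_chart_domain: obtains k where "p \<in> chart_domain k"
  by (metis proj_surj l2_nonzero_coord proj_in_chart_domain_iff)

lemma hcoord_chart_domain_iff:
  assumes "p \<in> chart_domain l"
  shows "p \<in> chart_domain k \<longleftrightarrow> hcoord l k p \<noteq> 0"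
proof -
  obtain w where "w \<noteq> 0" "p = proj w" by (rule proj_surj)
  with assms show ?thesis by (auto simp: hcoord_proj proj_in_chart_domain_iff)
qed

lemma hcoord_change:
  assumes "p \<in> chart_domain l"
  shows "hcoord k j p = hcoord l j p / hcoord l k p"
proof -
  obtain w where "w \<noteq> 0" "p = proj w" by (rule proj_surj)
  with assms show ?thesis by (auto simp: hcoord_proj proj_in_chart_domain_iff)
qed

lemma hcoord_self: "p \<in> chart_domain k \<Longrightarrow> hcoord k k p = 1"
proof -
  obtain w where "w \<noteq> 0" "p = proj w" by (rule proj_surj)
  then show "p \<in> chart_domain k \<Longrightarrow> hcoord k k p = 1"
    by (auto simp: hcoord_proj proj_in_chart_domain_iff)
qed

lemma hcoord_eq_chart:
  assumes "p \<in> chart_domain k"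
  shows "hcoord k j p = (if j = k then 1 else l2_nth (chart k p) (if j < k then j else j - 1))"
proof -
  obtain w where w: "w \<noteq> 0" "p = proj w" by (rule proj_surj)
  have "l2_nth (chart k p) i = l2_nth w (if i < k then i else Suc i) / l2_nth w k" for i
    by (simp add: w chart_proj affine_quotient.rep_eq)
  with assms hcoord_self[OF assms] show ?thesis
    by (auto simp: w hcoord_proj)
qed

text \<open>The chart omits the coordinate with index \<open>k\<close>, whose quotient is 1; this
  accounts for the summand 1. The other quotients are distinct coordinates of the chart.\<close>

lemma sum_hcoord_le:
  assumes "p \<in> chart_domain k"
  shows "(\<Sum>j<N. (cmod (hcoord k j p))\<^sup>2) \<le> 1 + (norm (chart k p))\<^sup>2"
proof -
  let ?\<phi> = "\<lambda>j. if j < k then j else j - 1"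
  let ?A = "{..<N} - {k}"
  have "inj_on ?\<phi> ?A" by (auto simp: inj_on_def split: if_splits)
  then have "(\<Sum>j\<in>?A. (cmod (l2_nth (chart k p) (?\<phi> j)))\<^sup>2) =
      (\<Sum>i\<in>?\<phi> ` ?A. (cmod (l2_nth (chart k p) i))\<^sup>2)"
    by (simp only: sum.reindex o_def)
  also have "\<dots> \<le> (norm (chart k p))\<^sup>2"
    using sum_le_suminf[OF summable_l2_nth[of "chart k p"], of "?\<phi> ` ?A"]
    by (simp add: norm_l2_def suminf_nonneg[OF summable_l2_nth])
  finally have "(\<Sum>j\<in>?A. (cmod (hcoord k j p))\<^sup>2) \<le> (norm (chart k p))\<^sup>2"
    using assms by (simp add: hcoord_eq_chart cong: if_cong)
  moreover have "(\<Sum>j<N. (cmod (hcoord k j p))\<^sup>2) \<le> 1 + (\<Sum>j\<in>?A. (cmod (hcoord k j p))\<^sup>2)"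
  proof (cases "k < N")
    case True
    then show ?thesis
      using sum.remove[of "{..<N}" k "\<lambda>j. (cmod (hcoord k j p))\<^sup>2"] hcoord_self[OF assms] by simp
  next
    case False
    then have "?A = {..<N}" by auto
    then show ?thesis by simp
  qed
  ultimately show ?thesis by linarith
qed

lemma open_chart_domain: "open (chart_domain k)"
proof -
  have "{w. w \<noteq> 0 \<and> proj w \<in> chart_domain k} = {w. l2_nth w k \<noteq> 0}"
    using proj_in_chart_domain_iff l2_nth_nonzero by auto
  moreover have "open {w. l2_nth w k \<noteq> 0}"
    by (intro open_Collect_neq continuous_intros)
  ultimately show ?thesis by (simp add: open_proj_l2_def)
qed

lemma open_preimage_chart_domain:
  assumes "proj_holomorphic_on f S"
  shows "open {z \<in> S. f z \<in> chart_domain k}"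
proof -
  have "open (f -` chart_domain k \<inter> S)"
    using assms open_chart_domain continuous_on_open_vimage unfolding proj_holomorphic_on_def by blast
  then show ?thesis by (simp add: vimage_def Int_def conj_commute)
qed

lemma cx_holomorphic_on_hcoord:
  assumes "proj_holomorphic_on f S"
  shows "cx_holomorphic_on (\<lambda>z. hcoord k j (f z)) {z \<in> S. f z \<in> chart_domain k}"
  unfolding cx_holomorphic_on_def
proof
  fix z assume z: "z \<in> {z \<in> S. f z \<in> chart_domain k}"
  let ?i = "if j < k then j else j - 1"
  obtain D where D: "((\<lambda>z. chart k (f z)) has_derivative D) (at z)" "\<And>c v. D (c *\<^sub>C v) = c *\<^sub>C D v"
    using assms z unfolding proj_holomorphic_on_def cx_holomorphic_on_def by blast
  have "((\<lambda>z. if j = k then 1 else l2_nth (chart k (f z)) ?i) has_derivative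
      (\<lambda>v. if j = k then 0 else l2_nth (D v) ?i)) (at z)"
    using bounded_linear.has_derivative[OF bounded_linear_l2_nth D(1), of ?i] by (cases "j = k") auto
  then have "((\<lambda>z. hcoord k j (f z)) has_derivative (\<lambda>v. if j = k then 0 else l2_nth (D v) ?i)) (at z)"
    by (rule has_derivative_transform_within_open[OF _ open_preimage_chart_domain[OF assms] z])
      (simp add: hcoord_eq_chart)
  moreover have "(if j = k then 0 else l2_nth (D (c *\<^sub>C v)) ?i) =
      c *\<^sub>C (if j = k then 0 else l2_nth (D v) ?i)" for c v
    by (simp add: D(2) l2_nth_scaleC scaleC_complex_def)
  ultimately show "\<exists>D. ((\<lambda>z. hcoord k j (f z)) has_derivative D) (at z) \<and>
      (\<forall>c v. D (c *\<^sub>C v) = c *\<^sub>C D v)"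
    by blast
qed

section \<open>Holomorphic curves in the projective Hilbert space\<close>

lemma cx_holomorphic_on_imp_continuous_on: "cx_holomorphic_on f S \<Longrightarrow> continuous_on S f"
  unfolding cx_holomorphic_on_def
  by (meson continuous_at_imp_continuous_on has_derivative_continuous)

text \<open>Phrased through quotients of homogeneous coordinates, so that the theory of one complex
  variable applies to each of them; the openness of the chart preimages takes the place of
  continuity.\<close>

definition holomorphic_curve :: "(complex \<Rightarrow> proj_l2) \<Rightarrow> complex set \<Rightarrow> bool"
  where "holomorphic_curve G U \<longleftrightarrow> open U \<and> (\<forall>k. open {t \<in> U. G t \<in> chart_domain k} \<and>
    (\<forall>j. (\<lambda>t. hcoord k j (G t)) holomorphic_on {t \<in> U. G t \<in> chart_domain k}))"

lemma holomorphic_curve_line: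
  fixes f :: "'a::complex_normed_vector \<Rightarrow> proj_l2"
  assumes "proj_holomorphic_on f S"
  shows "holomorphic_curve (\<lambda>t. f (q + t *\<^sub>C v)) {t. q + t *\<^sub>C v \<in> S}"
  unfolding holomorphic_curve_def
proof (intro conjI allI)
  have op: "open {t. q + t *\<^sub>C v \<in> W}" if "open W" for W
  proof -
    have "continuous_on UNIV (\<lambda>t. q + t *\<^sub>C v)"
      by (intro continuous_intros linear_continuous_on bounded_linear_scaleC_left)
    then show ?thesis using that open_vimage[of W "\<lambda>t. q + t *\<^sub>C v"] by (simp add: vimage_def)
  qed
  show "open {t. q + t *\<^sub>C v \<in> S}" using assms op by (simp add: proj_holomorphic_on_def)
  fix k
  show o: "open {t \<in> {t. q + t *\<^sub>C v \<in> S}. f (q + t *\<^sub>C v) \<in> chart_domain k}"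
    using op[OF open_preimage_chart_domain[OF assms, of k]] by simp
  fix j
  show "(\<lambda>t. hcoord k j (f (q + t *\<^sub>C v))) holomorphic_on
      {t \<in> {t. q + t *\<^sub>C v \<in> S}. f (q + t *\<^sub>C v) \<in> chart_domain k}"
    unfolding holomorphic_on_open[OF o]
  proof
    fix t assume "t \<in> {t \<in> {t. q + t *\<^sub>C v \<in> S}. f (q + t *\<^sub>C v) \<in> chart_domain k}"
    then obtain D where "((\<lambda>z. hcoord k j (f z)) has_derivative D) (at (q + t *\<^sub>C v))"
      "\<And>c v. D (c *\<^sub>C v) = c *\<^sub>C D v"
      using cx_holomorphic_on_hcoord[OF assms, of k j] unfolding cx_holomorphic_on_def by blast
    from has_field_derivative_along_line[OF this]
    show "\<exists>f'. ((\<lambda>t. hcoord k j (f (q + t *\<^sub>C v))) has_field_derivative f') (at t)" by blast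
  qed
qed

lemma holomorphic_curve_local:
  assumes G: "holomorphic_curve G U" and t0: "t0 \<in> U"
  obtains l \<rho> where "0 < \<rho>" "ball t0 \<rho> \<subseteq> U" "\<And>t. t \<in> ball t0 \<rho> \<Longrightarrow> G t \<in> chart_domain l"
    "\<And>j. (\<lambda>t. hcoord l j (G t)) holomorphic_on ball t0 \<rho>"
proof -
  obtain l where l: "G t0 \<in> chart_domain l" by (rule exists_chart_domain)
  have "open {t \<in> U. G t \<in> chart_domain l}" using G by (simp add: holomorphic_curve_def)
  then obtain \<rho> where \<rho>: "0 < \<rho>" "ball t0 \<rho> \<subseteq> {t \<in> U. G t \<in> chart_domain l}"
    using t0 l open_contains_ball by (metis (mono_tags, lifting) mem_Collect_eq)
  have "(\<lambda>t. hcoord l j (G t)) holomorphic_on ball t0 \<rho>" for j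
    using G \<rho>(2) holomorphic_on_subset unfolding holomorphic_curve_def by blast
  with \<rho> show ?thesis by (intro that[of \<rho> l]) auto
qed

text \<open>The identity theorem for a homogeneous coordinate, which is a function only within a
  chart. Near each point it has no zeros except possibly there, or it vanishes identically; the sets
  \<open>A\<close> and \<open>B\<close> of these points are open, disjoint and cover
  \<open>U\<close>, and connectedness leaves only \<open>A\<close>.\<close>

lemma holomorphic_curve_isolated:
  assumes G: "holomorphic_curve G U" and U: "connected U"
    and t1: "t1 \<in> U" "G t1 \<in> chart_domain k" and t0: "t0 \<in> U"
  obtains \<rho> where "0 < \<rho>" "ball t0 \<rho> \<subseteq> U" "\<And>t. t \<in> ball t0 \<rho> \<Longrightarrow> t \<noteq> t0 \<Longrightarrow> G t \<in> chart_domain k"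
proof -
  define A where "A = {t \<in> U. \<exists>\<rho>>0. ball t \<rho> \<subseteq> U \<and> (\<forall>y\<in>ball t \<rho>. y \<noteq> t \<longrightarrow> G y \<in> chart_domain k)}"
  define B where "B = {t \<in> U. \<exists>\<rho>>0. ball t \<rho> \<subseteq> U \<and> (\<forall>y\<in>ball t \<rho>. G y \<notin> chart_domain k)}"
  have near: "t \<in> A" if t: "t \<in> U" "G t \<in> chart_domain k" for t
  proof -
    have "open {t \<in> U. G t \<in> chart_domain k}" using G by (simp add: holomorphic_curve_def)
    then obtain \<rho> where "0 < \<rho>" "ball t \<rho> \<subseteq> {t \<in> U. G t \<in> chart_domain k}"
      using t open_contains_ball by (metis (mono_tags, lifting) mem_Collect_eq)
    then show ?thesis using t unfolding A_def by blast
  qed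
  have AB: "t \<in> A \<or> t \<in> B" if t: "t \<in> U" for t
  proof -
    obtain l \<rho> where l: "0 < \<rho>" "ball t \<rho> \<subseteq> U" "\<And>y. y \<in> ball t \<rho> \<Longrightarrow> G y \<in> chart_domain l"
      "\<And>j. (\<lambda>y. hcoord l j (G y)) holomorphic_on ball t \<rho>"
      by (rule holomorphic_curve_local[OF G t], rule that)
    have iff: "G y \<in> chart_domain k \<longleftrightarrow> hcoord l k (G y) \<noteq> 0" if "y \<in> ball t \<rho>" for y
      using l(3)[OF that] by (rule hcoord_chart_domain_iff)
    show ?thesis
    proof (cases "\<forall>y\<in>ball t \<rho>. hcoord l k (G y) = 0")
      case True
      then have "t \<in> B" unfolding B_def using t l(1,2) iff by blast
      then show ?thesis ..
    next
      case False
      then obtain b where b: "b \<in> ball t \<rho>" "hcoord l k (G b) \<noteq> 0" by blast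
      obtain d where d: "0 < d" "d \<le> \<rho>" "\<And>y. y \<in> ball t d \<Longrightarrow> y \<noteq> t \<Longrightarrow> hcoord l k (G y) \<noteq> 0"
        by (rule holomorphic_nonzero_punctured_ball[OF l(4)[of k] b], rule that)
      have "ball t d \<subseteq> ball t \<rho>" using d(2) by auto
      then have "t \<in> A" unfolding A_def using t d(1,3) l(2) iff by blast
      then show ?thesis ..
    qed
  qed
  have oA: "open A"
    unfolding open_contains_ball
  proof
    fix t assume "t \<in> A"
    then obtain \<rho> where \<rho>: "0 < \<rho>" "ball t \<rho> \<subseteq> U" "\<forall>y\<in>ball t \<rho>. y \<noteq> t \<longrightarrow> G y \<in> chart_domain k"
      unfolding A_def by blast
    have "ball t \<rho> \<subseteq> A"
    proof
      fix y assume y: "y \<in> ball t \<rho>"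
      then have "y \<in> U" using \<rho>(2) by (rule subsetD[rotated])
      then show "y \<in> A" using \<open>t \<in> A\<close> near[of y] \<rho>(3) y by (cases "y = t") simp_all
    qed
    with \<rho>(1) show "\<exists>e>0. ball t e \<subseteq> A" by blast
  qed
  have oB: "open B"
    unfolding open_contains_ball
  proof
    fix t assume "t \<in> B"
    then obtain \<rho> where \<rho>: "0 < \<rho>" "ball t \<rho> \<subseteq> U" "\<forall>y\<in>ball t \<rho>. G y \<notin> chart_domain k"
      unfolding B_def by blast
    have "ball t \<rho> \<subseteq> B"
    proof
      fix x assume x: "x \<in> ball t \<rho>"
      then obtain e where "0 < e" "ball x e \<subseteq> ball t \<rho>" using open_ball open_contains_ball by blast
      then have "ball x e \<subseteq> U" "\<forall>y\<in>ball x e. G y \<notin> chart_domain k" "x \<in> U"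
        using x \<rho>(2,3) by (meson subset_trans, meson subsetD, meson subsetD)
      then show "x \<in> B" unfolding B_def using \<open>0 < e\<close> by (intro CollectI conjI exI[of _ e])
    qed
    with \<rho>(1) show "\<exists>e>0. ball t e \<subseteq> B" by blast
  qed
  have "A \<inter> B \<inter> U = {}"
  proof (rule ccontr)
    assume "\<not> ?thesis"
    then obtain t where "t \<in> A" "t \<in> B" by blast
    then obtain \<rho> \<rho>' where \<rho>: "0 < \<rho>" "\<forall>y\<in>ball t \<rho>. y \<noteq> t \<longrightarrow> G y \<in> chart_domain k"
      "0 < \<rho>'" "\<forall>y\<in>ball t \<rho>'. G y \<notin> chart_domain k"
      unfolding A_def B_def by blast
    let ?y = "t + complex_of_real (min \<rho> \<rho>' / 2)"
    have "?y \<in> ball t \<rho>" "?y \<in> ball t \<rho>'" "?y \<noteq> t"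
      using \<rho>(1,3) by (auto simp: dist_norm)
    with \<rho>(2,4) show False by blast
  qed
  moreover have "U \<subseteq> A \<union> B" using AB by blast
  moreover have "A \<inter> U \<noteq> {}" using near t1 by blast
  ultimately have "B \<inter> U = {}" using U oA oB connectedD by blast
  then have "t0 \<in> A" using AB[OF t0] t0 by blast
  then show ?thesis unfolding A_def using that by blast
qed

text \<open>In a chart \<open>l\<close> around \<open>t0\<close> all quotients by coordinate
  \<open>k\<close> have the same denominator \<open>hcoord l k\<close>. The order of its zero bounds
  the pole orders for all \<open>j\<close> at once.\<close>

lemma holomorphic_curve_pole:
  assumes G: "holomorphic_curve G U" and U: "connected U"
    and t1: "t1 \<in> U" "G t1 \<in> chart_domain k" and t0: "t0 \<in> U"
  obtains \<rho> m where "0 < \<rho>" "\<And>j. (\<lambda>t. (t - t0) ^ Suc m * hcoord k j (G t)) holomorphic_on ball t0 \<rho>"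
proof -
  obtain \<rho> where \<rho>: "0 < \<rho>" "ball t0 \<rho> \<subseteq> U" "\<And>t. t \<in> ball t0 \<rho> \<Longrightarrow> t \<noteq> t0 \<Longrightarrow> G t \<in> chart_domain k"
    by (rule holomorphic_curve_isolated[OF G U t1 t0], rule that)
  obtain l \<sigma> where l: "0 < \<sigma>" "ball t0 \<sigma> \<subseteq> U" "\<And>y. y \<in> ball t0 \<sigma> \<Longrightarrow> G y \<in> chart_domain l"
    "\<And>j. (\<lambda>y. hcoord l j (G y)) holomorphic_on ball t0 \<sigma>"
    by (rule holomorphic_curve_local[OF G t0], rule that)
  show ?thesis
  proof (cases "hcoord l k (G t0) = 0")
    case False
    have "(\<lambda>t. (t - t0) ^ Suc 0 * hcoord k j (G t)) holomorphic_on ball t0 \<rho>" for j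
    proof -
      have "G t0 \<in> chart_domain k"
        using False hcoord_chart_domain_iff[OF l(3)] l(1) by simp
      then have "ball t0 \<rho> \<subseteq> {t \<in> U. G t \<in> chart_domain k}" using \<rho> by blast
      then have "(\<lambda>t. hcoord k j (G t)) holomorphic_on ball t0 \<rho>"
        using G holomorphic_on_subset unfolding holomorphic_curve_def by blast
      then show ?thesis by (intro holomorphic_intros)
    qed
    then show ?thesis using \<rho>(1) that by blast
  next
    case True
    have t0b: "t0 \<in> ball t0 \<sigma>" using l(1) by simp
    have nc: "\<not> (\<lambda>t. hcoord l k (G t)) constant_on ball t0 \<sigma>"
    proof
      assume "(\<lambda>t. hcoord l k (G t)) constant_on ball t0 \<sigma>"
      then have z: "hcoord l k (G t) = 0" if "t \<in> ball t0 \<sigma>" for t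
        using True t0b that unfolding constant_on_def by metis
      let ?y = "t0 + complex_of_real (min \<rho> \<sigma> / 2)"
      have y: "?y \<in> ball t0 \<rho>" "?y \<in> ball t0 \<sigma>" "?y \<noteq> t0"
        using \<rho>(1) l(1) by (auto simp: dist_norm)
      with z[OF y(2)] \<rho>(3)[OF y(1,3)] hcoord_chart_domain_iff[OF l(3)[OF y(2)]] show False by simp
    qed
    obtain g r m where g: "0 < m" "0 < r" "ball t0 r \<subseteq> ball t0 \<sigma>" "g holomorphic_on ball t0 r"
      "\<And>w. w \<in> ball t0 r \<Longrightarrow> hcoord l k (G w) = (w - t0) ^ m * g w" "\<And>w. w \<in> ball t0 r \<Longrightarrow> g w \<noteq> 0"
      by (rule holomorphic_factor_zero_nonconstant[OF l(4)[of k] open_ball connected_ball t0b True nc],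
          rule that)
    \<comment> \<open>At \<open>t0\<close> the quotient has the default value 0 of a division by
      zero, so multiplying by \<open>(t - t0) ^ m\<close> may leave a wrong value at this point. The
      additional factor \<open>t - t0\<close> makes both sides 0 there.\<close>
    have "(\<lambda>t. (t - t0) ^ Suc m * hcoord k j (G t)) holomorphic_on ball t0 r" for j
    proof (rule holomorphic_transform)
      show "(\<lambda>t. (t - t0) * hcoord l j (G t) / g t) holomorphic_on ball t0 r"
        using g(3,4,6) l(4)[of j] by (intro holomorphic_intros holomorphic_on_subset[OF l(4)]) auto
      fix t assume t: "t \<in> ball t0 r"
      then have "hcoord k j (G t) = hcoord l j (G t) / ((t - t0) ^ m * g t)"
        using hcoord_change[OF l(3)] g(3,5) by (metis subsetD)
      then show "(t - t0) * hcoord l j (G t) / g t = (t - t0) ^ Suc m * hcoord k j (G t)"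
        using g(6)[OF t] by (cases "t = t0") auto
    qed
    then show ?thesis using g(2) that by blast
  qed
qed

text \<open>Each point of \<open>C\<close> has a neighbourhood in which at most that point is sent
  outside the chart, and finitely many such neighbourhoods cover \<open>C\<close>.\<close>

lemma holomorphic_curve_finite_zeros:
  assumes G: "holomorphic_curve G U" and U: "connected U"
    and t1: "t1 \<in> U" "G t1 \<in> chart_domain k" and C: "compact C" "C \<subseteq> U"
  shows "finite {t \<in> C. G t \<notin> chart_domain k}"
proof -
  have "\<exists>\<rho>>0. \<forall>t\<in>ball x \<rho>. t \<noteq> x \<longrightarrow> G t \<in> chart_domain k" if x: "x \<in> C" for x
  proof (rule holomorphic_curve_isolated[OF G U t1 subsetD[OF C(2) x]])
    fix \<rho> assume "0 < \<rho>" "\<And>t. t \<in> ball x \<rho> \<Longrightarrow> t \<noteq> x \<Longrightarrow> G t \<in> chart_domain k"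
    then show ?thesis by blast
  qed
  then obtain \<rho> where \<rho>: "\<And>x. x \<in> C \<Longrightarrow> 0 < \<rho> x"
    "\<And>x t. x \<in> C \<Longrightarrow> t \<in> ball x (\<rho> x) \<Longrightarrow> t \<noteq> x \<Longrightarrow> G t \<in> chart_domain k"
    by metis
  have "C \<subseteq> (\<Union>x\<in>C. ball x (\<rho> x))" using \<rho>(1) by force
  then obtain X where X: "X \<subseteq> C" "finite X" "C \<subseteq> (\<Union>x\<in>X. ball x (\<rho> x))"
    using compactE_image[OF C(1), of C "\<lambda>x. ball x (\<rho> x)"] by auto
  have "{t \<in> C. G t \<notin> chart_domain k} \<subseteq> X" using X \<rho>(2) by blast
  then show ?thesis using X(2) finite_subset by blast
qed

text \<open>Pole orders are bounded independently of \<open>j\<close>, and by compactness finitely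
  many centres suffice. Hence a single product of linear factors clears the denominators of all
  coordinates.\<close>

lemma holomorphic_curve_denominator:
  assumes G: "holomorphic_curve G U" and U: "connected U"
    and t1: "t1 \<in> U" "G t1 \<in> chart_domain k" and C: "compact C" "C \<subseteq> U"
  obtains Q V where "Q \<noteq> (0 :: complex poly)" "open V" "C \<subseteq> V"
    "\<And>j. (\<lambda>t. poly Q t * hcoord k j (G t)) holomorphic_on V"
proof -
  have "\<exists>\<rho> m. 0 < \<rho> \<and> (\<forall>j. (\<lambda>t. (t - x) ^ Suc m * hcoord k j (G t)) holomorphic_on ball x \<rho>)"
    if x: "x \<in> C" for x
  proof (rule holomorphic_curve_pole[OF G U t1 subsetD[OF C(2) x]])
    fix \<rho> m assume "0 < \<rho>" "\<And>j. (\<lambda>t. (t - x) ^ Suc m * hcoord k j (G t)) holomorphic_on ball x \<rho>"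
    then show ?thesis by blast
  qed
  then obtain \<rho> m where \<rho>: "\<And>x. x \<in> C \<Longrightarrow> 0 < \<rho> x"
    "\<And>x j. x \<in> C \<Longrightarrow> (\<lambda>t. (t - x) ^ Suc (m x) * hcoord k j (G t)) holomorphic_on ball x (\<rho> x)"
    by metis
  have "C \<subseteq> (\<Union>x\<in>C. ball x (\<rho> x))" using \<rho>(1) by force
  then obtain X where X: "X \<subseteq> C" "finite X" "C \<subseteq> (\<Union>x\<in>X. ball x (\<rho> x))"
    using compactE_image[OF C(1), of C "\<lambda>x. ball x (\<rho> x)"] by auto
  define Q where "Q = (\<Prod>x\<in>X. [:- x, 1:] ^ Suc (m x))"
  have "Q \<noteq> 0" using X(2) by (simp add: Q_def del: power_Suc)
  moreover have "(\<lambda>t. poly Q t * hcoord k j (G t)) holomorphic_on (\<Union>x\<in>X. ball x (\<rho> x))" for j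
  proof (rule holomorphic_on_UN_open)
    fix x assume x: "x \<in> X"
    have "poly Q t = (\<Prod>y\<in>X - {x}. poly ([:- y, 1:] ^ Suc (m y)) t) * (t - x) ^ Suc (m x)" for t
      unfolding Q_def poly_prod using X(2) x by (simp add: prod.remove[of X x] algebra_simps)
    then have "(\<lambda>t. poly Q t * hcoord k j (G t)) =
        (\<lambda>t. (\<Prod>y\<in>X - {x}. poly ([:- y, 1:] ^ Suc (m y)) t) * ((t - x) ^ Suc (m x) * hcoord k j (G t)))"
      by (simp add: fun_eq_iff mult.assoc)
    moreover have "\<dots> holomorphic_on ball x (\<rho> x)"
      by (rule holomorphic_on_mult[OF _ \<rho>(2)]) (use x X(1) in \<open>auto intro!: holomorphic_intros\<close>)
    ultimately show "(\<lambda>t. poly Q t * hcoord k j (G t)) holomorphic_on ball x (\<rho> x)" by simp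
  qed simp
  ultimately show ?thesis using X(3) by (intro that[of Q "\<Union>x\<in>X. ball x (\<rho> x)"]) auto
qed

section \<open>Local extension across the curve\<close>

lemma bounded_bilinear_scaleC:
  "bounded_bilinear (\<lambda>c (v :: 'a::complex_normed_vector). c *\<^sub>C v)"
proof (unfold_locales)
  fix c c' :: complex and v v' :: 'a and r :: real
  show "(c + c') *\<^sub>C v = c *\<^sub>C v + c' *\<^sub>C v" by (rule scaleC_add_left)
  show "c *\<^sub>C (v + v') = c *\<^sub>C v + c *\<^sub>C v'" by (rule scaleC_add_right)
  show "(r *\<^sub>R c) *\<^sub>C v = r *\<^sub>R (c *\<^sub>C v)"
    by (simp add: scaleR_scaleC scaleC_scaleC scaleC_complex_def)
  show "c *\<^sub>C (r *\<^sub>R v) = r *\<^sub>R (c *\<^sub>C v)"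
    by (simp add: scaleR_scaleC scaleC_scaleC mult.commute)
  show "\<exists>K. \<forall>c (v :: 'a). norm (c *\<^sub>C v) \<le> norm c * norm v * K"
    by (intro exI[of _ 1]) (simp add: norm_scaleC)
qed

text \<open>
  The cone over the curve with vertex \<open>p\<close> and complex multiples has real dimension three,
  so that almost every complex line through \<open>p\<close> avoids the curve elsewhere.
\<close>

lemma line_avoiding_curve:
  fixes \<gamma> :: "real \<Rightarrow> complex ^ 2"
  assumes "\<And>x. \<gamma> differentiable (at x)"
  obtains b where "b \<noteq> 0" "\<And>t. t \<noteq> 0 \<Longrightarrow> p + t *\<^sub>C b \<notin> range \<gamma>"
proof -
  let ?c = "\<lambda>(x, c::complex). c *\<^sub>C (\<gamma> x - p)"
  have "?c differentiable (at y)" for y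
  proof -
    obtain \<gamma>' where "(\<gamma> has_derivative \<gamma>') (at (fst y))"
      using assms[of "fst y"] by (auto simp: differentiable_def)
    then have g: "((\<lambda>y. \<gamma> (fst y) - p) has_derivative (\<lambda>v. \<gamma>' (fst v))) (at y)"
      by (auto intro!: derivative_eq_intros has_derivative_compose[of fst fst y UNIV \<gamma> \<gamma>'] simp: has_derivative_fst)
    have "((\<lambda>y. snd y *\<^sub>C (\<gamma> (fst y) - p)) has_derivative
        (\<lambda>v. snd y *\<^sub>C \<gamma>' (fst v) + snd v *\<^sub>C (\<gamma> (fst y) - p))) (at y)"
      by (rule bounded_bilinear.FDERIV[OF bounded_bilinear_scaleC _ g]) (auto intro!: derivative_eq_intros)
    then show ?thesis unfolding differentiable_def case_prod_beta by blast
  qed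
  then have "negligible (range ?c)"
    by (intro negligible_differentiable_image_lowdim)
      (auto simp: differentiable_on_def differentiable_at_withinI)
  then have "range ?c \<noteq> UNIV" by (metis non_negligible_UNIV)
  then obtain b where b: "b \<notin> range ?c" by blast
  show ?thesis
  proof
    show "b \<noteq> 0" using b by (auto simp: image_iff split: prod.splits)
    fix t :: complex assume "t \<noteq> 0"
    show "p + t *\<^sub>C b \<notin> range \<gamma>"
    proof
      assume "p + t *\<^sub>C b \<in> range \<gamma>"
      then obtain x where "\<gamma> x = p + t *\<^sub>C b" by (metis imageE)
      then have "b = ?c (x, 1 / t)" using \<open>t \<noteq> 0\<close> by (simp add: scaleC_scaleC)
      with b show False by blast
    qed
  qed
qed

text \<open>The second basis vector \<open>a\<close> is chosen hermitian orthogonal to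
  \<open>b\<close>, so that the determinant is, up to sign, the squared length \<open>N\<close> of
  \<open>b\<close>. \<open>\<sigma>\<close> comes from Cramer's rule and \<open>\<tau>\<close> from
  the hermitian product with \<open>b\<close>.\<close>

lemma complex_coordinates:
  fixes b :: "complex ^ 2"
  assumes "b \<noteq> 0"
  obtains a \<sigma> \<tau> where "bounded_linear \<sigma>" "bounded_linear \<tau>"
    "\<And>c v. \<sigma> (c *\<^sub>C v) = c * \<sigma> v" "\<And>c v. \<tau> (c *\<^sub>C v) = c * \<tau> v"
    "\<And>s t. \<sigma> (s *\<^sub>C a + t *\<^sub>C b) = s" "\<And>s t. \<tau> (s *\<^sub>C a + t *\<^sub>C b) = t"
    "\<And>v. \<sigma> v *\<^sub>C a + \<tau> v *\<^sub>C b = v"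
proof -
  define N where "N = b $ 1 * cnj (b $ 1) + b $ 2 * cnj (b $ 2)"
  have "N = of_real ((cmod (b $ 1))\<^sup>2 + (cmod (b $ 2))\<^sup>2)"
    by (simp add: N_def complex_norm_square del: of_real_power)
  moreover have "(cmod (b $ 1))\<^sup>2 + (cmod (b $ 2))\<^sup>2 \<noteq> 0"
    using assms by (auto simp: sum_power2_eq_zero_iff vec_eq_iff forall_2)
  ultimately have N: "N \<noteq> 0" by (metis of_real_eq_0_iff)
  define a :: "complex ^ 2" where "a = vector [cnj (b $ 2), - cnj (b $ 1)]"
  define \<sigma> where "\<sigma> v = (v $ 1 * b $ 2 - v $ 2 * b $ 1) / N" for v :: "complex ^ 2"
  define \<tau> where "\<tau> v = (v $ 1 * cnj (b $ 1) + v $ 2 * cnj (b $ 2)) / N" for v :: "complex ^ 2"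
  have nth: "(c *\<^sub>C v) $ i = c * v $ i" for c and v :: "complex ^ 2" and i
    by (simp add: scaleC_vec_def scaleC_complex_def)
  show ?thesis
  proof
    show "bounded_linear \<sigma>" "bounded_linear \<tau>"
      unfolding \<sigma>_def \<tau>_def
      by (intro bounded_linear_intros bounded_linear_compose[OF bounded_linear_divide]
        bounded_linear_sub bounded_linear_add bounded_linear_compose[OF bounded_linear_mult_left] bounded_linear_vec_nth)+
    show "\<sigma> (c *\<^sub>C v) = c * \<sigma> v" "\<tau> (c *\<^sub>C v) = c * \<tau> v" for c v
      by (simp_all add: \<sigma>_def \<tau>_def nth algebra_simps)
    show "\<sigma> (s *\<^sub>C a + t *\<^sub>C b) = s" "\<tau> (s *\<^sub>C a + t *\<^sub>C b) = t" for s t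
      using N by (simp_all add: \<sigma>_def \<tau>_def nth a_def N_def field_simps)
    show "\<sigma> v *\<^sub>C a + \<tau> v *\<^sub>C b = v" for v
    proof -
      have N\<sigma>: "N * \<sigma> v = v $ 1 * b $ 2 - v $ 2 * b $ 1"
        and N\<tau>: "N * \<tau> v = v $ 1 * cnj (b $ 1) + v $ 2 * cnj (b $ 2)"
        using N by (simp_all add: \<sigma>_def \<tau>_def)
      have "N * (\<sigma> v *\<^sub>C a + \<tau> v *\<^sub>C b) $ i = N * v $ i" for i
      proof -
        have "N * (\<sigma> v *\<^sub>C a + \<tau> v *\<^sub>C b) $ i = (N * \<sigma> v) * a $ i + (N * \<tau> v) * b $ i"
          by (simp add: nth algebra_simps)
        also have "\<dots> = N * v $ i"
          unfolding N\<sigma> N\<tau> using exhaust_2[of i] by (auto simp: a_def N_def algebra_simps)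
        finally show ?thesis .
      qed
      then show ?thesis using N by (simp add: vec_eq_iff)
    qed
  qed
qed

text \<open>The parameter has real dimension one, the \<open>s\<close>-axis real dimension
  two.\<close>

lemma curve_projection_negligible:
  fixes \<gamma> :: "real \<Rightarrow> complex ^ 2" and \<sigma> :: "complex ^ 2 \<Rightarrow> complex"
  assumes "\<And>x. \<gamma> differentiable (at x)" "bounded_linear \<sigma>"
  shows "negligible ((\<lambda>x. \<sigma> (\<gamma> x - p)) ` UNIV)"
proof (rule negligible_differentiable_image_lowdim)
  have "(\<lambda>x. \<sigma> (\<gamma> x - p)) differentiable (at x)" for x
  proof -
    obtain \<gamma>' where "(\<gamma> has_derivative \<gamma>') (at x)" using assms(1)[of x] by (auto simp: differentiable_def)
    then have "((\<lambda>x. \<gamma> x - p) has_derivative \<gamma>') (at x)" by (auto intro!: derivative_eq_intros)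
    from bounded_linear.has_derivative[OF assms(2) this] show ?thesis
      unfolding differentiable_def by blast
  qed
  then show "(\<lambda>x. \<sigma> (\<gamma> x - p)) differentiable_on UNIV"
    by (auto simp: differentiable_on_def differentiable_at_withinI)
qed simp

lemma local_extension:
  fixes f :: "complex ^ 2 \<Rightarrow> proj_l2" and \<gamma> :: "real \<Rightarrow> complex ^ 2"
  assumes diff: "\<And>x. \<gamma> differentiable (at x)" and clo: "closed (range \<gamma>)"
    and f: "proj_holomorphic_on f (- range \<gamma>)"
  assumes p: "p \<in> range \<gamma>"
  obtains V \<phi> where "open V" "p \<in> V" "cx_holomorphic_on \<phi> V"
    "\<And>z. z \<in> V \<Longrightarrow> z \<noteq> p \<Longrightarrow> \<phi> z \<noteq> 0" "\<And>z. z \<in> V - range \<gamma> \<Longrightarrow> f z = proj (\<phi> z)"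
proof -
  let ?\<Gamma> = "range \<gamma>"
  obtain b where b: "b \<noteq> 0" "\<And>t. t \<noteq> 0 \<Longrightarrow> p + t *\<^sub>C b \<notin> ?\<Gamma>"
    by (rule line_avoiding_curve[OF diff, of p], rule that)
  obtain a \<sigma> \<tau> where lin: "bounded_linear \<sigma>" "bounded_linear \<tau>"
    "\<And>c v. \<sigma> (c *\<^sub>C v) = c * \<sigma> v" "\<And>c v. \<tau> (c *\<^sub>C v) = c * \<tau> v"
    and \<sigma>\<tau>: "\<And>s t. \<sigma> (s *\<^sub>C a + t *\<^sub>C b) = s" "\<And>s t. \<tau> (s *\<^sub>C a + t *\<^sub>C b) = t"
    "\<And>v. \<sigma> v *\<^sub>C a + \<tau> v *\<^sub>C b = v"
    by (rule complex_coordinates[OF b(1)], rule that)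
  define L where "L s t = p + (s *\<^sub>C a + t *\<^sub>C b)" for s t
  define S where "S z = \<sigma> (z - p)" for z
  define T where "T z = \<tau> (z - p)" for z
  have ST: "S (L s t) = s" "T (L s t) = t" for s t by (simp_all add: S_def T_def L_def \<sigma>\<tau>)
  have LST: "L (S z) (T z) = z" for z by (simp add: S_def T_def L_def \<sigma>\<tau>(3))
  have L1: "L s t = (p + s *\<^sub>C a) + t *\<^sub>C b" and L2: "L s t = (p + t *\<^sub>C b) + s *\<^sub>C a" for s t
    by (simp_all add: L_def algebra_simps)
  have contL: "continuous_on A (\<lambda>x. L (fst x) (snd x))" for A
    unfolding L_def
    by (intro continuous_intros bounded_bilinear.continuous_on[OF bounded_bilinear_scaleC])
  have contS: "continuous_on A S" "continuous_on A T" for A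
    unfolding S_def T_def
    by (intro bounded_linear.continuous_on[OF lin(1)] bounded_linear.continuous_on[OF lin(2)] continuous_intros)+
  define E where "E = (\<lambda>x. \<sigma> (\<gamma> x - p)) ` UNIV"
  have E: "negligible E" unfolding E_def by (rule curve_projection_negligible[OF diff lin(1)])
  have LE: "L s t \<notin> ?\<Gamma>" if "s \<notin> E" for s t
  proof
    assume "L s t \<in> ?\<Gamma>"
    then obtain x where "\<gamma> x = L s t" by (metis imageE)
    then have "s = \<sigma> (\<gamma> x - p)" using ST(1)[of s t] by (simp add: S_def)
    with that show False by (auto simp: E_def)
  qed
  have "holomorphic_curve (\<lambda>t. f (p + t *\<^sub>C b)) {t. p + t *\<^sub>C b \<in> - ?\<Gamma>}"
    by (rule holomorphic_curve_line[OF f])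
  moreover have "{t. p + t *\<^sub>C b \<in> - ?\<Gamma>} = - {0}"
  proof -
    have "p + 0 *\<^sub>C b \<in> ?\<Gamma>" using p by simp
    then show ?thesis using b(2) by blast
  qed
  ultimately have G0: "holomorphic_curve (\<lambda>t. f (p + t *\<^sub>C b)) (- {0})" by simp
  have con: "connected (- {0::complex})" by (rule connected_punctured_universe) simp
  obtain k where k: "f (p + 1 *\<^sub>C b) \<in> chart_domain k" by (rule exists_chart_domain)
  \<comment> \<open>A compact annulus around the puncture contains only finitely many zeros of
    coordinate \<open>k\<close>, so some radius in \<open>{1..2}\<close> avoids all their moduli.
    The index \<open>k\<close> is taken from a chart at the point \<open>t = 1\<close>.\<close>
  let ?C = "cball 0 2 - ball (0::complex) 1"
  have "finite {t \<in> ?C. f (p + t *\<^sub>C b) \<notin> chart_domain k}" (is "finite ?Z")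
    by (rule holomorphic_curve_finite_zeros[OF G0 con _ k]) (auto intro: compact_diff)
  then have "finite (cmod ` ?Z)" by simp
  moreover have "infinite {1..2::real}" by (simp add: infinite_Icc)
  ultimately have "\<not> {1..2} \<subseteq> cmod ` ?Z" using finite_subset by blast
  then obtain r where r: "1 \<le> r" "r \<le> 2" "r \<notin> cmod ` ?Z"
    unfolding subset_iff atLeastAtMost_iff by blast
  have r_pos: "0 < r" using r by simp
  have sph: "f (L 0 t) \<in> chart_domain k" "L 0 t \<notin> ?\<Gamma>" if "t \<in> sphere 0 r" for t
  proof -
    have "t \<in> ?C" "t \<noteq> 0" "cmod t = r" using that r by auto
    then show "f (L 0 t) \<in> chart_domain k" "L 0 t \<notin> ?\<Gamma>"
      using r(3) b(2)[of t] by (auto simp: L_def)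
  qed
  define W where "W k = {z \<in> - ?\<Gamma>. f z \<in> chart_domain k}" for k
  have oW: "open (W k)" for k unfolding W_def by (rule open_preimage_chart_domain[OF f])
  have open_pre: "open ((\<lambda>x. L (fst x) (snd x)) -` W k)"
    using oW by (intro open_vimage contL)
  have circle_pre: "{0} \<times> sphere 0 r \<subseteq> (\<lambda>x. L (fst x) (snd x)) -` W k"
  proof
    fix x assume "x \<in> {0::complex} \<times> sphere (0::complex) r"
    then have "fst x = 0" "snd x \<in> sphere 0 r" by auto
    then show "x \<in> (\<lambda>x. L (fst x) (snd x)) -` W k" using sph[of "snd x"] by (simp add: W_def)
  qed
  have circle_compact: "compact ({0::complex} \<times> sphere (0::complex) r)" by (intro compact_Times) auto
  \<comment> \<open>A tube around the circle: by compactness the whole circle stays off the curve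
    and within chart \<open>k\<close> for all small \<open>s\<close>, including those in
    \<open>E\<close>.\<close>
  obtain d where d: "0 < d"
    "(\<Union>x\<in>{0} \<times> sphere 0 r. ball x d) \<subseteq> (\<lambda>x. L (fst x) (snd x)) -` W k"
    by (rule compact_subset_open_imp_ball_epsilon_subset[OF circle_compact open_pre circle_pre], rule that)
  define e where "e = d / 2"
  have e: "0 < e" using d by (simp add: e_def)
  have LW: "L s t \<in> W k" if "s \<in> cball 0 e" "t \<in> sphere 0 r" for s t
  proof -
    have "(s, t) \<in> ball (0, t) d" using that d(1) by (simp add: dist_Pair_Pair e_def)
    then have "(s, t) \<in> (\<lambda>x. L (fst x) (snd x)) -` W k" using d(2) that(2) by blast
    then show ?thesis by simp
  qed
  have LWimg: "(\<lambda>x. L (fst x) (snd x)) ` (cball 0 e \<times> sphere 0 r) \<subseteq> W k" using LW by auto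
  have hc: "cx_holomorphic_on (\<lambda>z. hcoord l j (f z)) (W l)" for l j
    unfolding W_def by (rule cx_holomorphic_on_hcoord[OF f])
  have hcc: "continuous_on (W l) (\<lambda>z. hcoord l j (f z))" for l j
    by (rule cx_holomorphic_on_imp_continuous_on[OF hc])
  have "continuous_on (W k) (\<lambda>z. chart k (f z))"
    using f unfolding proj_holomorphic_on_def W_def by (auto intro: cx_holomorphic_on_imp_continuous_on)
  from continuous_on_compose2[OF this contL LWimg]
  have "continuous_on (cball 0 e \<times> sphere 0 r) (\<lambda>x. chart k (f (L (fst x) (snd x))))" .
  then have "compact ((\<lambda>x. chart k (f (L (fst x) (snd x)))) ` (cball 0 e \<times> sphere 0 r))"
    by (intro compact_continuous_image compact_Times) auto
  then have "bounded ((\<lambda>x. chart k (f (L (fst x) (snd x)))) ` (cball 0 e \<times> sphere 0 r))"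
    by (rule compact_imp_bounded)
  then obtain M where
    "\<forall>y\<in>(\<lambda>x. chart k (f (L (fst x) (snd x)))) ` (cball 0 e \<times> sphere 0 r). norm y \<le> M"
    unfolding bounded_iff ..
  then have M: "norm (chart k (f (L (fst x) (snd x)))) \<le> M" if "x \<in> cball 0 e \<times> sphere 0 r" for x
    using that by (rule bspec[OF _ imageI])
  define \<omega> where "\<omega> j s t = hcoord k j (f (L s t))" for j s t
  obtain h e' r' M' where eps: "0 < e'" "e' \<le> e" "0 < r'" "r' \<le> r"
    and h: "\<And>j s t. s \<in> ball 0 e' \<Longrightarrow> t \<in> ball 0 r' \<Longrightarrow> cdifferentiable_at (\<lambda>(s, t). h j s t) (s, t)"
    and hM: "\<And>s t N. s \<in> ball 0 e' \<Longrightarrow> t \<in> ball 0 r' \<Longrightarrow> (\<Sum>j<N. (cmod (h j s t))\<^sup>2) \<le> M'"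
    and hnz: "\<And>s t. s \<in> ball 0 e' \<Longrightarrow> t \<in> ball 0 r' \<Longrightarrow> (s, t) \<noteq> (0, 0) \<Longrightarrow> \<exists>j. h j s t \<noteq> 0"
    and h\<omega>: "\<And>s. s \<in> ball 0 e' - E \<Longrightarrow> \<exists>Z. finite Z \<and> (\<forall>t\<in>ball 0 r' - Z. \<exists>p. \<forall>j. h j s t = p * \<omega> j s t)"
  proof (rule common_denominator_extension[OF e r_pos _ _ E, of \<omega> k "1 + M\<^sup>2"])
    show "continuous_on (cball 0 e \<times> sphere 0 r) (\<lambda>(s, t). \<omega> j s t)" for j
      unfolding \<omega>_def case_prod_beta by (rule continuous_on_compose2[OF hcc contL LWimg])
    show "(\<lambda>s. \<omega> j s t) holomorphic_on ball 0 e" if "t \<in> sphere 0 r" for j t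
    proof -
      have "holomorphic_curve (\<lambda>s. f (L s t)) {s. L s t \<in> - ?\<Gamma>}"
        unfolding L2 by (rule holomorphic_curve_line[OF f])
      then have "(\<lambda>s. \<omega> j s t) holomorphic_on {s \<in> {s. L s t \<in> - ?\<Gamma>}. f (L s t) \<in> chart_domain k}"
        unfolding holomorphic_curve_def \<omega>_def by blast
      then show ?thesis
      proof (rule holomorphic_on_subset)
        show "ball 0 e \<subseteq> {s \<in> {s. L s t \<in> - ?\<Gamma>}. f (L s t) \<in> chart_domain k}"
        proof
          fix s :: complex assume "s \<in> ball 0 e"
          then have "L s t \<in> W k" by (intro LW that) simp
          then show "s \<in> {s \<in> {s. L s t \<in> - ?\<Gamma>}. f (L s t) \<in> chart_domain k}"
            unfolding W_def by blast
        qed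
      qed
    qed
    show "\<exists>Q::complex poly. Q \<noteq> 0 \<and> (\<forall>j. continuous_on (cball 0 r) (\<lambda>t. poly Q t * \<omega> j s t) \<and>
        (\<lambda>t. poly Q t * \<omega> j s t) holomorphic_on ball 0 r)" if s: "s \<in> ball 0 e - E" for s
    proof -
      have "holomorphic_curve (\<lambda>t. f (L s t)) {t. L s t \<in> - ?\<Gamma>}"
        unfolding L1 by (rule holomorphic_curve_line[OF f])
      moreover have "{t. L s t \<in> - ?\<Gamma>} = UNIV" using LE[of s] s by blast
      ultimately have G: "holomorphic_curve (\<lambda>t. f (L s t)) UNIV" by simp
      have rk: "f (L s (of_real r)) \<in> chart_domain k"
        using LW[of s "of_real r"] s r_pos by (simp add: W_def)
      obtain Q V where Q: "Q \<noteq> (0 :: complex poly)" "open V" "cball 0 r \<subseteq> V"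
        "\<And>j. (\<lambda>t. poly Q t * hcoord k j (f (L s t))) holomorphic_on V"
        by (rule holomorphic_curve_denominator[OF G connected_UNIV UNIV_I rk compact_cball[of 0 r] subset_UNIV], rule that)
      have "continuous_on (cball 0 r) (\<lambda>t. poly Q t * \<omega> j s t) \<and>
        (\<lambda>t. poly Q t * \<omega> j s t) holomorphic_on ball 0 r" for j
        unfolding \<omega>_def
        using Q(3) ball_subset_cball holomorphic_on_subset[OF Q(4)] holomorphic_on_imp_continuous_on
        by (meson order_trans)
      with Q(1) show ?thesis by blast
    qed
    show "\<omega> k s t = 1" if "s \<in> cball 0 e" "t \<in> sphere 0 r" for s t
      using LW[OF that] by (simp add: \<omega>_def W_def hcoord_self)
    show "(\<Sum>j<N. (cmod (\<omega> j s t))\<^sup>2) \<le> 1 + M\<^sup>2" if "s \<in> cball 0 e" "t \<in> sphere 0 r" for s t N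
    proof -
      have "(\<Sum>j<N. (cmod (\<omega> j s t))\<^sup>2) \<le> 1 + (norm (chart k (f (L s t))))\<^sup>2"
        unfolding \<omega>_def by (rule sum_hcoord_le) (use LW[OF that] in \<open>simp add: W_def\<close>)
      also have "\<dots> \<le> 1 + M\<^sup>2"
        using M[of "(s, t)"] that by (intro add_left_mono power_mono) auto
      finally show ?thesis .
    qed
  qed (rule that)
  define V where "V = {z. S z \<in> ball 0 e' \<and> T z \<in> ball 0 r'}"
  have "V = S -` ball 0 e' \<inter> T -` ball 0 r'" by (auto simp: V_def)
  then have oV: "open V" by (auto intro!: open_Int open_vimage contS)
  define g where "g z j = h j (S z) (T z)" for z j
  define \<phi> where "\<phi> z = Abs_l2 (g z)" for z
  have coord: "cx_holomorphic_on (\<lambda>z. g z j) V" for j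
    unfolding cx_holomorphic_on_def
  proof
    fix z assume "z \<in> V"
    then obtain A B where AB: "((\<lambda>(s, t). h j s t) has_derivative (\<lambda>(u, v). A * u + B * v)) (at (S z, T z))"
      using h[of "S z" "T z" j] unfolding V_def cdifferentiable_at_def by blast
    have sub: "((\<lambda>z. z - p) has_derivative (\<lambda>v. v)) (at z)" by (auto intro!: derivative_eq_intros)
    have "((\<lambda>z. (S z, T z)) has_derivative (\<lambda>v. (\<sigma> v, \<tau> v))) (at z)"
      unfolding S_def T_def
      by (intro has_derivative_Pair bounded_linear.has_derivative[OF lin(1) sub] bounded_linear.has_derivative[OF lin(2) sub])
    from has_derivative_compose[OF this AB]
    have D1: "((\<lambda>z. g z j) has_derivative (\<lambda>v. A * \<sigma> v + B * \<tau> v)) (at z)"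
      by (simp add: g_def)
    have D2: "A * \<sigma> (c *\<^sub>C v) + B * \<tau> (c *\<^sub>C v) = c *\<^sub>C (A * \<sigma> v + B * \<tau> v)" for c v
      by (simp add: lin scaleC_complex_def algebra_simps)
    show "\<exists>D. ((\<lambda>z. g z j) has_derivative D) (at z) \<and> (\<forall>c v. D (c *\<^sub>C v) = c *\<^sub>C D v)"
      by (rule exI, rule conjI[OF D1], intro allI, rule D2)
  qed
  have bnd: "\<exists>R M. 0 < R \<and> ball z R \<subseteq> V \<and> (\<forall>y\<in>ball z R. \<forall>N. (\<Sum>j<N. (cmod (g y j))\<^sup>2) \<le> M)"
    if zV: "z \<in> V" for z
  proof -
    obtain R where R: "0 < R" "ball z R \<subseteq> V" by (rule openE[OF oV zV], rule that)
    have M': "(\<Sum>j<N. (cmod (g y j))\<^sup>2) \<le> M'" if "y \<in> V" for y N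
      using that unfolding g_def V_def by (intro hM) auto
    show ?thesis
    proof (intro exI conjI ballI allI)
      show "(\<Sum>j<N. (cmod (g y j))\<^sup>2) \<le> M'" if "y \<in> ball z R" for y N
        using R(2) that by (intro M') (rule subsetD)
    qed fact+
  qed
  have \<phi>hol: "cx_holomorphic_on \<phi> V"
    unfolding \<phi>_def by (rule cx_holomorphic_on_l2I(1)[OF coord bnd])
  have nth: "l2_nth (\<phi> z) = g z" if "z \<in> V" for z
    unfolding \<phi>_def by (rule cx_holomorphic_on_l2I(2)[OF coord bnd that])
  have nz: "\<phi> z \<noteq> 0" if z: "z \<in> V" "z \<noteq> p" for z
  proof -
    have "(S z, T z) \<noteq> (0, 0)" using z(2) LST[of z] by (auto simp: L_def)
    then obtain j where "g z j \<noteq> 0" using hnz[of "S z" "T z"] z(1) by (auto simp: V_def g_def)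
    then have "l2_nth (\<phi> z) j \<noteq> 0" using nth[OF z(1)] by simp
    then show ?thesis by (rule l2_nth_nonzero)
  qed
  \<comment> \<open>Proportionality of \<open>g\<close> to the homogeneous coordinates of
    \<open>f\<close> is known only for \<open>s\<close> outside \<open>E\<close> and for all but
    finitely many \<open>t\<close>. Such points are dense because \<open>E\<close> is a null set;
    the factor \<open>c\<close> may be 0.\<close>
  have dense: "\<exists>y\<in>O'. \<exists>c. \<forall>j. g y j = c * hcoord k j (f y)"
    if O': "open O'" "O' \<subseteq> V" "z \<in> O'" for O' z
  proof -
    have "open ((\<lambda>x. L (fst x) (snd x)) -` O')" using O'(1) by (intro open_vimage contL)
    moreover have "(S z, T z) \<in> (\<lambda>x. L (fst x) (snd x)) -` O'" using O'(3) LST by simp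
    ultimately obtain A B where AB: "open A" "open B" "S z \<in> A" "T z \<in> B"
      "A \<times> B \<subseteq> (\<lambda>x. L (fst x) (snd x)) -` O'"
      by (rule open_prod_elim) (rule that, auto)
    have ABO: "L s t \<in> O'" if "s \<in> A" "t \<in> B" for s t
      using subsetD[OF AB(5) SigmaI[OF that]] by simp
    have "\<not> A \<subseteq> E"
      using E AB(1,3) open_not_negligible negligible_subset by blast
    then obtain s where s: "s \<in> A" "s \<notin> E" by blast
    have V: "s \<in> ball 0 e'" "t \<in> ball 0 r'" if "t \<in> B" for t
    proof -
      have "L s t \<in> V" using ABO[OF s(1) that] O'(2) by blast
      then show "s \<in> ball 0 e'" "t \<in> ball 0 r'" by (simp_all add: V_def ST)
    qed
    obtain Z where Z: "finite Z" "\<forall>t\<in>ball 0 r' - Z. \<exists>p. \<forall>j. h j s t = p * \<omega> j s t"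
      using h\<omega>[of s] V(1)[OF AB(4)] s(2) by blast
    have "infinite B"
    proof
      assume "finite B"
      with AB(2,4) show False using open_not_negligible[of B] negligible_finite by blast
    qed
    then have "\<not> B \<subseteq> Z" using Z(1) finite_subset by blast
    then obtain t where t: "t \<in> B" "t \<notin> Z" by blast
    then obtain c where "\<forall>j. h j s t = c * \<omega> j s t" using Z(2) V(2) by blast
    moreover have "L s t \<in> O'" using ABO[OF s(1) t(1)] .
    ultimately show ?thesis by (intro bexI[of _ "L s t"]) (auto simp: g_def ST \<omega>_def)
  qed
  have gc: "continuous_on V (\<lambda>z. g z j)" for j
    by (rule cx_holomorphic_on_imp_continuous_on[OF coord])
  have proj: "f z = proj (\<phi> z)" if z: "z \<in> V - ?\<Gamma>" for z
  proof -
    obtain w where w: "w \<noteq> 0" "f z = proj w" by (rule proj_surj)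
    obtain l where l: "l2_nth w l \<noteq> 0" using w(1) by (rule l2_nonzero_coord)
    have zW: "z \<in> V \<inter> W l" using z w l by (simp add: W_def proj_in_chart_domain_iff)
    have oVW: "open (V \<inter> W l)" using oV oW by blast
    \<comment> \<open>Both sides are continuous on \<open>V \<inter> W l\<close>, so a failure at
      \<open>z\<close> would persist on an open set, and this set contains points where
      \<open>g\<close> is proportional to the coordinates of \<open>f\<close>.\<close>
    have eq: "g z i = g z l * hcoord l i (f z)" for i
    proof (rule ccontr)
      let ?d = "\<lambda>z. g z i - g z l * hcoord l i (f z)"
      assume ne: "\<not> ?thesis"
      have "continuous_on (V \<inter> W l) ?d"
        by (intro continuous_intros continuous_on_subset[OF gc] continuous_on_subset[OF hcc]) auto
      then have "open (?d -` (- {0}) \<inter> (V \<inter> W l))"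
        using continuous_on_open_vimage[OF oVW] by blast
      moreover have "z \<in> ?d -` (- {0}) \<inter> (V \<inter> W l)" using ne zW by simp
      ultimately obtain y c where y: "y \<in> ?d -` (- {0}) \<inter> (V \<inter> W l)"
        "\<forall>j. g y j = c * hcoord k j (f y)"
        using dense[of "?d -` (- {0}) \<inter> (V \<inter> W l)" z] by blast
      have fy: "f y \<in> chart_domain l" using y(1) by (simp add: W_def)
      \<comment> \<open>This also covers the case that \<open>f y\<close> lies outside chart
        \<open>k\<close>: all quotients by coordinate \<open>k\<close> are then 0 by the convention
        on division, and both sides vanish.\<close>
      have "g y i = g y l * hcoord l i (f y)"
        using y(2) hcoord_change[OF fy, of k] hcoord_self[OF fy] by simp
      with y(1) show False by simp
    qed
    have "\<phi> z = (g z l / l2_nth w l) *\<^sub>C w"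
    proof (rule l2_eqI)
      show "l2_nth (\<phi> z) i = l2_nth ((g z l / l2_nth w l) *\<^sub>C w) i" for i
        using eq[of i] z by (simp add: nth l2_nth_scaleC w(2) hcoord_proj[OF w(1)])
    qed
    moreover have "\<phi> z \<noteq> 0" using z p nz by blast
    ultimately show ?thesis
      unfolding w(2) using w(1) by (metis proj_eq_iff scaleC_zero_left)
  qed
  have pV: "p \<in> V"
  proof -
    have "S p = 0" "T p = 0" using ST[of 0 0] by (simp_all add: L_def)
    then show ?thesis using eps by (simp add: V_def)
  qed
  show ?thesis by (rule that[OF oV pV \<phi>hol nz proj])
qed

section \<open>Gluing\<close>

text \<open>Nonzero vectors are proportional when all two by two minors of their coordinates vanish.
  The minors are continuous and vanish off \<open>\<Gamma>\<close>, whose complement is dense, hence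
  they vanish at \<open>q\<close> too.\<close>

lemma proj_lifts_agree:
  fixes \<phi> \<psi> :: "'a::topological_space \<Rightarrow> l2"
  assumes V: "open V" "continuous_on V \<phi>" "continuous_on V \<psi>" and q: "q \<in> V" "\<phi> q \<noteq> 0" "\<psi> q \<noteq> 0"
    and thin: "\<And>O'. open O' \<Longrightarrow> O' \<noteq> {} \<Longrightarrow> O' - \<Gamma> \<noteq> {}"
    and eq: "\<And>z. z \<in> V - \<Gamma> \<Longrightarrow> \<phi> z \<noteq> 0 \<and> \<psi> z \<noteq> 0 \<and> proj (\<phi> z) = proj (\<psi> z)"
  shows "proj (\<phi> q) = proj (\<psi> q)"
proof -
  have cross: "l2_nth (\<phi> q) i * l2_nth (\<psi> q) j - l2_nth (\<phi> q) j * l2_nth (\<psi> q) i = 0" (is "?d q = 0") for i j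
  proof (rule ccontr)
    assume ne: "?d q \<noteq> 0"
    have "continuous_on V ?d" using V by (intro continuous_intros)
    then have "open (?d -` (- {0}) \<inter> V)"
      using continuous_on_open_vimage[OF V(1)] by blast
    moreover have "?d -` (- {0}) \<inter> V \<noteq> {}" using q(1) ne by blast
    ultimately obtain z where z: "?d z \<noteq> 0" "z \<in> V - \<Gamma>" using thin by blast
    then obtain c where "\<phi> z = c *\<^sub>C \<psi> z" using eq[OF z(2)] proj_eq_iff by blast
    with z(1) show False by (simp add: l2_nth_scaleC)
  qed
  obtain l where l: "l2_nth (\<psi> q) l \<noteq> 0" using q(3) by (rule l2_nonzero_coord)
  have "\<phi> q = (l2_nth (\<phi> q) l / l2_nth (\<psi> q) l) *\<^sub>C \<psi> q"
  proof (rule l2_eqI)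
    show "l2_nth (\<phi> q) i = l2_nth ((l2_nth (\<phi> q) l / l2_nth (\<psi> q) l) *\<^sub>C \<psi> q) i" for i
      using cross[of i l] l by (simp add: l2_nth_scaleC field_simps)
  qed
  with q show ?thesis by (metis proj_eq_iff scaleC_zero_left)
qed

lemma sum_square_reindex_le:
  fixes \<pi> :: "nat \<Rightarrow> nat"
  assumes "inj \<pi>"
  shows "(\<Sum>j<N. (cmod (l2_nth w (\<pi> j)))\<^sup>2) \<le> (norm w)\<^sup>2"
proof -
  have "(\<Sum>j<N. (cmod (l2_nth w (\<pi> j)))\<^sup>2) = (\<Sum>i\<in>\<pi> ` {..<N}. (cmod (l2_nth w i))\<^sup>2)"
    using assms by (simp only: sum.reindex inj_on_subset[OF _ subset_UNIV] o_def)
  also have "\<dots> \<le> (\<Sum>i. (cmod (l2_nth w i))\<^sup>2)"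
    by (rule sum_le_suminf) (auto simp: summable_l2_nth)
  also have "\<dots> = (norm w)\<^sup>2"
    by (simp add: norm_l2_def suminf_nonneg[OF summable_l2_nth])
  finally show ?thesis .
qed

text \<open>An application of the weak criterion for holomorphy. The local bound for the square sums
  combines a bound for \<open>norm (\<phi> y)\<close> from above with one for
  \<open>cmod (l2_nth (\<phi> y) k)\<close> from below, both by continuity.\<close>

lemma cx_holomorphic_on_affine_quotient:
  assumes \<phi>: "cx_holomorphic_on \<phi> V" and V: "open V"
  shows "cx_holomorphic_on (\<lambda>z. affine_quotient k (\<phi> z)) {z \<in> V. l2_nth (\<phi> z) k \<noteq> 0}"
proof -
  let ?U = "{z \<in> V. l2_nth (\<phi> z) k \<noteq> 0}"
  let ?\<pi> = "\<lambda>j. if j < k then j else Suc j"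
  have cont: "continuous_on V \<phi>" using \<phi> by (rule cx_holomorphic_on_imp_continuous_on)
  have "open ((\<lambda>z. l2_nth (\<phi> z) k) -` (- {0}) \<inter> V)"
    using continuous_on_open_vimage[OF V] continuous_on_l2_nth[OF cont] by blast
  moreover have "(\<lambda>z. l2_nth (\<phi> z) k) -` (- {0}) \<inter> V = ?U" by auto
  ultimately have oU: "open ?U" by simp
  have "cx_holomorphic_on (\<lambda>z. Abs_l2 (l2_nth (affine_quotient k (\<phi> z)))) ?U"
  proof (rule cx_holomorphic_on_l2I(1))
    fix j
    show "cx_holomorphic_on (\<lambda>z. l2_nth (affine_quotient k (\<phi> z)) j) ?U"
      unfolding cx_holomorphic_on_def
    proof
      fix z assume z: "z \<in> ?U"
      then obtain D where D: "(\<phi> has_derivative D) (at z)" "\<And>c v. D (c *\<^sub>C v) = c *\<^sub>C D v"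
        using \<phi> unfolding cx_holomorphic_on_def by blast
      let ?D = "\<lambda>v. (l2_nth (D v) (?\<pi> j) * l2_nth (\<phi> z) k - l2_nth (\<phi> z) (?\<pi> j) * l2_nth (D v) k) /
          (l2_nth (\<phi> z) k * l2_nth (\<phi> z) k)"
      have D1: "((\<lambda>z. l2_nth (\<phi> z) (?\<pi> j) / l2_nth (\<phi> z) k) has_derivative ?D) (at z)"
        using z by (intro has_derivative_divide' bounded_linear.has_derivative[OF bounded_linear_l2_nth D(1)]) simp
      have D2: "?D (c *\<^sub>C v) = c *\<^sub>C ?D v" for c v
        by (simp add: D(2) l2_nth_scaleC scaleC_complex_def algebra_simps)
      show "\<exists>D. ((\<lambda>z. l2_nth (affine_quotient k (\<phi> z)) j) has_derivative D) (at z) \<and>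
          (\<forall>c v. D (c *\<^sub>C v) = c *\<^sub>C D v)"
        unfolding affine_quotient.rep_eq
        by (rule exI, rule conjI[OF D1], intro allI, rule D2)
    qed
  next
    fix z assume z: "z \<in> ?U"
    define m where "m = cmod (l2_nth (\<phi> z) k) / 2"
    have m: "0 < m" using z by (simp add: m_def)
    let ?O = "{y \<in> ?U. norm (\<phi> y) < norm (\<phi> z) + 1} \<inter> {y \<in> ?U. m < cmod (l2_nth (\<phi> y) k)}"
    have cU: "continuous_on ?U \<phi>" by (rule continuous_on_subset[OF cont]) auto
    have "open ((\<lambda>y. norm (\<phi> y)) -` {..<norm (\<phi> z) + 1} \<inter> ?U)"
      "open ((\<lambda>y. cmod (l2_nth (\<phi> y) k)) -` {m<..} \<inter> ?U)"
      by (rule continuous_on_open_vimage[OF oU, THEN iffD1, rule_format];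
          intro continuous_intros cU open_lessThan open_greaterThan)+
    moreover have "(\<lambda>y. norm (\<phi> y)) -` {..<norm (\<phi> z) + 1} \<inter> ?U = {y \<in> ?U. norm (\<phi> y) < norm (\<phi> z) + 1}"
      "(\<lambda>y. cmod (l2_nth (\<phi> y) k)) -` {m<..} \<inter> ?U = {y \<in> ?U. m < cmod (l2_nth (\<phi> y) k)}"
      by auto
    ultimately have "open ?O" by (simp add: open_Int)
    moreover have "z \<in> ?O" using z m by (simp add: m_def)
    ultimately obtain R where R: "0 < R" "ball z R \<subseteq> ?O" by (rule openE)
    have "(\<Sum>j<N. (cmod (l2_nth (affine_quotient k (\<phi> y)) j))\<^sup>2) \<le> (norm (\<phi> z) + 1)\<^sup>2 / m\<^sup>2"
      if y: "y \<in> ?O" for y N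
    proof -
      have "(\<Sum>j<N. (cmod (l2_nth (affine_quotient k (\<phi> y)) j))\<^sup>2) =
          (\<Sum>j<N. (cmod (l2_nth (\<phi> y) (?\<pi> j)))\<^sup>2) / (cmod (l2_nth (\<phi> y) k))\<^sup>2"
        by (simp add: affine_quotient.rep_eq norm_divide power_divide sum_divide_distrib)
      also have "\<dots> \<le> (norm (\<phi> z) + 1)\<^sup>2 / m\<^sup>2"
      proof (rule frac_le)
        have "(\<Sum>j<N. (cmod (l2_nth (\<phi> y) (?\<pi> j)))\<^sup>2) \<le> (norm (\<phi> y))\<^sup>2"
          by (rule sum_square_reindex_le) (auto simp: inj_on_def split: if_splits)
        also have "\<dots> \<le> (norm (\<phi> z) + 1)\<^sup>2" using y by (intro power_mono) auto
        finally show "(\<Sum>j<N. (cmod (l2_nth (\<phi> y) (?\<pi> j)))\<^sup>2) \<le> (norm (\<phi> z) + 1)\<^sup>2" .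
        show "m\<^sup>2 \<le> (cmod (l2_nth (\<phi> y) k))\<^sup>2" using y m by (intro power_mono) auto
      qed (use m in auto)
      finally show ?thesis .
    qed
    then have "\<forall>y\<in>ball z R. \<forall>N. (\<Sum>j<N. (cmod (l2_nth (affine_quotient k (\<phi> y)) j))\<^sup>2) \<le> (norm (\<phi> z) + 1)\<^sup>2 / m\<^sup>2"
      using R(2) by (meson subsetD)
    moreover have "ball z R \<subseteq> ?U" using R(2) by auto
    ultimately show "\<exists>R M. 0 < R \<and> ball z R \<subseteq> ?U \<and>
        (\<forall>y\<in>ball z R. \<forall>N. (\<Sum>j<N. (cmod (l2_nth (affine_quotient k (\<phi> y)) j))\<^sup>2) \<le> M)"
      using R(1) by (intro exI conjI)
  qed
  then show ?thesis by (simp add: l2_nth_inverse)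
qed

lemma cx_holomorphic_on_cong:
  assumes "open S" "\<And>z. z \<in> S \<Longrightarrow> f z = g z" "cx_holomorphic_on f S"
  shows "cx_holomorphic_on g S"
  unfolding cx_holomorphic_on_def
proof
  fix z assume z: "z \<in> S"
  then obtain D where D: "(f has_derivative D) (at z)" "\<forall>c v. D (c *\<^sub>C v) = c *\<^sub>C D v"
    using assms(3) unfolding cx_holomorphic_on_def by blast
  from has_derivative_transform_within_open[OF D(1) assms(1) z assms(2)] D(2)
  show "\<exists>D. (g has_derivative D) (at z) \<and> (\<forall>c v. D (c *\<^sub>C v) = c *\<^sub>C D v)" by blast
qed

lemma proj_holomorphic_on_cong:
  assumes "\<And>z. z \<in> S \<Longrightarrow> f z = g z" "proj_holomorphic_on f S"
  shows "proj_holomorphic_on g S"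
proof -
  have "{z \<in> S. g z \<in> chart_domain k} = {z \<in> S. f z \<in> chart_domain k}" for k
    using assms(1) by auto
  moreover have "cx_holomorphic_on (\<lambda>z. chart k (g z)) {z \<in> S. f z \<in> chart_domain k}" for k
    by (rule cx_holomorphic_on_cong[OF open_preimage_chart_domain[OF assms(2)], of _ "\<lambda>z. chart k (f z)"])
      (use assms in \<open>auto simp: proj_holomorphic_on_def\<close>)
  moreover have "continuous_on S g"
    using assms continuous_on_cong[of S S f g] unfolding proj_holomorphic_on_def by auto
  ultimately show ?thesis using assms(2) unfolding proj_holomorphic_on_def by simp
qed

lemma proj_holomorphic_on_lift:
  assumes V: "open V" and \<phi>: "cx_holomorphic_on \<phi> V" and nz: "\<And>z. z \<in> V \<Longrightarrow> \<phi> z \<noteq> 0"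
  shows "proj_holomorphic_on (\<lambda>z. proj (\<phi> z)) V"
proof -
  have cont: "continuous_on V \<phi>" using \<phi> by (rule cx_holomorphic_on_imp_continuous_on)
  have "continuous_on V (\<lambda>z. proj (\<phi> z))"
    unfolding continuous_on_open_vimage[OF V]
  proof (intro allI impI)
    fix B :: "proj_l2 set" assume "open B"
    then have "open {w. w \<noteq> 0 \<and> proj w \<in> B}" by (simp only: open_proj_l2_def)
    from cont[unfolded continuous_on_open_vimage[OF V], rule_format, OF this]
    have "open (\<phi> -` {w. w \<noteq> 0 \<and> proj w \<in> B} \<inter> V)" .
    moreover have "\<phi> -` {w. w \<noteq> 0 \<and> proj w \<in> B} \<inter> V = (\<lambda>z. proj (\<phi> z)) -` B \<inter> V"
      using nz by auto
    ultimately show "open ((\<lambda>z. proj (\<phi> z)) -` B \<inter> V)" by simp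
  qed
  moreover have "cx_holomorphic_on (\<lambda>z. chart k (proj (\<phi> z))) {z \<in> V. proj (\<phi> z) \<in> chart_domain k}" for k
  proof -
    have eq: "{z \<in> V. proj (\<phi> z) \<in> chart_domain k} = {z \<in> V. l2_nth (\<phi> z) k \<noteq> 0}"
      using nz proj_in_chart_domain_iff by auto
    have "open ((\<lambda>z. l2_nth (\<phi> z) k) -` (- {0}) \<inter> V)"
      using continuous_on_open_vimage[OF V] continuous_on_l2_nth[OF cont] by blast
    moreover have "(\<lambda>z. l2_nth (\<phi> z) k) -` (- {0}) \<inter> V = {z \<in> V. l2_nth (\<phi> z) k \<noteq> 0}" by auto
    ultimately have "open {z \<in> V. l2_nth (\<phi> z) k \<noteq> 0}" by simp
    then show ?thesis
      unfolding eq
      by (rule cx_holomorphic_on_cong[OF _ _ cx_holomorphic_on_affine_quotient[OF \<phi> V]])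
        (simp add: chart_proj nz)
  qed
  ultimately show ?thesis using V by (simp add: proj_holomorphic_on_def)
qed

lemma proj_holomorphic_on_local:
  assumes "\<And>z. z \<in> S \<Longrightarrow> \<exists>V. z \<in> V \<and> V \<subseteq> S \<and> proj_holomorphic_on F V"
  shows "proj_holomorphic_on F S"
proof -
  have "open S"
  proof (subst open_subopen, intro ballI)
    fix z assume "z \<in> S"
    then obtain V where "z \<in> V" "V \<subseteq> S" "proj_holomorphic_on F V" using assms by blast
    then show "\<exists>T. open T \<and> z \<in> T \<and> T \<subseteq> S" by (intro exI[of _ V]) (simp add: proj_holomorphic_on_def)
  qed
  moreover have "continuous_on S F"
  proof (rule continuous_at_imp_continuous_on, rule ballI)
    fix z assume "z \<in> S"
    then obtain V where "z \<in> V" "proj_holomorphic_on F V" using assms by blast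
    then show "isCont F z"
      unfolding proj_holomorphic_on_def using continuous_on_eq_continuous_at by blast
  qed
  moreover have "cx_holomorphic_on (\<lambda>z. chart k (F z)) {z \<in> S. F z \<in> chart_domain k}" for k
    unfolding cx_holomorphic_on_def
  proof
    fix z assume z: "z \<in> {z \<in> S. F z \<in> chart_domain k}"
    then obtain V where "z \<in> V" "proj_holomorphic_on F V" using assms by blast
    with z show "\<exists>D. ((\<lambda>z. chart k (F z)) has_derivative D) (at z) \<and> (\<forall>c v. D (c *\<^sub>C v) = c *\<^sub>C D v)"
      unfolding proj_holomorphic_on_def cx_holomorphic_on_def by blast
  qed
  ultimately show ?thesis by (simp add: proj_holomorphic_on_def)
qed

section \<open>Discrete sets as analytic sets of codimension two\<close>

lemma regular_point_isolated:
  fixes A :: "(complex ^ 'n) set"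
  assumes reg: "regular_point_of_dim A d a" and W: "open W" "a \<in> W" "A \<inter> W \<subseteq> {a}"
  shows "d = 0"
proof (rule ccontr)
  assume "d \<noteq> 0"
  obtain V and \<Phi> \<Psi> :: "complex ^ 'n \<Rightarrow> complex ^ 'n" and J :: "'n set" where
    a: "a \<in> A" "a \<in> V" and o: "open (\<Phi> ` V)" and \<Psi>: "cx_holomorphic_on \<Psi> (\<Phi> ` V)" "\<forall>z\<in>V. \<Psi> (\<Phi> z) = z"
    and J: "card J = d" "\<forall>z\<in>V. z \<in> A \<longleftrightarrow> (\<forall>i. i \<notin> J \<longrightarrow> \<Phi> z $ i = 0)"
    using reg unfolding regular_point_of_dim_def by blast
  have "J \<noteq> {}" using J(1) \<open>d \<noteq> 0\<close> by auto
  then obtain i where i: "i \<in> J" by blast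
  have "continuous_on (\<Phi> ` V) \<Psi>" using \<Psi>(1) by (rule cx_holomorphic_on_imp_continuous_on)
  then have "open (\<Psi> -` W \<inter> \<Phi> ` V)" using continuous_on_open_vimage[OF o] W(1) by blast
  moreover have "\<Phi> a \<in> \<Psi> -` W \<inter> \<Phi> ` V" using a \<Psi>(2) W(2) by simp
  ultimately obtain e where e: "0 < e" "ball (\<Phi> a) e \<subseteq> \<Psi> -` W \<inter> \<Phi> ` V" by (rule openE)
  \<comment> \<open>In the straightening coordinates a step along a direction \<open>i\<close> in
    \<open>J\<close> stays in the coordinate subspace, so its preimage is a second point of
    \<open>A\<close> inside \<open>W\<close>.\<close>
  define y where "y = \<Phi> a + axis i (of_real (e / 2))"
  have "norm (axis i x) = norm x" for x :: complex
    by (simp add: norm_eq_sqrt_inner inner_axis_axis)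
  then have "norm (axis i (complex_of_real (e / 2))) = e / 2" using e(1) by simp
  then have "y \<in> ball (\<Phi> a) e" using e(1) by (simp add: y_def dist_norm)
  then have "y \<in> \<Psi> -` W \<inter> \<Phi> ` V" using e(2) by blast
  then obtain z where z: "z \<in> V" "y = \<Phi> z" "\<Psi> y \<in> W" by blast
  then have zW: "z \<in> W" using \<Psi>(2) by simp
  have "\<Phi> z $ m = 0" if "m \<notin> J" for m
  proof -
    have "m \<noteq> i" using that i by auto
    moreover have "\<Phi> a $ m = 0" using J(2) a that by blast
    ultimately show ?thesis unfolding z(2)[symmetric] y_def by (simp add: axis_def)
  qed
  then have "z \<in> A" using J(2) z(1) by blast
  with zW W(3) have "z = a" by blast
  then have "axis i (complex_of_real (e / 2)) = 0" using z(2) by (simp add: y_def)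
  then show False using e(1) by (simp add: axis_eq_0_iff)
qed

text \<open>Near a point \<open>a\<close> of \<open>I\<close> the local equations are
  \<open>z $ i = a $ i\<close>, elsewhere the single equation \<open>1 = 0\<close>. At points
  outside \<open>I\<close> the hypothesis says that \<open>I\<close> is closed.\<close>

lemma analytic_subset_isolated:
  fixes I :: "(complex ^ 2) set"
  assumes "\<And>a. \<exists>W. open W \<and> a \<in> W \<and> I \<inter> W \<subseteq> {a}"
  shows "analytic_subset UNIV I"
  unfolding analytic_subset_def
proof (intro conjI ballI subset_UNIV)
  fix a :: "complex ^ 2"
  obtain W where W: "open W" "a \<in> W" "I \<inter> W \<subseteq> {a}" using assms by blast
  show "\<exists>V G. open V \<and> a \<in> V \<and> V \<subseteq> UNIV \<and> finite G \<and>
      (\<forall>g\<in>G. cx_holomorphic_on (g :: complex ^ 2 \<Rightarrow> complex) V) \<and> I \<inter> V = {z \<in> V. \<forall>g\<in>G. g z = 0}"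
  proof (cases "a \<in> I")
    case True
    let ?G = "range (\<lambda>i z. z $ i - a $ i) :: (complex ^ 2 \<Rightarrow> complex) set"
    have "cx_holomorphic_on (\<lambda>z. z $ i - a $ i) W" for i
      unfolding cx_holomorphic_on_def
    proof
      fix z
      have "((\<lambda>z. z $ i - a $ i) has_derivative (\<lambda>v. v $ i)) (at z)"
        by (auto intro!: derivative_eq_intros bounded_linear.has_derivative[OF bounded_linear_vec_nth])
      then show "\<exists>D. ((\<lambda>z. z $ i - a $ i) has_derivative D) (at z) \<and> (\<forall>c v. D (c *\<^sub>C v) = c *\<^sub>C D v)"
        by (intro exI[of _ "\<lambda>v. v $ i"]) (simp add: scaleC_vec_def)
    qed
    moreover have "{z \<in> W. \<forall>g\<in>?G. g z = 0} = {a}" using W(2) by (auto simp: vec_eq_iff)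
    moreover have "I \<inter> W = {a}" using True W by blast
    ultimately show ?thesis using W by (intro exI[of _ W] exI[of _ ?G]) auto
  next
    case False
    have "cx_holomorphic_on (\<lambda>z :: complex ^ 2. 1 :: complex) W"
      unfolding cx_holomorphic_on_def
    proof
      fix z
      show "\<exists>D. ((\<lambda>z :: complex ^ 2. 1 :: complex) has_derivative D) (at z) \<and> (\<forall>c v. D (c *\<^sub>C v) = c *\<^sub>C D v)"
        by (intro exI[of _ "\<lambda>_. 0"]) simp
    qed
    moreover have "I \<inter> W = {}" using False W by blast
    ultimately show ?thesis using W by (intro exI[of _ W] exI[of _ "{\<lambda>_. 1}"]) auto
  qed
qed

text \<open>Restricting the parameter to a compact interval makes the curve compact, hence
  closed.\<close>

lemma periodic_image:
  fixes \<gamma> :: "real \<Rightarrow> 'a"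
  assumes "\<And>t. \<gamma> (t + 1) = \<gamma> t"
  shows "range \<gamma> = \<gamma> ` {0..1}"
proof -
  have nat: "\<gamma> (t + real n) = \<gamma> t" for t n
  proof (induction n)
    case (Suc n)
    then show ?case using assms[of "t + real n"] by (simp add: algebra_simps)
  qed simp
  have "\<gamma> t = \<gamma> (frac t)" for t
  proof (cases "0 \<le> \<lfloor>t\<rfloor>")
    case True
    then have "t = frac t + real (nat \<lfloor>t\<rfloor>)" by (simp add: frac_def)
    then show ?thesis by (metis nat)
  next
    case False
    then have "frac t = t + real (nat (- \<lfloor>t\<rfloor>))" by (simp add: frac_def)
    then show ?thesis by (metis nat)
  qed
  moreover have "frac t \<in> {0..1}" for t :: real
    using frac_ge_0[of t] frac_lt_1[of t] by simp
  ultimately have "\<gamma> t \<in> \<gamma> ` {0..1}" for t by (metis image_eqI)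
  then show ?thesis by blast
qed

theorem corollary1:
  fixes \<Gamma> :: "(complex ^ 2) set" and f :: "complex ^ 2 \<Rightarrow> proj_l2"
  assumes "C1_closed_curve \<Gamma>"
    and "proj_holomorphic_on f (- \<Gamma>)"
  shows "extends_meromorphically_to (- \<Gamma>) f UNIV"
proof -
  obtain \<gamma> \<gamma>' where \<gamma>: "\<And>t::real. (\<gamma> has_vector_derivative \<gamma>' t) (at t)" "\<And>t. \<gamma> (t + 1) = \<gamma> t"
    and \<Gamma>: "\<Gamma> = range \<gamma>"
    using assms(1) unfolding C1_closed_curve_def by blast
  have diff: "\<gamma> differentiable (at t)" for t
    using \<gamma>(1)[of t] unfolding has_vector_derivative_def differentiable_def by blast
  have "continuous_on {0..1} \<gamma>"
    using diff differentiable_imp_continuous_within by (blast intro: continuous_at_imp_continuous_on)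
  then have clo: "closed (range \<gamma>)"
    unfolding periodic_image[of \<gamma>, OF \<gamma>(2)] by (intro compact_imp_closed compact_continuous_image) auto
  \<comment> \<open>Real dimension one against four: the complement of the curve is dense, so that
    values on the curve are determined by continuity.\<close>
  have "negligible \<Gamma>"
    unfolding \<Gamma>
    by (rule negligible_differentiable_image_lowdim)
      (auto simp: differentiable_on_def intro!: differentiable_at_withinI diff)
  then have thin: "O' - \<Gamma> \<noteq> {}" if "open O'" "O' \<noteq> {}" for O'
    using that open_not_negligible[of O'] negligible_subset by blast
  \<comment> \<open>A nonvanishing local lift. On the curve \<open>f\<close> carries no information,
    so there the lift itself prescribes the value.\<close>
  define Lift where "Lift V \<phi> \<longleftrightarrow> open V \<and> cx_holomorphic_on \<phi> V \<and> (\<forall>z\<in>V. \<phi> z \<noteq> 0) \<and>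
      (\<forall>z\<in>V - \<Gamma>. f z = proj (\<phi> z))" for V and \<phi> :: "complex ^ 2 \<Rightarrow> l2"
  define I where "I = {p \<in> \<Gamma>. \<not> (\<exists>V \<phi>. p \<in> V \<and> Lift V \<phi>)}"
  have "\<forall>q. \<exists>V \<phi>. q \<in> \<Gamma> - I \<longrightarrow> q \<in> V \<and> Lift V \<phi>" unfolding I_def by blast
  then obtain V0 \<phi>0 where lift0: "\<And>q. q \<in> \<Gamma> - I \<Longrightarrow> q \<in> V0 q \<and> Lift (V0 q) (\<phi>0 q)" by metis
  \<comment> \<open>Each point of the curve outside \<open>I\<close> uses the lift chosen for it;
    \<open>F_lift\<close> shows that every other lift gives the same value.\<close>
  define F where "F z = (if z \<in> \<Gamma> - I then proj (\<phi>0 z z) else f z)" for z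
  have F_lift: "z \<notin> I \<and> F z = proj (\<phi> z)" if L: "Lift V \<phi>" and z: "z \<in> V" for V \<phi> z
  proof (cases "z \<in> \<Gamma>")
    case False
    then show ?thesis using L z by (simp add: Lift_def I_def F_def)
  next
    case True
    then have zI: "z \<in> \<Gamma> - I" using L z unfolding I_def by blast
    note L0 = lift0[OF zI]
    have "proj (\<phi>0 z z) = proj (\<phi> z)"
    proof (rule proj_lifts_agree[where V = "V0 z \<inter> V" and \<phi> = "\<phi>0 z" and \<psi> = \<phi> and q = z and \<Gamma> = \<Gamma>,
          OF _ _ _ _ _ _ thin])
      show "open (V0 z \<inter> V)" using L L0 by (auto simp: Lift_def)
      show "continuous_on (V0 z \<inter> V) (\<phi>0 z)" "continuous_on (V0 z \<inter> V) \<phi>"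
        using L L0 unfolding Lift_def
        by (meson cx_holomorphic_on_imp_continuous_on continuous_on_subset inf_le1 inf_le2)+
      show "z \<in> V0 z \<inter> V" "\<phi>0 z z \<noteq> 0" "\<phi> z \<noteq> 0" using L L0 z by (auto simp: Lift_def)
      show "\<phi>0 z y \<noteq> 0 \<and> \<phi> y \<noteq> 0 \<and> proj (\<phi>0 z y) = proj (\<phi> y)" if "y \<in> V0 z \<inter> V - \<Gamma>" for y
        using L L0 that unfolding Lift_def by (metis DiffD1 DiffD2 DiffI IntD1 IntD2)
    qed
    then show ?thesis using zI by (simp add: F_def)
  qed
  \<comment> \<open>The lift has no zero except possibly at \<open>p\<close>. Without
    \<open>p\<close> its neighbourhood therefore misses \<open>I\<close>, which isolates the points
    of \<open>I\<close>; with \<open>p\<close> it supplies the lift demanded of a meromorphic map at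
    such a point.\<close>
  have local: "\<exists>V \<phi>. open V \<and> p \<in> V \<and> cx_holomorphic_on \<phi> V \<and> Lift (V - {p}) \<phi>" if p: "p \<in> \<Gamma>" for p
  proof -
    obtain V \<phi> where V: "open V" "p \<in> V" "cx_holomorphic_on \<phi> V" "\<And>z. z \<in> V \<Longrightarrow> z \<noteq> p \<Longrightarrow> \<phi> z \<noteq> 0"
      "\<And>z. z \<in> V - range \<gamma> \<Longrightarrow> f z = proj (\<phi> z)"
      by (rule local_extension[OF diff clo assms(2)[unfolded \<Gamma>] p[unfolded \<Gamma>]], rule that)
    have "cx_holomorphic_on \<phi> (V - {p})" using V(3) by (simp add: cx_holomorphic_on_def)
    then have "Lift (V - {p}) \<phi>" using V unfolding Lift_def \<Gamma> by (auto intro: open_Diff)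
    then show ?thesis using V(1-3) by blast
  qed
  have oG: "open (- \<Gamma>)" using clo \<Gamma> by (simp add: open_Compl)
  have I\<Gamma>: "I \<subseteq> \<Gamma>" by (auto simp: I_def)
  have iso: "\<exists>W. open W \<and> a \<in> W \<and> I \<inter> W \<subseteq> {a}" for a
  proof (cases "a \<in> \<Gamma>")
    case True
    then obtain V \<phi> where "open V" "a \<in> V" "Lift (V - {a}) \<phi>" using local by blast
    with F_lift show ?thesis by (intro exI[of _ V]) blast
  next
    case False
    then show ?thesis using oG I\<Gamma> by (intro exI[of _ "- \<Gamma>"]) blast
  qed
  have holF: "proj_holomorphic_on F (UNIV - I)"
  proof (rule proj_holomorphic_on_local)
    fix z assume z: "z \<in> UNIV - I"
    show "\<exists>V. z \<in> V \<and> V \<subseteq> UNIV - I \<and> proj_holomorphic_on F V"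
    proof (cases "z \<in> \<Gamma>")
      case False
      have "proj_holomorphic_on F (- \<Gamma>)"
        by (rule proj_holomorphic_on_cong[OF _ assms(2)]) (simp add: F_def)
      then show ?thesis using False I\<Gamma> by (intro exI[of _ "- \<Gamma>"]) blast
    next
      case True
      then obtain V \<phi> where V: "z \<in> V" "Lift V \<phi>" using lift0 z by blast
      have "proj_holomorphic_on (\<lambda>z. proj (\<phi> z)) V"
        using V(2) by (intro proj_holomorphic_on_lift) (auto simp: Lift_def)
      then have "proj_holomorphic_on F V"
        by (rule proj_holomorphic_on_cong[rotated]) (simp add: F_lift[OF V(2)])
      then show ?thesis using V F_lift by blast
    qed
  qed
  have "codim_at_least 2 I"
    unfolding codim_at_least_def
  proof (intro allI impI)
    fix d a assume "regular_point_of_dim I d a"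
    with iso[of a] have "d = 0" using regular_point_isolated by blast
    then show "d + 2 \<le> CARD(2)" by simp
  qed
  moreover have "\<exists>V \<phi>. open V \<and> a \<in> V \<and> V \<subseteq> UNIV \<and> cx_holomorphic_on \<phi> V \<and>
      (\<forall>z\<in>V - I. \<phi> z \<noteq> 0 \<and> F z = proj (\<phi> z))" if a: "a \<in> I" for a
  proof -
    obtain V \<phi> where V: "open V" "a \<in> V" "cx_holomorphic_on \<phi> V" "Lift (V - {a}) \<phi>"
      using local a I\<Gamma> by blast
    have "\<phi> z \<noteq> 0 \<and> F z = proj (\<phi> z)" if "z \<in> V - I" for z
    proof -
      have z: "z \<in> V - {a}" using that a by blast
      then show ?thesis using F_lift[OF V(4) z] V(4) by (simp add: Lift_def)
    qed
    with V(1-3) show ?thesis by blast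
  qed
  ultimately have "meromorphic_map UNIV I F"
    using analytic_subset_isolated[OF iso] holF unfolding meromorphic_map_def by blast
  moreover have "- \<Gamma> \<subseteq> UNIV - I" using I\<Gamma> by blast
  moreover have "\<forall>z\<in>- \<Gamma>. F z = f z" by (simp add: F_def)
  ultimately show ?thesis unfolding extends_meromorphically_to_def by blast
qed

end
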